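(* Assume that $V'$ is globally Lipschitz continuous. Let $(p(t),q(t))_{t\in[0,T]}$ be the solution of the stochastic Hamiltonian system $$dq(t)=p(t)\,dt,\qquad dp(t)=-V'(q(t))\,dt+\Sigma\,dW(t),\qquad (p(0),q(0))=(p_0,q_0),$$ and for $\ell\in\mathbb N_0$ let $(p^\ell_n,q^\ell_n)_{n=0,\dots,2^\ell}$ be its numerical discretization by the drift-preserving scheme $$\Psi_{n+1}=p_n+\Sigma\Delta W_n-\frac h2\int_0^1V'(q_n+sh\Psi_{n+1})\,ds,\quad q_{n+1}=q_n+h\Psi_{n+1},\quad p_{n+1}=p_n+\Sigma\Delta W_n-h\int_0^1V'(q_n+sh\Psi_{n+1})\,ds$$ with step size $h=h_\ell=T\cdot2^{-\ell}$. Then for any differentiable test function $f\colon\mathbb R^{2m}\to\mathbb R$ with derivative of polynomial growth, the multilevel Monte Carlo estimator on level $L>0$ satisfies for any $\epsilon>0$ at the final time $T$ $$\left\|\mathbb E[f(p(T),q(T))]-E^L[f(p^L_{2^L},q^L_{2^L})]\right\|_{L^2(\Omega)}\le\left(C_1+C_3+C_2\,\zeta(1+\epsilon)\right)h_L$$ with constants $C_1,C_2,C_3$ and with sample sizes given by $$M_\ell=\left\lceil 2^{2(L-\ell/2)}\,\ell^{2(1+\epsilon)}\right\rceil,\ \ \ell=1,\dots,L,\qquad M_0=\lceil 2^{2L}\rceil,$$ where $\lceil\cdot\rceil$ denotes the rounding to the next larger integer and $\zeta$ the Riemann zeta function. The resulting computational work is bounded by $$\mathcal W_L=\mathcal O\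!\left(h_L^{-2}L^{3+2\epsilon}\right).$$
   Context: Let $T>0$, let $m,d$ be positive integers, $(\Omega,\mathcal F,\mathbb P)$ a probability space with a normal filtration $(\mathcal F_t)_{t\in[0,T]}$, and $W$ a standard $\mathbb R^d$-valued $(\mathcal F_t)$-Brownian motion with continuous sample paths. $V\colon\mathbb R^m\to\mathbb R$ is a smooth potential with gradient $V'$, $H(p,q)=\frac12\sum_{j=1}^m p_j^2+V(q)$ is the associated separable Hamiltonian, and $\Sigma\in\mathbb R^{m\times d}$ is a constant matrix. The initial values have finite expected energy, $\mathbb E[H(p_0,q_0)]<+\infty$. The nested level-$\ell$ time grid is $t^\ell_n=T\cdot n\cdot 2^{-\ell}$, $n=0,\dots,2^\ell$; the scheme on level $\ell$ starts from $(p_0,q_0)$ and uses the Wiener increments $\Delta W_n=W(t^\ell_{n+1})-W(t^\ell_n)$. Step sizes are understood to satisfy $0<h\le h^*$, where $h^*>0$ (possibly depending on $f$) is the threshold below which the scheme converges with order $1$ in mean square and, for the test function $f$, with order $1$ weakly. For a real random variable $Y$, $\|Y\|_{L^2(\Omega)}=\mathbb E[|Y|^2]^{1/2}$, and $E_M[Y]=M^{-1}\sum_{i=1}^M\hat Y^i$ is the Monte Carlo estimator based on $M$ independent, identically distributed samples $\hat Y^i$ of $Y$. For a sequence $(Y_\ell)_{\ell\in\mathbb N_0}$ of approximations of $Y$, the multilevel Monte Carlo estimator of $\mathbb E[Y_L]$ is $$E^L[Y_L]=E_{M_0}[Y_0]+\sum_{\ell=1}^LE_{M_\ell}[Y_\ell-Y_{\ell-1}],$$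 with a number $M_\ell$ of independent samples depending on the level; here $Y_\ell=f(p^\ell_{2^\ell},q^\ell_{2^\ell})$. The cost of one sample on level $\ell$ is taken to be of order $h_\ell^{-1}$.
   Formalization: Adds: initial values have finite moment of order 2(r+1), r the growth exponent of f'. Finite expected energy is not enough: V=0, Σ=0, f=|p|², E|p_0|²<∞=E|p_0|⁴ gives the Monte Carlo mean infinite L² error. *)

theory Defs
  imports "HOL-Probability.Probability"
begin

section \<open>Smooth functions and the Hamiltonian\<close>

primrec k_times_cont_diff :: "nat \<Rightarrow> ('a::euclidean_space \<Rightarrow> real) \<Rightarrow> bool" where
  "k_times_cont_diff 0 g \<longleftrightarrow> continuous_on UNIV g"
| "k_times_cont_diff (Suc k) g \<longleftrightarrow>
     (\<forall>x. g differentiable (at x)) \<and>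
     (\<forall>b\<in>Basis. k_times_cont_diff k (\<lambda>x. frechet_derivative g (at x) b))"

definition smooth :: "('a::euclidean_space \<Rightarrow> real) \<Rightarrow> bool" where
  "smooth g \<longleftrightarrow> (\<forall>k. k_times_cont_diff k g)"

definition hamiltonian :: "(real ^ 'm \<Rightarrow> real) \<Rightarrow> real ^ 'm \<Rightarrow> real ^ 'm \<Rightarrow> real" where
  "hamiltonian V p q = (1 / 2) * (\<Sum>j\<in>UNIV. (p $ j)\<^sup>2) + V q"

section \<open>Filtrations and Brownian motion\<close>

text \<open>The library's filtrations are indexed by a whole type. Only the indices in \<open>{0..T}\<close> matter
  below, and a filtration on \<open>{0..T}\<close> extends constantly to the left and to the right.\<close>

definition normal_filtration :: "'a measure \<Rightarrow> real \<Rightarrow> (real \<Rightarrow> 'a measure) \<Rightarrow> bool" where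
  "normal_filtration M T F \<longleftrightarrow>
     filtration (space M) F \<and>
     (\<forall>t\<in>{0..T}. subalgebra M (F t)) \<and>
     null_sets M \<subseteq> sets (F 0) \<and>
     (\<forall>t\<in>{0..<T}. sets (F t) = (\<Inter>s\<in>{t<..T}. sets (F s)))"

definition brownian_motion ::
    "'a measure \<Rightarrow> real \<Rightarrow> (real \<Rightarrow> 'a measure) \<Rightarrow> (real \<Rightarrow> 'a \<Rightarrow> real ^ 'd) \<Rightarrow> bool" where
  "brownian_motion M T F W \<longleftrightarrow>
     (\<forall>t\<in>{0..T}. W t \<in> borel_measurable (F t)) \<and>
     (AE \<omega> in M. W 0 \<omega> = 0) \<and>
     (\<forall>\<omega>\<in>space M. continuous_on {0..T} (\<lambda>t. W t \<omega>)) \<and>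
     (\<forall>s t. 0 \<le> s \<longrightarrow> s < t \<longrightarrow> t \<le> T \<longrightarrow>
        prob_space.indep_set M (sets (F s))
          {(\<lambda>\<omega>. W t \<omega> - W s \<omega>) -` A \<inter> space M | A. A \<in> sets borel} \<and>
        distributed M lborel (\<lambda>\<omega>. W t \<omega> - W s \<omega>)
          (\<lambda>x. ennreal (\<Prod>i\<in>UNIV. normal_density 0 (sqrt (t - s)) (x $ i))))"

section \<open>The stochastic Hamiltonian system\<close>

text \<open>The noise is additive with constant coefficient, so the stochastic integral of \<open>\<Sigma>\<close> over
  \<open>{0..t}\<close> is \<open>\<Sigma> *v (W t - W 0)\<close> and the equation is a pathwise integral equation.\<close>

definition hamiltonian_sde_solution ::
    "'a measure \<Rightarrow> real \<Rightarrow> (real \<Rightarrow> 'a measure) \<Rightarrow> (real \<Rightarrow> 'a \<Rightarrow> real ^ 'd) \<Rightarrow>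
     (real ^ 'm \<Rightarrow> real ^ 'm) \<Rightarrow> real ^ 'd ^ 'm \<Rightarrow> ('a \<Rightarrow> real ^ 'm) \<Rightarrow> ('a \<Rightarrow> real ^ 'm) \<Rightarrow>
     (real \<Rightarrow> 'a \<Rightarrow> real ^ 'm) \<Rightarrow> (real \<Rightarrow> 'a \<Rightarrow> real ^ 'm) \<Rightarrow> bool" where
  "hamiltonian_sde_solution M T F W V' \<Sigma> p\<^sub>0 q\<^sub>0 p q \<longleftrightarrow>
     (\<forall>t\<in>{0..T}. p t \<in> borel_measurable (F t) \<and> q t \<in> borel_measurable (F t)) \<and>
     (AE \<omega> in M.
        continuous_on {0..T} (\<lambda>t. p t \<omega>) \<and> continuous_on {0..T} (\<lambda>t. q t \<omega>) \<and>
        (\<forall>t\<in>{0..T}.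
           q t \<omega> = q\<^sub>0 \<omega> + integral {0..t} (\<lambda>s. p s \<omega>) \<and>
           p t \<omega> = p\<^sub>0 \<omega> - integral {0..t} (\<lambda>s. V' (q s \<omega>)) + \<Sigma> *v (W t \<omega> - W 0 \<omega>)))"

definition hamiltonian_setting ::
    "'a measure \<Rightarrow> real \<Rightarrow> (real \<Rightarrow> 'a measure) \<Rightarrow> (real \<Rightarrow> 'a \<Rightarrow> real ^ 'd) \<Rightarrow>
     (real ^ 'm \<Rightarrow> real) \<Rightarrow> (real ^ 'm \<Rightarrow> real ^ 'm) \<Rightarrow> real ^ 'd ^ 'm \<Rightarrow>
     ('a \<Rightarrow> real ^ 'm) \<Rightarrow> ('a \<Rightarrow> real ^ 'm) \<Rightarrow>
     (real \<Rightarrow> 'a \<Rightarrow> real ^ 'm) \<Rightarrow> (real \<Rightarrow> 'a \<Rightarrow> real ^ 'm) \<Rightarrow> bool" where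
  "hamiltonian_setting M T F W V V' \<Sigma> p\<^sub>0 q\<^sub>0 p q \<longleftrightarrow>
     0 < T \<and> prob_space M \<and> normal_filtration M T F \<and> brownian_motion M T F W \<and>
     p\<^sub>0 \<in> borel_measurable (F 0) \<and> q\<^sub>0 \<in> borel_measurable (F 0) \<and>
     integrable M (\<lambda>\<omega>. hamiltonian V (p\<^sub>0 \<omega>) (q\<^sub>0 \<omega>)) \<and>
     hamiltonian_sde_solution M T F W V' \<Sigma> p\<^sub>0 q\<^sub>0 p q"

section \<open>The drift-preserving scheme\<close>

text \<open>One step from \<open>(p, q)\<close> to \<open>(p', q')\<close>, with \<open>w\<close> in the role of \<open>\<Sigma> \<Delta>W\<^sub>n\<close>. The equation for
  \<open>\<Psi>\<close> is implicit; it need not be uniquely solvable for large \<open>h\<close>, hence a relation.\<close>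

definition drift_preserving_step ::
    "(real ^ 'm \<Rightarrow> real ^ 'm) \<Rightarrow> real \<Rightarrow> real ^ 'm \<Rightarrow> real ^ 'm \<Rightarrow> real ^ 'm \<Rightarrow>
     real ^ 'm \<Rightarrow> real ^ 'm \<Rightarrow> bool" where
  "drift_preserving_step V' h w p q p' q' \<longleftrightarrow>
     (\<exists>\<Psi>. \<Psi> = p + w - (h / 2) *\<^sub>R integral {0..1} (\<lambda>s. V' (q + (s * h) *\<^sub>R \<Psi>)) \<and>
          q' = q + h *\<^sub>R \<Psi> \<and>
          p' = p + w - h *\<^sub>R integral {0..1} (\<lambda>s. V' (q + (s * h) *\<^sub>R \<Psi>)))"

definition drift_preserving_scheme ::
    "'a measure \<Rightarrow> (real \<Rightarrow> 'a measure) \<Rightarrow> (real \<Rightarrow> 'a \<Rightarrow> real ^ 'd) \<Rightarrow>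
     (real ^ 'm \<Rightarrow> real ^ 'm) \<Rightarrow> real ^ 'd ^ 'm \<Rightarrow> ('a \<Rightarrow> real ^ 'm) \<Rightarrow> ('a \<Rightarrow> real ^ 'm) \<Rightarrow>
     real \<Rightarrow> nat \<Rightarrow> (nat \<Rightarrow> 'a \<Rightarrow> real ^ 'm) \<Rightarrow> (nat \<Rightarrow> 'a \<Rightarrow> real ^ 'm) \<Rightarrow> bool" where
  "drift_preserving_scheme M F W V' \<Sigma> p\<^sub>0 q\<^sub>0 h N P Q \<longleftrightarrow>
     (\<forall>n\<le>N. P n \<in> borel_measurable (F (real n * h)) \<and> Q n \<in> borel_measurable (F (real n * h))) \<and>
     (AE \<omega> in M.
        P 0 \<omega> = p\<^sub>0 \<omega> \<and> Q 0 \<omega> = q\<^sub>0 \<omega> \<and>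
        (\<forall>n<N. drift_preserving_step V' h
           (\<Sigma> *v (W (real (Suc n) * h) \<omega> - W (real n * h) \<omega>))
           (P n \<omega>) (Q n \<omega>) (P (Suc n) \<omega>) (Q (Suc n) \<omega>)))"

definition L2_norm :: "'a measure \<Rightarrow> ('a \<Rightarrow> 'b::real_normed_vector) \<Rightarrow> real" where
  "L2_norm M Y = sqrt (\<integral>\<omega>. (norm (Y \<omega>))\<^sup>2 \<partial>M)"

text \<open>\<open>hs\<close> is a step size threshold below which the scheme converges with order 1. A Bochner
  integral is 0 where it does not exist, so integrability is stated separately.\<close>

definition mean_square_order_one ::
    "'a measure \<Rightarrow> real \<Rightarrow> (real \<Rightarrow> 'a measure) \<Rightarrow> (real \<Rightarrow> 'a \<Rightarrow> real ^ 'd) \<Rightarrow>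
     (real ^ 'm \<Rightarrow> real ^ 'm) \<Rightarrow> real ^ 'd ^ 'm \<Rightarrow> ('a \<Rightarrow> real ^ 'm) \<Rightarrow> ('a \<Rightarrow> real ^ 'm) \<Rightarrow>
     (real \<Rightarrow> 'a \<Rightarrow> real ^ 'm) \<Rightarrow> (real \<Rightarrow> 'a \<Rightarrow> real ^ 'm) \<Rightarrow> real \<Rightarrow> bool" where
  "mean_square_order_one M T F W V' \<Sigma> p\<^sub>0 q\<^sub>0 p q hs \<longleftrightarrow>
     (\<exists>C. \<forall>N P Q h. 0 < N \<and> h = T / real N \<and> h \<le> hs \<and>
        drift_preserving_scheme M F W V' \<Sigma> p\<^sub>0 q\<^sub>0 h N P Q \<longrightarrow>
        (\<forall>n\<le>N.
           integrable M (\<lambda>\<omega>. (norm (p (real n * h) \<omega> - P n \<omega>, q (real n * h) \<omega> - Q n \<omega>))\<^sup>2) \<and>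
           L2_norm M (\<lambda>\<omega>. (p (real n * h) \<omega> - P n \<omega>, q (real n * h) \<omega> - Q n \<omega>)) \<le> C * h))"

definition weak_order_one ::
    "'a measure \<Rightarrow> real \<Rightarrow> (real \<Rightarrow> 'a measure) \<Rightarrow> (real \<Rightarrow> 'a \<Rightarrow> real ^ 'd) \<Rightarrow>
     (real ^ 'm \<Rightarrow> real ^ 'm) \<Rightarrow> real ^ 'd ^ 'm \<Rightarrow> ('a \<Rightarrow> real ^ 'm) \<Rightarrow> ('a \<Rightarrow> real ^ 'm) \<Rightarrow>
     (real \<Rightarrow> 'a \<Rightarrow> real ^ 'm) \<Rightarrow> (real \<Rightarrow> 'a \<Rightarrow> real ^ 'm) \<Rightarrow>
     ((real ^ 'm) \<times> (real ^ 'm) \<Rightarrow> real) \<Rightarrow> real \<Rightarrow> bool" where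
  "weak_order_one M T F W V' \<Sigma> p\<^sub>0 q\<^sub>0 p q f hs \<longleftrightarrow>
     integrable M (\<lambda>\<omega>. f (p T \<omega>, q T \<omega>)) \<and>
     (\<exists>C. \<forall>N P Q h. 0 < N \<and> h = T / real N \<and> h \<le> hs \<and>
        drift_preserving_scheme M F W V' \<Sigma> p\<^sub>0 q\<^sub>0 h N P Q \<longrightarrow>
        integrable M (\<lambda>\<omega>. f (P N \<omega>, Q N \<omega>)) \<and>
        \<bar>(\<integral>\<omega>. f (p T \<omega>, q T \<omega>) \<partial>M) - (\<integral>\<omega>. f (P N \<omega>, Q N \<omega>) \<partial>M)\<bar> \<le> C * h)"

section \<open>Multilevel Monte Carlo\<close>

definition step_size :: "real \<Rightarrow> nat \<Rightarrow> real" where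
  "step_size T l = T / 2 ^ l"

definition iid_samples :: "'a measure \<Rightarrow> ('a \<Rightarrow> real) \<Rightarrow> nat \<Rightarrow> (nat \<Rightarrow> 'a \<Rightarrow> real) \<Rightarrow> bool" where
  "iid_samples M Y n S \<longleftrightarrow>
     prob_space.indep_vars M (\<lambda>_. borel) S {1..n} \<and>
     (\<forall>i\<in>{1..n}. distr M borel (S i) = distr M borel Y)"

definition mc_estimator :: "nat \<Rightarrow> (nat \<Rightarrow> 'a \<Rightarrow> real) \<Rightarrow> 'a \<Rightarrow> real" where
  "mc_estimator n S \<omega> = (1 / real n) * (\<Sum>i=1..n. S i \<omega>)"

text \<open>\<open>S l i\<close> is the \<open>i\<close>-th sample on level \<open>l\<close>: of \<open>Y 0\<close> for \<open>l = 0\<close> and of \<open>Y l - Y (l - 1)\<close>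
  for \<open>l > 0\<close>. No joint law of samples on different levels is prescribed.\<close>

definition mlmc_samples ::
    "'a measure \<Rightarrow> (nat \<Rightarrow> 'a \<Rightarrow> real) \<Rightarrow> (nat \<Rightarrow> nat) \<Rightarrow> nat \<Rightarrow> (nat \<Rightarrow> nat \<Rightarrow> 'a \<Rightarrow> real) \<Rightarrow> bool" where
  "mlmc_samples M Y m L S \<longleftrightarrow>
     iid_samples M (Y 0) (m 0) (S 0) \<and>
     (\<forall>l\<in>{1..L}. iid_samples M (\<lambda>\<omega>. Y l \<omega> - Y (l - 1) \<omega>) (m l) (S l))"

definition mlmc_estimator ::
    "(nat \<Rightarrow> nat) \<Rightarrow> nat \<Rightarrow> (nat \<Rightarrow> nat \<Rightarrow> 'a \<Rightarrow> real) \<Rightarrow> 'a \<Rightarrow> real" where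
  "mlmc_estimator m L S \<omega> =
     mc_estimator (m 0) (S 0) \<omega> + (\<Sum>l=1..L. mc_estimator (m l) (S l) \<omega>)"

definition sample_size :: "real \<Rightarrow> nat \<Rightarrow> nat \<Rightarrow> nat" where
  "sample_size \<epsilon> L l =
     (if l = 0 then nat \<lceil>2 powr (2 * real L)\<rceil>
      else nat \<lceil>2 powr (2 * (real L - real l / 2)) * real l powr (2 * (1 + \<epsilon>))\<rceil>)"

definition mlmc_work :: "(nat \<Rightarrow> real) \<Rightarrow> (nat \<Rightarrow> nat) \<Rightarrow> nat \<Rightarrow> real" where
  "mlmc_work cost m L = (\<Sum>l=0..L. real (m l) * cost l)"

text \<open>The Riemann zeta function on the real half-line \<open>s > 1\<close>.\<close>

definition riemann_zeta :: "real \<Rightarrow> real" where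
  "riemann_zeta s = (\<Sum>k. 1 / real (Suc k) powr s)"

end

theory Submission
  imports Defs
begin

text \<open>The noise is additive, so exact and numerical solution can be compared pathwise. Since \<open>q\<close> is
  differentiable in time, the error of a step is \<open>O(h\<^sup>2)\<close> up to the integral of \<open>w s - w t\<close>, with \<open>w\<close>
  the noise and \<open>t\<close> the end point of the step. Discrete Gronwall reduces everything to the sum \<open>\<rho>\<close> of
  these integrals. As a limit of combinations of independent centred increments with coefficients at
  most \<open>h\<close>, \<open>\<rho>\<close> has order 1 in mean square; a cruder convexity bound gives order 1/2 in all moments.

  For \<open>f\<close> with derivative of growth \<open>r\<close>, the mean square order 1 and moments of order \<open>2 * r\<close> give weak
  order 1, and order 1/2 in the moment of order \<open>2 * (r + 1)\<close> gives \<open>f(X) - f(X\<^sub>h) = O(h\<^sup>1\<^sup>/\<^sup>2)\<close> in L2, which is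
  all that the multilevel variance estimate needs: with the given sample sizes, level \<open>l\<close> contributes
  a multiple of \<open>h\<^sub>L / l powr (1 + \<epsilon>)\<close>.\<close>

section \<open>Bounds on moments\<close>

text \<open>The order 1 of \<open>noise_error\<close> cannot be seen step by step: the integral over
  a single step has size \<open>h powr (3 / 2)\<close>, and \<open>1 / h\<close> such terms add up
  to order 1/2 only, unless norms are taken after summation, where the orthogonality of Brownian
  increments gains another half order. Hence the pathwise estimate keeps the vector sum intact. Its
  right-hand side contains sums and time integrals of noise norms but no maximum over time, so that
  moments at single times suffice. Since \<open>f\<close> is only once differentiable, the weak
  error is read off from the strong one; the factor of polynomial growth and the error are separated
  by inequalities with weights depending on \<open>h\<close>, for which the moments at hand are just
  enough. The threshold \<open>1 / (2 * B)\<close>, with \<open>B \<ge> 1\<close> a Lipschitz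
  constant of \<open>V'\<close>, lets the implicit stage \<open>\<Psi>\<close> be absorbed. The
  levels of the estimator have no prescribed joint law, so their errors are added as L2 norms; this
  is why \<open>riemann_zeta\<close> is evaluated at \<open>1 + \<epsilon>\<close>.\<close>

text \<open>An upper bound \<open>c\<close> on the moment of order \<open>k\<close>. The nonnegative
  integral lets bounds be combined before integrability is known and meets Fatou's lemma directly;
  integrability is recovered in \<open>moment_leD\<close>. Measurability is carried along, and
  \<open>0 \<le> c\<close> guards against \<open>ennreal\<close> sending negative numbers to
  0.\<close>

definition moment_le :: "'a measure \<Rightarrow> nat \<Rightarrow> ('a \<Rightarrow> real) \<Rightarrow> real \<Rightarrow> bool" where
  "moment_le M k X c \<longleftrightarrow>
     0 \<le> c \<and> X \<in> borel_measurable M \<and> (\<integral>\<^sup>+ \<omega>. ennreal (\<bar>X \<omega>\<bar> ^ k) \<partial>M) \<le> ennreal c"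

lemma moment_leD:
  assumes "moment_le M k X c"
  shows "0 \<le> c" "X \<in> borel_measurable M" "(\<integral>\<^sup>+ \<omega>. ennreal (\<bar>X \<omega>\<bar> ^ k) \<partial>M) \<le> ennreal c"
    "integrable M (\<lambda>\<omega>. \<bar>X \<omega>\<bar> ^ k)" "(\<integral>\<omega>. \<bar>X \<omega>\<bar> ^ k \<partial>M) \<le> c"
proof -
  show *: "0 \<le> c" "X \<in> borel_measurable M" "(\<integral>\<^sup>+ \<omega>. ennreal (\<bar>X \<omega>\<bar> ^ k) \<partial>M) \<le> ennreal c"
    using assms by (auto simp: moment_le_def)
  have [measurable]: "X \<in> borel_measurable M" by (rule *(2))
  show i: "integrable M (\<lambda>\<omega>. \<bar>X \<omega>\<bar> ^ k)"
    using le_less_trans[OF *(3) ennreal_less_top] by (intro integrableI_bounded) simp_all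
  then show "(\<integral>\<omega>. \<bar>X \<omega>\<bar> ^ k \<partial>M) \<le> c"
    using *(1,3) nn_integral_eq_integral[OF i] by (simp add: ennreal_le_iff)
qed

lemma moment_leI:
  assumes "X \<in> borel_measurable M" "integrable M (\<lambda>\<omega>. \<bar>X \<omega>\<bar> ^ k)" "(\<integral>\<omega>. \<bar>X \<omega>\<bar> ^ k \<partial>M) \<le> c"
  shows "moment_le M k X c"
proof -
  have "0 \<le> (\<integral>\<omega>. \<bar>X \<omega>\<bar> ^ k \<partial>M)" by simp
  then have "0 \<le> c" using assms(3) by linarith
  then show ?thesis
    using assms nn_integral_eq_integral[OF assms(2)] by (simp add: moment_le_def ennreal_leI)
qed

lemma moment_le_weaken: "moment_le M k X c \<Longrightarrow> c \<le> d \<Longrightarrow> moment_le M k X d"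
  unfolding moment_le_def by (meson ennreal_leI order_trans)

lemma moment_le_mono:
  assumes "moment_le M k Y c" "X \<in> borel_measurable M" "AE \<omega> in M. \<bar>X \<omega>\<bar> \<le> \<bar>Y \<omega>\<bar>"
  shows "moment_le M k X c"
proof -
  have "(\<integral>\<^sup>+ \<omega>. ennreal (\<bar>X \<omega>\<bar> ^ k) \<partial>M) \<le> (\<integral>\<^sup>+ \<omega>. ennreal (\<bar>Y \<omega>\<bar> ^ k) \<partial>M)"
    using assms(3) by (intro nn_integral_mono_AE) (auto intro!: ennreal_leI power_mono elim!: eventually_mono)
  also have "\<dots> \<le> ennreal c" using moment_leD(3)[OF assms(1)] .
  finally show ?thesis using assms(1,2) by (simp add: moment_le_def)
qed

lemma power_add_le_two_power:
  fixes x y :: real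
  assumes "0 \<le> x" "0 \<le> y"
  shows "(x + y) ^ k \<le> 2 ^ k * (x ^ k + y ^ k)"
proof -
  have "(x + y) ^ k \<le> (2 * max x y) ^ k" using assms by (intro power_mono) auto
  also have "\<dots> = 2 ^ k * (max x y) ^ k" by (simp add: power_mult_distrib)
  also have "(max x y) ^ k \<le> x ^ k + y ^ k" using assms by (auto simp: max_def)
  finally show ?thesis by simp
qed

lemma moment_le_add:
  assumes X: "moment_le M k X c" and Y: "moment_le M k Y d"
  shows "moment_le M k (\<lambda>\<omega>. X \<omega> + Y \<omega>) (2 ^ k * (c + d))"
proof -
  have [measurable]: "X \<in> borel_measurable M" "Y \<in> borel_measurable M"
    using moment_leD(2) X Y by blast+
  have c: "0 \<le> c" "0 \<le> d" using moment_leD(1) X Y by blast+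
  have "(\<integral>\<^sup>+ \<omega>. ennreal (\<bar>X \<omega> + Y \<omega>\<bar> ^ k) \<partial>M)
      \<le> (\<integral>\<^sup>+ \<omega>. ennreal (2 ^ k) * (ennreal (\<bar>X \<omega>\<bar> ^ k) + ennreal (\<bar>Y \<omega>\<bar> ^ k)) \<partial>M)"
  proof (rule nn_integral_mono)
    fix \<omega>
    have "\<bar>X \<omega> + Y \<omega>\<bar> ^ k \<le> (\<bar>X \<omega>\<bar> + \<bar>Y \<omega>\<bar>) ^ k" by (intro power_mono) auto
    also have "\<dots> \<le> 2 ^ k * (\<bar>X \<omega>\<bar> ^ k + \<bar>Y \<omega>\<bar> ^ k)" by (rule power_add_le_two_power) auto
    finally have "ennreal (\<bar>X \<omega> + Y \<omega>\<bar> ^ k) \<le> ennreal (2 ^ k * (\<bar>X \<omega>\<bar> ^ k + \<bar>Y \<omega>\<bar> ^ k))"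
      by (rule ennreal_leI)
    then show "ennreal (\<bar>X \<omega> + Y \<omega>\<bar> ^ k) \<le> ennreal (2 ^ k) * (ennreal (\<bar>X \<omega>\<bar> ^ k) + ennreal (\<bar>Y \<omega>\<bar> ^ k))"
      by (simp add: ennreal_mult)
  qed
  also have "\<dots> = ennreal (2 ^ k) * ((\<integral>\<^sup>+ \<omega>. ennreal (\<bar>X \<omega>\<bar> ^ k) \<partial>M) + (\<integral>\<^sup>+ \<omega>. ennreal (\<bar>Y \<omega>\<bar> ^ k) \<partial>M))"
    by (subst nn_integral_cmult, simp, subst nn_integral_add) auto
  also have "\<dots> \<le> ennreal (2 ^ k) * (ennreal c + ennreal d)"
    by (intro mult_left_mono add_mono moment_leD(3) X Y) auto
  also have "\<dots> = ennreal (2 ^ k * (c + d))" using c by (simp add: ennreal_mult)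
  finally show ?thesis using c by (simp add: moment_le_def)
qed

lemma moment_le_cmult:
  assumes X: "moment_le M k X c"
  shows "moment_le M k (\<lambda>\<omega>. a * X \<omega>) (\<bar>a\<bar> ^ k * c)"
proof -
  have [measurable]: "X \<in> borel_measurable M" using moment_leD(2) X by blast
  have c: "0 \<le> c" using moment_leD(1) X by blast
  have "(\<integral>\<^sup>+ \<omega>. ennreal (\<bar>a * X \<omega>\<bar> ^ k) \<partial>M) = ennreal (\<bar>a\<bar> ^ k) * (\<integral>\<^sup>+ \<omega>. ennreal (\<bar>X \<omega>\<bar> ^ k) \<partial>M)"
    by (subst nn_integral_cmult[symmetric]) (auto simp: abs_mult power_mult_distrib ennreal_mult)
  also have "\<dots> \<le> ennreal (\<bar>a\<bar> ^ k) * ennreal c"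
    by (intro mult_left_mono moment_leD(3) X) auto
  finally show ?thesis using c by (simp add: moment_le_def ennreal_mult)
qed

lemma (in prob_space) moment_le_const: "moment_le M k (\<lambda>_. a) (\<bar>a\<bar> ^ k)"
  by (simp add: moment_le_def emeasure_space_1)

text \<open>Convexity of the power on the nonnegative half-line, with the normalised weights
  \<open>a i / A\<close>; clearing denominators leaves \<open>A ^ k\<close>. Odd powers are in
  general convex only there, hence the case split on parity.\<close>

lemma jensen_power_sum:
  fixes a x :: "'i \<Rightarrow> real"
  assumes "finite I" "\<And>i. i \<in> I \<Longrightarrow> 0 \<le> a i" "\<And>i. i \<in> I \<Longrightarrow> 0 \<le> x i" "(\<Sum>i\<in>I. a i) = A" "0 < A"
  shows "(\<Sum>i\<in>I. a i * x i) ^ Suc k \<le> A ^ k * (\<Sum>i\<in>I. a i * x i ^ Suc k)"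
proof -
  have cvx: "convex_on {0..} (\<lambda>x::real. x ^ Suc k)"
  proof (cases "even (Suc k)")
    case True
    then show ?thesis using convex_on_subset[OF convex_power_even, of "Suc k" "{0..}"] by simp
  next
    case False
    then show ?thesis using convex_power_odd by blast
  qed
  have ne: "I \<noteq> {}" using assms by auto
  have "(\<Sum>i\<in>I. (a i / A) *\<^sub>R x i) ^ Suc k \<le> (\<Sum>i\<in>I. (a i / A) * (x i ^ Suc k))"
    by (rule convex_on_sum[OF \<open>finite I\<close> ne cvx])
       (use assms in \<open>auto simp: sum_divide_distrib[symmetric] divide_simps\<close>)
  then have "(\<Sum>i\<in>I. a i * x i) ^ Suc k / A ^ Suc k \<le> (\<Sum>i\<in>I. a i * x i ^ Suc k) / A"
    by (simp add: sum_divide_distrib[symmetric] power_divide del: power_Suc)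
  then show ?thesis using \<open>0 < A\<close> by (simp add: field_simps)
qed

text \<open>Jensen's inequality, integrated. The \<open>X i\<close> may depend on each other in any
  way, so it serves for sums over coordinates, for averages over time grids whose total weight stays
  bounded, and for the L2 triangle inequality.\<close>

lemma moment_le_weighted_sum:
  assumes I: "finite I" and a: "\<And>i. i \<in> I \<Longrightarrow> 0 \<le> a i" and A: "(\<Sum>i\<in>I. a i) \<le> A"
    and X: "\<And>i. i \<in> I \<Longrightarrow> moment_le M k (X i) c" and c: "0 \<le> c" and k: "0 < k"
  shows "moment_le M k (\<lambda>\<omega>. \<Sum>i\<in>I. a i * X i \<omega>) (A ^ k * c)"
proof -
  \<comment> \<open>The exact total weight, by which Jensen divides; the bound \<open>A\<close>
    enters only at the end. For \<open>A' = 0\<close> all weights vanish and the sum is 0.\<close>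
  define A' where "A' = (\<Sum>i\<in>I. a i)"
  have A'0: "0 \<le> A'" unfolding A'_def using a by (rule sum_nonneg)
  have [measurable]: "i \<in> I \<Longrightarrow> X i \<in> borel_measurable M" for i using X moment_leD(2) by blast
  have m: "(\<lambda>\<omega>. \<Sum>i\<in>I. a i * X i \<omega>) \<in> borel_measurable M" by measurable
  obtain j where j: "k = Suc j" using k gr0_implies_Suc by blast
  have AA: "A' ^ k \<le> A ^ k" using A A'0 unfolding A'_def by (rule power_mono)
  show ?thesis
  proof (cases "A' = 0")
    case True
    then have "\<And>i. i \<in> I \<Longrightarrow> a i = 0" using a I unfolding A'_def by (simp add: sum_nonneg_eq_0_iff)
    then have "(\<Sum>i\<in>I. a i * X i \<omega>) = 0" for \<omega> by simp
    moreover have "0 \<le> A ^ k * c" using AA A'0 c by (meson mult_nonneg_nonneg order_trans zero_le_power)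
    ultimately show ?thesis using k by (simp add: moment_le_def power_0_left)
  next
    case False
    have "(\<integral>\<^sup>+ \<omega>. ennreal (\<bar>\<Sum>i\<in>I. a i * X i \<omega>\<bar> ^ k) \<partial>M)
      \<le> (\<integral>\<^sup>+ \<omega>. (\<Sum>i\<in>I. ennreal (A' ^ j * a i) * ennreal (\<bar>X i \<omega>\<bar> ^ k)) \<partial>M)"
    proof (rule nn_integral_mono)
      fix \<omega>
      have "\<bar>\<Sum>i\<in>I. a i * X i \<omega>\<bar> ^ k \<le> (\<Sum>i\<in>I. a i * \<bar>X i \<omega>\<bar>) ^ k"
        by (intro power_mono order_trans[OF sum_abs]) (use a in \<open>auto simp: abs_mult intro!: sum_mono\<close>)
      also have "\<dots> \<le> A' ^ j * (\<Sum>i\<in>I. a i * \<bar>X i \<omega>\<bar> ^ k)"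
        unfolding j by (rule jensen_power_sum[OF I a]) (use A'_def A'0 False in auto)
      also have "\<dots> = (\<Sum>i\<in>I. A' ^ j * a i * \<bar>X i \<omega>\<bar> ^ k)" by (simp add: sum_distrib_left mult_ac)
      finally have "ennreal (\<bar>\<Sum>i\<in>I. a i * X i \<omega>\<bar> ^ k) \<le> ennreal (\<Sum>i\<in>I. A' ^ j * a i * \<bar>X i \<omega>\<bar> ^ k)"
        by (rule ennreal_leI)
      also have "\<dots> = (\<Sum>i\<in>I. ennreal (A' ^ j * a i) * ennreal (\<bar>X i \<omega>\<bar> ^ k))"
        using a A'0 by (subst sum_ennreal[symmetric]) (auto simp: ennreal_mult intro!: sum.cong)
      finally show "ennreal (\<bar>\<Sum>i\<in>I. a i * X i \<omega>\<bar> ^ k) \<le> (\<Sum>i\<in>I. ennreal (A' ^ j * a i) * ennreal (\<bar>X i \<omega>\<bar> ^ k))" .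
    qed
    also have "\<dots> = (\<Sum>i\<in>I. ennreal (A' ^ j * a i) * (\<integral>\<^sup>+ \<omega>. ennreal (\<bar>X i \<omega>\<bar> ^ k) \<partial>M))"
      by (subst nn_integral_sum) (auto intro!: sum.cong nn_integral_cmult)
    also have "\<dots> \<le> (\<Sum>i\<in>I. ennreal (A' ^ j * a i) * ennreal c)"
      by (intro sum_mono mult_left_mono moment_leD(3) X) auto
    also have "\<dots> = ennreal (\<Sum>i\<in>I. A' ^ j * a i * c)"
      using a A'0 c by (subst sum_ennreal[symmetric]) (auto simp: ennreal_mult intro!: sum.cong)
    also have "(\<Sum>i\<in>I. A' ^ j * a i * c) = A' ^ k * c"
      unfolding j A'_def by (simp add: sum_distrib_left sum_distrib_right mult_ac)
    also have "ennreal (A' ^ k * c) \<le> ennreal (A ^ k * c)"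
      using AA c by (intro ennreal_leI mult_right_mono) auto
    finally have "(\<integral>\<^sup>+ \<omega>. ennreal (\<bar>\<Sum>i\<in>I. a i * X i \<omega>\<bar> ^ k) \<partial>M) \<le> ennreal (A ^ k * c)" .
    moreover have "0 \<le> A ^ k * c" using AA A'0 c by (meson mult_nonneg_nonneg order_trans zero_le_power)
    ultimately show ?thesis using m by (simp add: moment_le_def)
  qed
qed

text \<open>Fatou's lemma. Besides the bound it gives measurability of the limit, which is how path
  integrals of the noise become random variables.\<close>

lemma moment_le_LIMSEQ:
  assumes X: "\<And>n. moment_le M k (X n) c"
    and lim: "\<And>\<omega>. \<omega> \<in> space M \<Longrightarrow> (\<lambda>n. X n \<omega>) \<longlonglongrightarrow> Y \<omega>"
  shows "moment_le M k Y c"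
proof -
  have [measurable]: "X n \<in> borel_measurable M" for n using X moment_leD(2) by blast
  have [measurable]: "Y \<in> borel_measurable M" by (rule borel_measurable_LIMSEQ_real[OF lim]) auto
  have "(\<integral>\<^sup>+ \<omega>. ennreal (\<bar>Y \<omega>\<bar> ^ k) \<partial>M) = (\<integral>\<^sup>+ \<omega>. liminf (\<lambda>n. ennreal (\<bar>X n \<omega>\<bar> ^ k)) \<partial>M)"
  proof (rule nn_integral_cong)
    fix \<omega> assume "\<omega> \<in> space M"
    then have "(\<lambda>n. ennreal (\<bar>X n \<omega>\<bar> ^ k)) \<longlonglongrightarrow> ennreal (\<bar>Y \<omega>\<bar> ^ k)"
      by (intro tendsto_ennrealI tendsto_power tendsto_rabs lim)
    then show "ennreal (\<bar>Y \<omega>\<bar> ^ k) = liminf (\<lambda>n. ennreal (\<bar>X n \<omega>\<bar> ^ k))"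
      by (rule lim_imp_Liminf[OF sequentially_bot, symmetric])
  qed
  also have "\<dots> \<le> liminf (\<lambda>n. \<integral>\<^sup>+ \<omega>. ennreal (\<bar>X n \<omega>\<bar> ^ k) \<partial>M)"
    by (rule nn_integral_liminf) auto
  also have "\<dots> \<le> ennreal c"
    by (intro Liminf_le[OF sequentially_bot] always_eventually allI moment_leD(3) X)
  finally show ?thesis using moment_leD(1)[OF X] by (simp add: moment_le_def)
qed

text \<open>From \<open>x ^ j \<le> 1 + x ^ k\<close> for \<open>x \<ge> 0\<close> and total mass 1.
  Only the dependence on \<open>h\<close> matters later, so the additive loss does no harm.\<close>

lemma (in prob_space) moment_le_lower:
  assumes X: "moment_le M k X c" and jk: "j \<le> k"
  shows "moment_le M j X (1 + c)"
proof -
  have [measurable]: "X \<in> borel_measurable M" using moment_leD(2) X by blast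
  have c: "0 \<le> c" using moment_leD(1) X by blast
  have "(\<integral>\<^sup>+ \<omega>. ennreal (\<bar>X \<omega>\<bar> ^ j) \<partial>M) \<le> (\<integral>\<^sup>+ \<omega>. 1 + ennreal (\<bar>X \<omega>\<bar> ^ k) \<partial>M)"
  proof (rule nn_integral_mono)
    fix \<omega>
    have "\<bar>X \<omega>\<bar> ^ j \<le> 1 + \<bar>X \<omega>\<bar> ^ k"
    proof (cases "\<bar>X \<omega>\<bar> \<le> 1")
      case True
      then have "\<bar>X \<omega>\<bar> ^ j \<le> 1" by (simp add: power_le_one)
      then show ?thesis by (smt (verit) zero_le_power abs_ge_zero)
    next
      case False
      then show ?thesis using power_increasing[OF jk, of "\<bar>X \<omega>\<bar>"] by linarith
    qed
    then show "ennreal (\<bar>X \<omega>\<bar> ^ j) \<le> 1 + ennreal (\<bar>X \<omega>\<bar> ^ k)"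
      by (metis abs_ge_zero ennreal_1 ennreal_leI ennreal_plus zero_le_one zero_le_power)
  qed
  also have "\<dots> = 1 + (\<integral>\<^sup>+ \<omega>. ennreal (\<bar>X \<omega>\<bar> ^ k) \<partial>M)"
    by (subst nn_integral_add) (auto simp: emeasure_space_1)
  also have "\<dots> \<le> 1 + ennreal c" by (intro add_mono moment_leD(3) X) auto
  also have "\<dots> = ennreal (1 + c)" using c by simp
  finally show ?thesis using c by (simp add: moment_le_def)
qed

section \<open>Pathwise estimates\<close>

text \<open>The sum on the right ends before \<open>n\<close>, so the partial sums of
  \<open>e\<close> grow by at most the factor \<open>1 + h * L\<close> per step, up to the new
  \<open>a n\<close>, whatever the size of \<open>h * L\<close>. The outcome keeps
  \<open>a n\<close> and the sum of the \<open>a k\<close> apart instead of passing to a maximum, so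
  that moments can be taken term by term.\<close>

lemma discrete_gronwall:
  fixes e a :: "nat \<Rightarrow> real"
  assumes e: "\<And>n. n \<le> N \<Longrightarrow> e n \<le> a n + h * L * (\<Sum>k<n. e k)"
    and a: "\<And>n. 0 \<le> a n" and h: "0 \<le> h" and L: "0 \<le> L" and n: "n \<le> N"
  shows "e n \<le> a n + h * L * exp (L * (real N * h)) * (\<Sum>k<n. a k)"
proof -
  have hL: "0 \<le> h * L" using h L by simp
  have S: "n \<le> N \<Longrightarrow> (\<Sum>k<n. e k) \<le> (1 + h * L) ^ n * (\<Sum>k<n. a k)" for n
  proof (induction n)
    case (Suc n)
    have "(\<Sum>k<Suc n. e k) \<le> (1 + h * L) * (\<Sum>k<n. e k) + a n"
      using e[of n] Suc.prems by (simp add: algebra_simps)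
    also have "\<dots> \<le> (1 + h * L) * ((1 + h * L) ^ n * (\<Sum>k<n. a k)) + (1 + h * L) ^ Suc n * a n"
    proof (intro add_mono mult_left_mono)
      show "a n \<le> (1 + h * L) ^ Suc n * a n"
        using mult_right_mono[OF one_le_power[of "1 + h * L" "Suc n"] a[of n]] hL by simp
    qed (use Suc hL in auto)
    also have "\<dots> = (1 + h * L) ^ Suc n * (\<Sum>k<Suc n. a k)" by (simp add: algebra_simps)
    finally show ?case .
  qed simp
  have "(1 + h * L) ^ n \<le> exp (h * L) ^ n"
    using hL by (intro power_mono) (auto simp: add.commute)
  also have "\<dots> \<le> exp (h * L) ^ N" using n hL by (intro power_increasing) auto
  also have "\<dots> = exp (L * (real N * h))" by (simp add: exp_of_nat_mult[symmetric] mult_ac)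
  finally have "(1 + h * L) ^ n * (\<Sum>k<n. a k) \<le> exp (L * (real N * h)) * (\<Sum>k<n. a k)"
    by (intro mult_right_mono sum_nonneg a)
  then have "(\<Sum>k<n. e k) \<le> exp (L * (real N * h)) * (\<Sum>k<n. a k)" using S[OF n] by linarith
  then have "h * L * (\<Sum>k<n. e k) \<le> h * L * (exp (L * (real N * h)) * (\<Sum>k<n. a k))"
    using hL by (rule mult_left_mono)
  then show ?thesis using e[OF n] by (simp add: mult.assoc)
qed

text \<open>Integrating factor: with \<open>Z\<close> the primitive of \<open>z\<close>, the
  function \<open>exp (- L * s) * Z s - A s\<close> does not increase, because its derivative is at
  most \<open>exp (- L * s) * a s - a s\<close>. As in the discrete version, \<open>a t\<close> and
  the integral of \<open>a\<close> stay separate.\<close>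

lemma gronwall_integral:
  fixes z a :: "real \<Rightarrow> real"
  assumes z: "continuous_on {0..T} z" and a: "continuous_on {0..T} a"
    and le: "\<And>t. t \<in> {0..T} \<Longrightarrow> z t \<le> a t + L * integral {0..t} z"
    and a0: "\<And>t. t \<in> {0..T} \<Longrightarrow> 0 \<le> a t" and L: "0 \<le> L" and t: "t \<in> {0..T}"
  shows "z t \<le> a t + L * exp (L * T) * integral {0..T} a"
proof -
  define Z where "Z s = integral {0..s} z" for s
  define A where "A s = integral {0..s} a" for s
  define G where "G s = exp (- L * s) * Z s - A s" for s
  have dZ: "(Z has_real_derivative z s) (at s within {0..T})"
    and dA: "(A has_real_derivative a s) (at s within {0..T})" if "s \<in> {0..T}" for s
    unfolding Z_def[abs_def] A_def[abs_def] using z a that by (auto intro: integral_has_real_derivative)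
  have "G t \<le> G 0"
  proof (cases "t = 0")
    case False
    then have t0: "0 < t" using t by simp
    show ?thesis
    proof (rule DERIV_nonpos_imp_decreasing_open[OF less_imp_le[OF t0]])
      fix s assume s: "0 < s" "s < t"
      then have sT: "s \<in> {0..T}" "s \<in> interior {0..T}" using t by auto
      have "(G has_real_derivative exp (- L * s) * (z s - L * Z s) - a s) (at s)"
        unfolding G_def[abs_def] using dZ[OF sT(1)] dA[OF sT(1)] at_within_interior[OF sT(2)]
        by (auto intro!: derivative_eq_intros simp: algebra_simps)
      moreover have "exp (- L * s) * (z s - L * Z s) \<le> 1 * a s"
      proof (rule order_trans)
        show "exp (- L * s) * (z s - L * Z s) \<le> exp (- L * s) * a s"
          using le[OF sT(1)] by (intro mult_left_mono) (auto simp: Z_def)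
        show "exp (- L * s) * a s \<le> 1 * a s"
          using a0[OF sT(1)] L s by (intro mult_right_mono) auto
      qed
      ultimately show "\<exists>y. (G has_real_derivative y) (at s) \<and> y \<le> 0" by force
    next
      have "continuous_on {0..T} G"
        unfolding G_def[abs_def] by (intro continuous_intros DERIV_continuous_on[OF dZ] DERIV_continuous_on[OF dA])
      then show "continuous_on {0..t} G" by (rule continuous_on_subset) (use t in auto)
    qed
  qed simp
  then have "exp (- L * t) * Z t \<le> A t" by (simp add: G_def Z_def A_def)
  then have "exp (L * t) * (exp (- L * t) * Z t) \<le> exp (L * t) * A t" by (intro mult_left_mono) auto
  then have "Z t \<le> exp (L * t) * A t" by (simp add: mult.assoc[symmetric] exp_add[symmetric])
  also have "\<dots> \<le> exp (L * T) * A T"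
  proof (rule mult_mono)
    show "A t \<le> A T" unfolding A_def
      using t a0 by (intro integral_subset_le integrable_continuous_interval continuous_on_subset[OF a]) auto
    show "0 \<le> A t" unfolding A_def
      using t a0 by (intro integral_nonneg integrable_continuous_interval continuous_on_subset[OF a]) auto
  qed (use t L in \<open>auto intro: mult_left_mono\<close>)
  finally have "L * Z t \<le> L * (exp (L * T) * A T)" using L by (rule mult_left_mono)
  then show ?thesis using le[OF t] by (simp add: Z_def A_def mult.assoc)
qed

section \<open>Integrals over grids and Riemann sums\<close>

lemma integral_grid:
  fixes g :: "real \<Rightarrow> 'b::euclidean_space"
  assumes g: "continuous_on {a..b} g" and h: "0 \<le> h"
  shows "a + real n * h \<le> b \<Longrightarrow>
    integral {a..a + real n * h} g = (\<Sum>i<n. integral {a + real i * h..a + real (Suc i) * h} g)"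
proof (induction n)
  case (Suc n)
  have le: "a + real n * h \<le> a + real (Suc n) * h" using h by (simp add: algebra_simps)
  have "integral {a..a + real (Suc n) * h} g
      = integral {a..a + real n * h} g + integral {a + real n * h..a + real (Suc n) * h} g"
    by (rule Henstock_Kurzweil_Integration.integral_combine[symmetric, OF _ le])
       (use h Suc.prems in \<open>auto intro!: integrable_continuous_interval continuous_on_subset[OF g]\<close>)
  then show ?case using Suc.IH Suc.prems le by simp
qed simp

lemma norm_integral_le:
  fixes g :: "real \<Rightarrow> 'b::euclidean_space"
  assumes "continuous_on {a..b} g" "continuous_on {a..b} f" "\<And>s. s \<in> {a..b} \<Longrightarrow> norm (g s) \<le> f s"
  shows "norm (integral {a..b} g) \<le> integral {a..b} f"
  by (rule integral_norm_bound_integral) (use assms in \<open>auto intro: integrable_continuous_interval\<close>)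

lemma norm_integral_le_const:
  fixes g :: "real \<Rightarrow> 'b::euclidean_space"
  assumes "a \<le> b" "continuous_on {a..b} g" "\<And>s. s \<in> {a..b} \<Longrightarrow> norm (g s) \<le> c"
  shows "norm (integral {a..b} g) \<le> c * (b - a)"
  using norm_integral_le[OF assms(2), of "\<lambda>_. c"] assms by (simp add: mult.commute)

text \<open>Left-endpoint sums converge by uniform continuity. They express a path integral as a
  limit of finite combinations of values at fixed times, the form in which moments of the noise are
  computable. \<open>Suc m\<close> keeps the number of cells positive.\<close>

lemma riemann_sum_LIMSEQ:
  fixes g :: "real \<Rightarrow> 'b::euclidean_space"
  assumes ab: "a \<le> b" and g: "continuous_on {a..b} g"
  shows "(\<lambda>m. \<Sum>i<Suc m. ((b - a) / real (Suc m)) *\<^sub>R g (a + real i * ((b - a) / real (Suc m))))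
    \<longlonglongrightarrow> integral {a..b} g"
proof (rule LIMSEQ_I)
  fix r :: real assume r: "0 < r"
  \<comment> \<open>The summand 1 keeps the denominator positive when \<open>a = b\<close>.\<close>
  define \<epsilon> where "\<epsilon> = r / (2 * (b - a + 1))"
  have \<epsilon>: "0 < \<epsilon>" "\<epsilon> * (2 * (b - a + 1)) = r" using r ab by (auto simp: \<epsilon>_def)
  have \<epsilon>r: "\<epsilon> * (b - a) < r"
    unfolding \<epsilon>(2)[symmetric] using \<epsilon>(1) ab by (intro mult_strict_left_mono) auto
  obtain \<delta> where \<delta>: "0 < \<delta>" "\<And>x y. x \<in> {a..b} \<Longrightarrow> y \<in> {a..b} \<Longrightarrow> dist y x < \<delta> \<Longrightarrow> dist (g y) (g x) < \<epsilon>"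
    using compact_uniformly_continuous[OF g compact_Icc] \<epsilon>(1) unfolding uniformly_continuous_on_def by metis
  obtain n0 :: nat where n0: "(b - a) / \<delta> < real n0" using reals_Archimedean2 by blast
  show "\<exists>n0. \<forall>m\<ge>n0. norm ((\<Sum>i<Suc m. ((b - a) / real (Suc m)) *\<^sub>R g (a + real i * ((b - a) / real (Suc m)))) - integral {a..b} g) < r"
  proof (intro exI allI impI)
    fix m assume m: "n0 \<le> m"
    define h where "h = (b - a) / real (Suc m)"
    have h0: "0 \<le> h" and hm: "real (Suc m) * h = b - a" using ab by (auto simp: h_def)
    have "(b - a) / \<delta> < real (Suc m)" using n0 m by simp
    then have h\<delta>: "h < \<delta>" using \<delta>(1) by (simp add: h_def field_simps)
    have "integral {a..a + real (Suc m) * h} g = (\<Sum>i<Suc m. integral {a + real i * h..a + real (Suc i) * h} g)"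
      by (rule integral_grid[OF g h0]) (use hm in simp)
    then have "(\<Sum>i<Suc m. h *\<^sub>R g (a + real i * h)) - integral {a..b} g
        = (\<Sum>i<Suc m. h *\<^sub>R g (a + real i * h) - integral {a + real i * h..a + real (Suc i) * h} g)"
      using hm by (simp add: sum_subtractf del: sum.lessThan_Suc of_nat_Suc)
    also have "norm \<dots> \<le> (\<Sum>i<Suc m. \<epsilon> * h)"
    proof (rule sum_norm_le)
      fix i assume "i \<in> {..<Suc m}"
      then have "real (Suc i) * h \<le> real (Suc m) * h" using h0 by (intro mult_right_mono) auto
      then have i: "a + real (Suc i) * h \<le> b" "a \<le> a + real i * h" "a + real i * h \<le> a + real (Suc i) * h"
        using hm h0 by (auto simp: algebra_simps)
      define J where "J = {a + real i * h..a + real (Suc i) * h}"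
      have J: "J \<subseteq> {a..b}" "a + real i * h \<in> J" using i by (auto simp: J_def)
      have gJ: "continuous_on J g" using g J by (metis continuous_on_subset)
      have cJ: "integral J (\<lambda>_. g (a + real i * h)) = h *\<^sub>R g (a + real i * h)"
        using h0 by (simp add: J_def algebra_simps)
      have "h *\<^sub>R g (a + real i * h) - integral J g = integral J (\<lambda>s. g (a + real i * h) - g s)"
        unfolding cJ[symmetric] using gJ
        by (intro integral_diff[symmetric] integrable_const_ivl integrable_continuous_interval)
           (auto simp: J_def intro: integrable_continuous_interval)
      also have "norm \<dots> \<le> \<epsilon> * (a + real (Suc i) * h - (a + real i * h))"
        unfolding J_def
      proof (rule norm_integral_le_const[OF i(3)])
        show "continuous_on {a + real i * h..a + real (Suc i) * h} (\<lambda>s. g (a + real i * h) - g s)"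
          using gJ unfolding J_def by (intro continuous_intros)
        fix s assume s: "s \<in> {a + real i * h..a + real (Suc i) * h}"
        then have "dist (a + real i * h) s < \<delta>" using h\<delta> by (auto simp: dist_real_def algebra_simps)
        then show "norm (g (a + real i * h) - g s) \<le> \<epsilon>"
          using \<delta>(2)[of s "a + real i * h"] s J unfolding J_def by (auto simp: dist_norm intro: less_imp_le)
      qed
      also have "\<dots> = \<epsilon> * h" by (simp add: algebra_simps)
      finally show "norm (h *\<^sub>R g (a + real i * h) - integral {a + real i * h..a + real (Suc i) * h} g) \<le> \<epsilon> * h"
        unfolding J_def .
    qed
    also have "\<dots> = \<epsilon> * (b - a)" by (simp add: hm[symmetric] del: of_nat_Suc)
    also have "\<dots> < r" by (rule \<epsilon>r)
    finally show "norm ((\<Sum>i<Suc m. ((b - a) / real (Suc m)) *\<^sub>R g (a + real i * ((b - a) / real (Suc m)))) - integral {a..b} g) < r"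
      unfolding h_def .
  qed
qed

section \<open>A priori bounds for the scheme and the solution along a path\<close>

text \<open>A Lipschitz constant may be enlarged, so \<open>1 \<le> B\<close> is a normalisation:
  bounds with the factors 1 and \<open>B\<close> merge, and \<open>h * B \<le> 1 / 2\<close> also
  yields \<open>h \<le> 1 / 2\<close>.\<close>

locale lipschitz_force =
  fixes V' :: "real ^ 'm \<Rightarrow> real ^ 'm" and B T :: real
  assumes lipschitz: "B-lipschitz_on UNIV V'" and B: "1 \<le> B" and T: "0 < T"
begin

definition v0 :: real where "v0 = norm (V' 0)"

lemma v0_nonneg: "0 \<le> v0" by (simp add: v0_def)

lemma V'_diff: "norm (V' x - V' y) \<le> B * norm (x - y)"
  using lipschitz_onD[OF lipschitz] by (simp add: dist_norm)

lemma V'_growth: "norm (V' x) \<le> v0 + B * norm x"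
  using V'_diff[of x 0] norm_triangle_ineq2[of "V' x" "V' 0"] by (simp add: v0_def)

lemma continuous_on_V' [continuous_intros]:
  "continuous_on S g \<Longrightarrow> continuous_on S (\<lambda>s. V' (g s))"
  using continuous_on_compose2[OF lipschitz_on_continuous_on[OF lipschitz]] by blast

text \<open>The stage equation is implicit, but for \<open>h * B \<le> 1 / 2\<close> the stage
  occurs on the right with a small factor and is absorbed on the left. The bounds hold for whichever
  solution \<open>\<Psi>\<close> the step has chosen; \<open>I\<close> is the averaged
  force.\<close>

lemma step_bounds:
  assumes "drift_preserving_step V' h w p q p' q'" and h: "0 < h" and hB: "h * B \<le> 1 / 2"
  obtains \<Psi> I where "q' = q + h *\<^sub>R \<Psi>" "p' = p + w - h *\<^sub>R I" "\<Psi> = p + w - (h / 2) *\<^sub>R I"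
    "norm (I - V' q) \<le> B * h * norm \<Psi>" "norm I \<le> v0 + B * norm q + norm \<Psi>"
    "norm \<Psi> \<le> 2 * (norm p + norm q + norm w + v0)"
proof -
  from assms(1) obtain \<Psi> where \<Psi>: "\<Psi> = p + w - (h / 2) *\<^sub>R integral {0..1} (\<lambda>s. V' (q + (s * h) *\<^sub>R \<Psi>))"
    "q' = q + h *\<^sub>R \<Psi>" "p' = p + w - h *\<^sub>R integral {0..1} (\<lambda>s. V' (q + (s * h) *\<^sub>R \<Psi>))"
    unfolding drift_preserving_step_def by blast
  define I where "I = integral {0..1} (\<lambda>s. V' (q + (s * h) *\<^sub>R \<Psi>))"
  have "I - V' q = integral {0..1} (\<lambda>s. V' (q + (s * h) *\<^sub>R \<Psi>) - V' q)"
    unfolding I_def by (subst integral_diff) (auto intro!: integrable_continuous_interval continuous_intros)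
  also have "norm \<dots> \<le> (B * h * norm \<Psi>) * (1 - 0)"
  proof (rule norm_integral_le_const)
    fix s :: real assume s: "s \<in> {0..1}"
    have "norm (V' (q + (s * h) *\<^sub>R \<Psi>) - V' q) \<le> B * norm ((s * h) *\<^sub>R \<Psi>)"
      using V'_diff[of "q + (s * h) *\<^sub>R \<Psi>" q] by simp
    also have "\<dots> = s * (B * h * norm \<Psi>)" using s h by (simp add: abs_mult)
    also have "\<dots> \<le> 1 * (B * h * norm \<Psi>)" using s h B by (intro mult_right_mono) auto
    finally show "norm (V' (q + (s * h) *\<^sub>R \<Psi>) - V' q) \<le> B * h * norm \<Psi>" by simp
  qed (auto intro!: continuous_intros)
  finally have 1: "norm (I - V' q) \<le> B * h * norm \<Psi>" by simp
  have "B * h * norm \<Psi> \<le> 1 / 2 * norm \<Psi>" using hB by (intro mult_right_mono) (auto simp: mult.commute)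
  moreover have "norm I \<le> norm (I - V' q) + norm (V' q)" using norm_triangle_ineq[of "I - V' q" "V' q"] by simp
  ultimately have I: "norm I \<le> v0 + B * norm q + 1 / 2 * norm \<Psi>" using 1 V'_growth[of q] by linarith
  have h1: "h \<le> 1 / 2" using hB mult_left_mono[OF B, of h] h by linarith
  have "norm \<Psi> \<le> norm (p + w) + norm ((h / 2) *\<^sub>R I)"
    using \<Psi>(1) norm_triangle_ineq4[of "p + w" "(h / 2) *\<^sub>R I"] by (simp add: I_def)
  also have "\<dots> \<le> norm p + norm w + h / 2 * (v0 + B * norm q + 1 / 2 * norm \<Psi>)"
    using I h by (intro add_mono norm_triangle_ineq) (auto intro: mult_left_mono)
  also have "\<dots> = norm p + norm w + h * (v0 / 2) + (h * B) * (norm q / 2) + h * (norm \<Psi> / 4)"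
    by (simp add: algebra_simps)
  also have "\<dots> \<le> norm p + norm w + 1 / 2 * (v0 / 2) + 1 / 2 * (norm q / 2) + 1 / 2 * (norm \<Psi> / 4)"
    using h1 hB v0_nonneg by (intro add_mono mult_right_mono) auto
  \<comment> \<open>The last right-hand side contains \<open>norm \<Psi> / 8\<close>; solving for
    \<open>norm \<Psi>\<close> costs the factor 8/7, below the claimed 2.\<close>
  finally have "norm \<Psi> \<le> 2 * (norm p + norm q + norm w + v0)"
    using v0_nonneg norm_ge_zero[of p] norm_ge_zero[of q] norm_ge_zero[of w] by argo
  moreover have "norm I \<le> v0 + B * norm q + norm \<Psi>" using I norm_ge_zero[of \<Psi>] by linarith
  ultimately show ?thesis using 1 \<Psi> by (intro that[of \<Psi> I]) (simp_all add: I_def)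
qed

text \<open>\<open>w\<close> now denotes the noise at the grid points. Norms of \<open>w n\<close>
  and \<open>w (Suc n)\<close> replace that of the increment, and the stages are chosen for all
  steps at once, as sequences that can be summed.\<close>

lemma scheme_unfold:
  assumes step: "\<And>n. n < N \<Longrightarrow> drift_preserving_step V' h (w (Suc n) - w n) (P n) (Q n) (P (Suc n)) (Q (Suc n))"
    and h: "0 < h" and hB: "h * B \<le> 1 / 2"
  obtains \<Psi> I where
    "\<And>n. n < N \<Longrightarrow> Q (Suc n) = Q n + h *\<^sub>R \<Psi> n"
    "\<And>n. n < N \<Longrightarrow> P (Suc n) = P n + (w (Suc n) - w n) - h *\<^sub>R I n"
    "\<And>n. n < N \<Longrightarrow> \<Psi> n = P n + (w (Suc n) - w n) - (h / 2) *\<^sub>R I n"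
    "\<And>n. n < N \<Longrightarrow> norm (I n - V' (Q n)) \<le> B * h * norm (\<Psi> n)"
    "\<And>n. n < N \<Longrightarrow> norm (I n) \<le> v0 + B * norm (Q n) + norm (\<Psi> n)"
    "\<And>n. n < N \<Longrightarrow> norm (\<Psi> n) \<le> 2 * (norm (P n) + norm (Q n) + norm (w n) + norm (w (Suc n)) + v0)"
proof -
  define R where "R n \<Psi> I \<longleftrightarrow> Q (Suc n) = Q n + h *\<^sub>R \<Psi> \<and> P (Suc n) = P n + (w (Suc n) - w n) - h *\<^sub>R I \<and>
    \<Psi> = P n + (w (Suc n) - w n) - (h / 2) *\<^sub>R I \<and> norm (I - V' (Q n)) \<le> B * h * norm \<Psi> \<and>
    norm I \<le> v0 + B * norm (Q n) + norm \<Psi> \<and>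
    norm \<Psi> \<le> 2 * (norm (P n) + norm (Q n) + norm (w n) + norm (w (Suc n)) + v0)" for n \<Psi> I
  have "\<exists>x. R n (fst x) (snd x)" if n: "n < N" for n
  proof -
    obtain \<Psi> I where *: "Q (Suc n) = Q n + h *\<^sub>R \<Psi>" "P (Suc n) = P n + (w (Suc n) - w n) - h *\<^sub>R I"
      "\<Psi> = P n + (w (Suc n) - w n) - (h / 2) *\<^sub>R I" "norm (I - V' (Q n)) \<le> B * h * norm \<Psi>"
      "norm I \<le> v0 + B * norm (Q n) + norm \<Psi>"
      "norm \<Psi> \<le> 2 * (norm (P n) + norm (Q n) + norm (w (Suc n) - w n) + v0)"
      using step_bounds[OF step[OF n] h hB] by metis
    have "norm \<Psi> \<le> 2 * (norm (P n) + norm (Q n) + norm (w n) + norm (w (Suc n)) + v0)"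
      using *(6) norm_triangle_ineq4[of "w (Suc n)" "w n"] by argo
    with * have "R n \<Psi> I" unfolding R_def by blast
    then show ?thesis by (intro exI[of _ "(\<Psi>, I)"]) simp
  qed
  then obtain x where x: "\<And>n. n < N \<Longrightarrow> R n (fst (x n)) (snd (x n))" by metis
  show ?thesis
    by (rule that[of "\<lambda>n. fst (x n)" "\<lambda>n. snd (x n)"]; drule x; unfold R_def; elim conjE; assumption)
qed

text \<open>Summing the steps telescopes the noise to \<open>w n\<close>, since
  \<open>w 0 = 0\<close>, and discrete Gronwall does the rest. \<open>C\<close> is chosen before the
  number of steps and the paths, so the bound may later be applied for almost every outcome and
  raised to any power. The noise enters through its value at \<open>n\<close> and a time
  average.\<close>

lemma scheme_bound:
  "\<exists>C\<ge>0. \<forall>N h w P Q. 0 < N \<and> h = T / real N \<and> h * B \<le> 1 / 2 \<and> w 0 = 0 \<and>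
     (\<forall>n<N. drift_preserving_step V' h (w (Suc n) - w n) (P n) (Q n) (P (Suc n)) (Q (Suc n))) \<longrightarrow>
     (\<forall>n\<le>N. norm (P n) + norm (Q n)
        \<le> C * (1 + norm (P 0) + norm (Q 0) + norm (w n) + h * (\<Sum>k\<le>N. norm (w k))))"
proof -
  \<comment> \<open>With \<open>y\<close>, \<open>Z\<close>, \<open>U\<close> as below:
    \<open>norm I + norm \<Psi> \<le> v0 + B * norm Q + 2 * norm \<Psi>\<close> and the bound on
    \<open>norm \<Psi>\<close> give \<open>5 * v0\<close> and the rate \<open>B + 4\<close>. The two
    noise sums contribute \<open>8 * Z\<close>, and \<open>y 0 + 8 * Z\<close> is at most
    \<open>9 * U\<close>. \<open>C\<close> collects the factors after Gronwall.\<close>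
  define c where "c = 5 * v0 * T + 9"
  define L where "L = B + 4"
  define C where "C = 1 + c + L * exp (L * T) * (T * c + 1)"
  have c: "9 \<le> c" and L: "0 \<le> L" using v0_nonneg T B by (auto simp: c_def L_def)
  have C: "0 \<le> C" using c L T by (auto simp: C_def)
  show ?thesis
  proof (rule exI[of _ C], rule conjI[OF C], intro allI impI, elim conjE)
    fix N n :: nat and h and w P Q :: "nat \<Rightarrow> real ^ 'm"
    assume N: "0 < N" and h_def: "h = T / real N" and hB: "h * B \<le> 1 / 2" and w0: "w 0 = 0"
      and step: "\<forall>n<N. drift_preserving_step V' h (w (Suc n) - w n) (P n) (Q n) (P (Suc n)) (Q (Suc n))"
      and n: "n \<le> N"
    have h: "0 < h" and Nh: "real N * h = T" using N T by (auto simp: h_def)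
    obtain \<Psi> I where
      Q: "\<And>n. n < N \<Longrightarrow> Q (Suc n) = Q n + h *\<^sub>R \<Psi> n" and
      P: "\<And>n. n < N \<Longrightarrow> P (Suc n) = P n + (w (Suc n) - w n) - h *\<^sub>R I n" and
      I: "\<And>n. n < N \<Longrightarrow> norm (I n) \<le> v0 + B * norm (Q n) + norm (\<Psi> n)" and
      \<Psi>: "\<And>n. n < N \<Longrightarrow> norm (\<Psi> n) \<le> 2 * (norm (P n) + norm (Q n) + norm (w n) + norm (w (Suc n)) + v0)"
      using scheme_unfold[of N h w P Q] step h hB by metis
    define y where "y n = norm (P n) + norm (Q n)" for n
    define Z where "Z = h * (\<Sum>k\<le>N. norm (w k))"
    define U where "U = 1 + y 0 + Z"
    define a where "a n = norm (w n) + c * U" for n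
    have Z0: "0 \<le> Z" using h by (auto simp: Z_def intro!: mult_nonneg_nonneg sum_nonneg)
    have U: "0 \<le> U" using Z0 by (simp add: U_def y_def)
    have sum_w: "h * (\<Sum>k<n. norm (w k)) \<le> Z" if "n \<le> N" for n
      unfolding Z_def using that h by (intro mult_left_mono sum_mono2) auto
    have sum_w': "h * (\<Sum>k<n. norm (w (Suc k))) \<le> Z" if "n \<le> N" for n
    proof -
      have "(\<Sum>k<n. norm (w (Suc k))) = (\<Sum>k\<in>Suc ` {..<n}. norm (w k))" by (simp add: sum.reindex)
      also have "\<dots> \<le> (\<Sum>k\<le>N. norm (w k))" using that by (intro sum_mono2) auto
      finally show ?thesis unfolding Z_def using h by (intro mult_left_mono) auto
    qed
    have y: "y n \<le> a n + h * L * (\<Sum>k<n. y k)" if n: "n \<le> N" for n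
    proof -
      have "n \<le> N \<Longrightarrow> P n = P 0 + w n - h *\<^sub>R (\<Sum>k<n. I k)" for n
        by (induction n) (auto simp: w0 P algebra_simps)
      then have "norm (P n) \<le> norm (P 0) + norm (w n) + norm (h *\<^sub>R (\<Sum>k<n. I k))"
        using n norm_triangle_ineq4 norm_triangle_ineq by (metis (no_types, lifting) add_mono_thms_linordered_semiring(3) order_trans)
      moreover have "n \<le> N \<Longrightarrow> Q n = Q 0 + h *\<^sub>R (\<Sum>k<n. \<Psi> k)" for n
        by (induction n) (auto simp: Q algebra_simps)
      then have "norm (Q n) \<le> norm (Q 0) + norm (h *\<^sub>R (\<Sum>k<n. \<Psi> k))"
        using n norm_triangle_ineq by metis
      moreover have "norm (h *\<^sub>R (\<Sum>k<n. I k)) \<le> h * (\<Sum>k<n. norm (I k))"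
        "norm (h *\<^sub>R (\<Sum>k<n. \<Psi> k)) \<le> h * (\<Sum>k<n. norm (\<Psi> k))"
        using h by (auto intro!: mult_left_mono norm_sum)
      ultimately have "y n \<le> y 0 + norm (w n) + h * (\<Sum>k<n. norm (I k) + norm (\<Psi> k))"
        by (simp add: y_def sum.distrib distrib_left)
      also have "h * (\<Sum>k<n. norm (I k) + norm (\<Psi> k))
          \<le> h * (\<Sum>k<n. 5 * v0 + 4 * norm (w k) + 4 * norm (w (Suc k)) + L * y k)"
      proof (intro mult_left_mono sum_mono)
        fix k assume "k \<in> {..<n}"
        then have k: "k < N" using n by simp
        have "B * norm (Q k) \<le> B * y k" using B by (intro mult_left_mono) (auto simp: y_def)
        then show "norm (I k) + norm (\<Psi> k) \<le> 5 * v0 + 4 * norm (w k) + 4 * norm (w (Suc k)) + L * y k"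
          using I[OF k] \<Psi>[OF k] by (simp add: y_def L_def algebra_simps)
      qed (use h in auto)
      also have "\<dots> = 5 * v0 * (real n * h) + 4 * (h * (\<Sum>k<n. norm (w k))) + 4 * (h * (\<Sum>k<n. norm (w (Suc k)))) + h * L * (\<Sum>k<n. y k)"
        by (simp add: sum.distrib sum_distrib_left distrib_left mult_ac)
      also have "\<dots> \<le> 5 * v0 * T + 4 * Z + 4 * Z + h * L * (\<Sum>k<n. y k)"
      proof -
        have "real n * h \<le> T" unfolding Nh[symmetric] using n h by (intro mult_right_mono) auto
        then have "5 * v0 * (real n * h) \<le> 5 * v0 * T" using v0_nonneg by (intro mult_left_mono) auto
        then show ?thesis using sum_w[OF n] sum_w'[OF n] by linarith
      qed
      finally have "y n \<le> norm (w n) + (y 0 + 5 * v0 * T + 8 * Z) + h * L * (\<Sum>k<n. y k)" by simp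
      also have "y 0 + 5 * v0 * T + 8 * Z \<le> c * U"
      proof -
        have "5 * v0 * T * 1 \<le> 5 * v0 * T * U"
          using v0_nonneg T Z0 by (intro mult_left_mono) (auto simp: U_def y_def)
        moreover have "y 0 + 8 * Z \<le> 9 * U" using Z0 by (simp add: U_def y_def)
        ultimately show ?thesis by (simp add: c_def algebra_simps)
      qed
      finally show ?thesis by (simp add: a_def)
    qed
    have "y n \<le> a n + h * L * exp (L * (real N * h)) * (\<Sum>k<n. a k)"
      by (rule discrete_gronwall[OF y]) (use U c h L n in \<open>auto simp: a_def\<close>)
    also have "h * L * exp (L * (real N * h)) * (\<Sum>k<n. a k) = L * exp (L * T) * (h * (\<Sum>k<n. a k))"
      by (simp add: Nh)
    also have "\<dots> \<le> L * exp (L * T) * ((T * c + 1) * U)"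
    proof (intro mult_left_mono)
      have "h * (\<Sum>k<n. a k) = h * (\<Sum>k<n. norm (w k)) + (real n * h) * (c * U)"
        by (simp add: a_def sum.distrib algebra_simps)
      also have "\<dots> \<le> U + T * (c * U)"
      proof (intro add_mono)
        have "Z \<le> U" by (simp add: U_def y_def)
        with sum_w[OF n] show "h * (\<Sum>k<n. norm (w k)) \<le> U" by linarith
        have "real n * h \<le> T" unfolding Nh[symmetric] using n h by (intro mult_right_mono) auto
        then show "real n * h * (c * U) \<le> T * (c * U)" using U c by (intro mult_right_mono) auto
      qed
      finally show "h * (\<Sum>k<n. a k) \<le> (T * c + 1) * U" by (simp add: algebra_simps)
    qed (use L in auto)
    finally have "y n \<le> norm (w n) + (C - 1) * U" by (simp add: a_def C_def algebra_simps)
    also have "\<dots> \<le> C * norm (w n) + C * U"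
      using C c L T U by (intro add_mono mult_right_mono) (auto simp: C_def mult_le_cancel_right1)
    finally show "norm (P n) + norm (Q n)
        \<le> C * (1 + norm (P 0) + norm (Q 0) + norm (w n) + h * (\<Sum>k\<le>N. norm (w k)))"
      by (simp add: y_def U_def Z_def algebra_simps)
  qed
qed

text \<open>The counterpart of \<open>scheme_bound\<close> in continuous time, with an integral in
  place of the average over grid points. It is stated for arbitrary continuous paths, so that
  probability enters only when moments are taken.\<close>

lemma solution_bound:
  "\<exists>C\<ge>0. \<forall>w p q p\<^sub>0 q\<^sub>0. continuous_on {0..T} w \<and> continuous_on {0..T} p \<and> continuous_on {0..T} q \<and>
     (\<forall>t\<in>{0..T}. q t = q\<^sub>0 + integral {0..t} p \<and> p t = p\<^sub>0 - integral {0..t} (\<lambda>s. V' (q s)) + w t) \<longrightarrow>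
     (\<forall>t\<in>{0..T}. norm (p t) + norm (q t)
        \<le> C * (1 + norm p\<^sub>0 + norm q\<^sub>0 + norm (w t) + integral {0..T} (\<lambda>s. norm (w s))))"
proof -
  define c where "c = v0 * T + 1"
  define C where "C = 1 + c + B * exp (B * T) * (T * c + 1)"
  have c: "1 \<le> c" using v0_nonneg T by (auto simp: c_def)
  have C: "0 \<le> C" using c B T by (auto simp: C_def)
  show ?thesis
  proof (rule exI[of _ C], rule conjI[OF C], intro allI impI ballI, elim conjE)
    fix w p q :: "real \<Rightarrow> real ^ 'm" and p\<^sub>0 q\<^sub>0 t
    assume w: "continuous_on {0..T} w" and p: "continuous_on {0..T} p" and q: "continuous_on {0..T} q"
      and eq: "\<forall>t\<in>{0..T}. q t = q\<^sub>0 + integral {0..t} p \<and> p t = p\<^sub>0 - integral {0..t} (\<lambda>s. V' (q s)) + w t"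
      and t: "t \<in> {0..T}"
    define z where "z t = norm (p t) + norm (q t)" for t
    define J where "J = integral {0..T} (\<lambda>s. norm (w s))"
    define U where "U = 1 + norm p\<^sub>0 + norm q\<^sub>0 + J"
    define a where "a t = norm (w t) + c * U" for t
    have z: "continuous_on {0..T} z" unfolding z_def[abs_def] by (intro continuous_intros p q)
    have a: "continuous_on {0..T} a" unfolding a_def[abs_def] by (intro continuous_intros w)
    have J: "0 \<le> J" unfolding J_def
      by (intro integral_nonneg integrable_continuous_interval continuous_intros w) auto
    have U: "1 \<le> U" using J by (simp add: U_def)
    have le: "z t \<le> a t + B * integral {0..t} z" if t: "t \<in> {0..T}" for t
    proof -
      have sub: "{0..t} \<subseteq> {0..T}" using t by auto
      note cont = continuous_on_subset[OF p sub] continuous_on_subset[OF q sub] continuous_on_subset[OF z sub]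
      have "norm (integral {0..t} (\<lambda>s. V' (q s))) \<le> integral {0..t} (\<lambda>s. v0 + B * norm (q s))"
        by (rule norm_integral_le) (auto intro!: continuous_intros cont V'_growth)
      moreover have "norm (integral {0..t} p) \<le> integral {0..t} (\<lambda>s. norm (p s))"
        by (rule norm_integral_le) (auto intro!: continuous_intros cont)
      moreover have "integral {0..t} (\<lambda>s. v0 + B * norm (q s)) + integral {0..t} (\<lambda>s. norm (p s))
          = integral {0..t} (\<lambda>s. (v0 + B * norm (q s)) + norm (p s))"
        by (intro integral_add[symmetric] integrable_continuous_interval continuous_intros cont)
      moreover have "\<dots> \<le> integral {0..t} (\<lambda>s. v0 + B * z s)"
      proof (intro integral_le integrable_continuous_interval continuous_intros cont)
        fix s
        show "(v0 + B * norm (q s)) + norm (p s) \<le> v0 + B * z s"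
          using mult_right_mono[OF B, of "norm (p s)"] by (simp add: z_def algebra_simps)
      qed
      moreover have "\<dots> = v0 * t + B * integral {0..t} z"
        using t by (subst integral_add) (auto intro!: integrable_continuous_interval continuous_intros cont)
      moreover have "norm (q t) \<le> norm q\<^sub>0 + norm (integral {0..t} p)"
        using eq t norm_triangle_ineq by metis
      moreover have "norm (p t) \<le> norm p\<^sub>0 + norm (integral {0..t} (\<lambda>s. V' (q s))) + norm (w t)"
        using eq t norm_triangle_ineq4[of p\<^sub>0 "integral {0..t} (\<lambda>s. V' (q s))"]
          norm_triangle_ineq[of "p\<^sub>0 - integral {0..t} (\<lambda>s. V' (q s))" "w t"] by simp
      moreover have "v0 * t \<le> v0 * T" using v0_nonneg t by (intro mult_left_mono) auto
      moreover have "v0 * T * 1 \<le> v0 * T * U" using v0_nonneg T U by (intro mult_left_mono) auto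
      ultimately show ?thesis using J by (simp add: a_def c_def z_def U_def algebra_simps)
    qed
    have "z t \<le> a t + B * exp (B * T) * integral {0..T} a"
      by (rule gronwall_integral[OF z a le]) (use c U B t in \<open>auto simp: a_def\<close>)
    also have "integral {0..T} a = J + T * (c * U)"
      unfolding a_def[abs_def] J_def using T w
      by (subst integral_add) (auto intro!: integrable_continuous_interval continuous_intros)
    also have "B * exp (B * T) * (J + T * (c * U)) \<le> B * exp (B * T) * ((T * c + 1) * U)"
      using B by (intro mult_left_mono) (auto simp: U_def algebra_simps)
    finally have "z t \<le> norm (w t) + (C - 1) * U" by (simp add: a_def C_def algebra_simps)
    also have "\<dots> \<le> C * norm (w t) + C * U"
      using C c B T U by (intro add_mono mult_right_mono) (auto simp: C_def mult_le_cancel_right1)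
    finally show "norm (p t) + norm (q t)
        \<le> C * (1 + norm p\<^sub>0 + norm q\<^sub>0 + norm (w t) + integral {0..T} (\<lambda>s. norm (w s)))"
      by (simp add: z_def U_def J_def algebra_simps)
  qed
qed

end

section \<open>Local and global error of the scheme along a path\<close>

text \<open>The error of the right-endpoint rule for the time integral of \<open>w\<close> over the
  first \<open>n\<close> steps. It arises because the scheme lets the whole noise increment of a
  step act on the position from the start of the step, whereas the solution has received only the
  noise up to time \<open>s\<close>.\<close>

definition noise_error :: "(real \<Rightarrow> real ^ 'm) \<Rightarrow> real \<Rightarrow> nat \<Rightarrow> real ^ 'm" where
  "noise_error w h n =
     (\<Sum>k<n. integral {real k * h..real (Suc k) * h} (\<lambda>s. w s - w (real (Suc k) * h)))"

context lipschitz_force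
begin

text \<open>Over one step, \<open>q\<close> has derivative \<open>p\<close>, so the force is frozen at cost \<open>O(h\<^sup>2)\<close> pathwise. The only
  error term of lower order is the integral of \<open>w s - w b\<close>, where \<open>w\<close> is the noise.\<close>

lemma local_error:
  assumes w: "continuous_on {0..T} w" and p: "continuous_on {0..T} p" and q: "continuous_on {0..T} q"
    and eq: "\<And>t. t \<in> {0..T} \<Longrightarrow> q t = q\<^sub>0 + integral {0..t} p"
      "\<And>t. t \<in> {0..T} \<Longrightarrow> p t = p\<^sub>0 - integral {0..t} (\<lambda>s. V' (q s)) + w t"
    and a: "0 \<le> a" and h: "0 < h" and b: "b = a + h" "b \<le> T"
    and \<Psi>: "\<Psi> = P + (w b - w a) - (h / 2) *\<^sub>R I"
    and I: "norm (I - V' Q) \<le> B * h * norm \<Psi>" "norm I \<le> v0 + B * norm Q + norm \<Psi>"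
  shows "norm (p b - (P + (w b - w a) - h *\<^sub>R I) - (p a - P))
      \<le> h * B * norm (q a - Q) + h * (B * integral {a..b} (\<lambda>s. norm (p s)) + h * B * norm \<Psi>)" (is ?p)
    and "norm (q b - (Q + h *\<^sub>R \<Psi>) - (q a - Q) - h *\<^sub>R (p a - P) - integral {a..b} (\<lambda>s. w s - w b))
      \<le> h * (integral {a..b} (\<lambda>s. v0 + B * norm (q s)) + h * (v0 + B * norm Q + norm \<Psi>))" (is ?q)
proof -
  have ab: "a \<le> b" "{a..b} \<subseteq> {0..T}" "a \<in> {0..T}" "b \<in> {0..T}" using a h b by auto
  note c = continuous_on_subset[OF w ab(2)] continuous_on_subset[OF p ab(2)] continuous_on_subset[OF q ab(2)]
  have cq: "continuous_on {0..T} (\<lambda>s. V' (q s))" by (intro continuous_intros q)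
  have split: "integral {0..s} g = integral {0..a} g + integral {a..s} g"
    if "s \<in> {a..b}" "continuous_on {0..T} g" for s and g :: "real \<Rightarrow> real ^ 'm"
    using that a ab
    by (intro Henstock_Kurzweil_Integration.integral_combine[symmetric] integrable_continuous_interval)
       (auto elim!: continuous_on_subset)
  have qs: "q s = q a + integral {a..s} p" if "s \<in> {a..b}" for s
    using eq(1)[of s] eq(1)[of a] split[OF that p] that ab by (auto simp: algebra_simps)
  have ps: "p s = p a - w a + w s - integral {a..s} (\<lambda>s. V' (q s))" if "s \<in> {a..b}" for s
  proof -
    have "s \<in> {0..T}" using that ab by auto
    then have "p s = p\<^sub>0 - (integral {0..a} (\<lambda>s. V' (q s)) + integral {a..s} (\<lambda>s. V' (q s))) + w s"
      using eq(2) split[OF that cq] by simp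
    then show ?thesis using eq(2)[OF ab(3)] by simp
  qed
  define X where "X = integral {a..b} (\<lambda>s. norm (p s))"
  have int_p: "norm (integral {a..s} p) \<le> X" if "s \<in> {a..b}" for s
  proof -
    have sub: "{a..s} \<subseteq> {a..b}" using that by auto
    have cs: "continuous_on {a..s} p" "continuous_on {a..s} (\<lambda>s. norm (p s))" "continuous_on {a..b} (\<lambda>s. norm (p s))"
      using continuous_on_subset[OF c(2) sub] by (auto intro!: continuous_intros c)
    have "norm (integral {a..s} p) \<le> integral {a..s} (\<lambda>s. norm (p s))"
      by (rule norm_integral_le[OF cs(1,2)]) simp
    also have "\<dots> \<le> X" unfolding X_def
      by (rule integral_subset_le[OF sub]) (auto intro!: integrable_continuous_interval cs)
    finally show ?thesis .
  qed
  have "integral {a..b} (\<lambda>s. V' (q s)) - h *\<^sub>R V' Q = integral {a..b} (\<lambda>s. V' (q s) - V' Q)"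
  proof -
    have const: "h *\<^sub>R V' Q = integral {a..b} (\<lambda>s. V' Q)" using b h by simp
    show ?thesis unfolding const
      by (intro integral_diff[symmetric] integrable_continuous_interval continuous_intros c)
  qed
  also have "norm \<dots> \<le> (B * (norm (q a - Q) + X)) * (b - a)"
  proof (rule norm_integral_le_const[OF ab(1)])
    fix s assume s: "s \<in> {a..b}"
    have "norm (q s - Q) \<le> norm (q a - Q) + norm (integral {a..s} p)"
      using norm_triangle_ineq[of "q a - Q" "integral {a..s} p"] by (simp add: qs[OF s] algebra_simps)
    then have "norm (q s - Q) \<le> norm (q a - Q) + X" using int_p[OF s] by linarith
    then have "B * norm (q s - Q) \<le> B * (norm (q a - Q) + X)" using B by (intro mult_left_mono) auto
    then show "norm (V' (q s) - V' Q) \<le> B * (norm (q a - Q) + X)" using V'_diff[of "q s" Q] by linarith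
  qed (auto intro!: continuous_intros c)
  finally have 1: "norm (integral {a..b} (\<lambda>s. V' (q s)) - h *\<^sub>R V' Q) \<le> h * B * norm (q a - Q) + h * (B * X)"
    using b by (simp add: algebra_simps)
  have 2: "norm (h *\<^sub>R I - h *\<^sub>R V' Q) \<le> h * (h * B * norm \<Psi>)"
    using I(1) h by (simp add: scaleR_diff_right[symmetric] mult_ac)
  have bI: "b \<in> {a..b}" using ab by simp
  have "p b - (P + (w b - w a) - h *\<^sub>R I) - (p a - P)
      = (h *\<^sub>R I - h *\<^sub>R V' Q) - (integral {a..b} (\<lambda>s. V' (q s)) - h *\<^sub>R V' Q)"
    using ps[OF bI] by (simp add: algebra_simps)
  also have "norm \<dots> \<le> norm (h *\<^sub>R I - h *\<^sub>R V' Q) + norm (integral {a..b} (\<lambda>s. V' (q s)) - h *\<^sub>R V' Q)"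
    by (rule norm_triangle_ineq4)
  finally show ?p using 1 2 unfolding X_def by (simp add: algebra_simps)
  define Y where "Y = integral {a..b} (\<lambda>s. v0 + B * norm (q s))"
  \<comment> \<open>The part of \<open>p s\<close> due to the force. Its integral over the step is a
    double integral, hence \<open>h\<close> times an integral over the step.\<close>
  define D where "D s = integral {a..s} (\<lambda>s. V' (q s))" for s
  have D: "continuous_on {a..b} D"
    unfolding D_def[abs_def] by (intro indefinite_integral_continuous_1 integrable_continuous_interval continuous_intros c)
  have "norm (integral {a..b} D) \<le> Y * (b - a)"
  proof (rule norm_integral_le_const[OF ab(1) D])
    fix s assume s: "s \<in> {a..b}"
    then have sub: "{a..s} \<subseteq> {a..b}" by auto
    have cs: "continuous_on {a..s} q" by (rule continuous_on_subset[OF c(3) sub])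
    have "norm (D s) \<le> integral {a..s} (\<lambda>s. v0 + B * norm (q s))" unfolding D_def
      by (rule norm_integral_le) (auto intro!: continuous_intros cs V'_growth)
    also have "\<dots> \<le> Y" unfolding Y_def
      by (rule integral_subset_le[OF sub])
         (use v0_nonneg B in \<open>auto intro!: integrable_continuous_interval continuous_intros c cs\<close>)
    finally show "norm (D s) \<le> Y" .
  qed
  then have 3: "norm (integral {a..b} D) \<le> h * Y" using b by (simp add: mult.commute)
  have 4: "norm ((h * h / 2) *\<^sub>R I) \<le> h * (h * (v0 + B * norm Q + norm \<Psi>))"
  proof -
    have "h * h / 2 * norm I \<le> h * h * norm I" using h by (intro mult_right_mono) auto
    also have "\<dots> \<le> h * h * (v0 + B * norm Q + norm \<Psi>)" using I(2) h by (intro mult_left_mono) auto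
    finally show ?thesis using h by (simp add: mult.assoc)
  qed
  have h\<Psi>: "h *\<^sub>R \<Psi> = h *\<^sub>R P + h *\<^sub>R w b - h *\<^sub>R w a - (h * h / 2) *\<^sub>R I"
    by (simp add: \<Psi> algebra_simps)
  \<comment> \<open>\<open>p s\<close> is split into the value with the full noise increment, as in
    the scheme, the deviation \<open>w s - w b\<close>, and the contribution \<open>D s\<close> of
    the force.\<close>
  have "integral {a..b} p = integral {a..b} (\<lambda>s. (p a - w a + w b) + (w s - w b) - D s)"
  proof (rule integral_cong)
    fix s assume "s \<in> {a..b}"
    from ps[OF this] show "p s = (p a - w a + w b) + (w s - w b) - D s" by (simp add: D_def)
  qed
  also have "\<dots> = integral {a..b} (\<lambda>s. (p a - w a + w b) + (w s - w b)) - integral {a..b} D"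
    by (intro integral_diff integrable_continuous_interval continuous_intros c D)
  also have "integral {a..b} (\<lambda>s. (p a - w a + w b) + (w s - w b))
      = integral {a..b} (\<lambda>s. p a - w a + w b) + integral {a..b} (\<lambda>s. w s - w b)"
    by (intro integral_add integrable_continuous_interval continuous_intros c)
  also have "integral {a..b} (\<lambda>s. p a - w a + w b) = h *\<^sub>R p a - h *\<^sub>R w a + h *\<^sub>R w b"
    using b h by (simp add: algebra_simps)
  finally have ip: "integral {a..b} p = h *\<^sub>R p a - h *\<^sub>R w a + h *\<^sub>R w b
      + integral {a..b} (\<lambda>s. w s - w b) - integral {a..b} D" .
  have "q b - (Q + h *\<^sub>R \<Psi>) - (q a - Q) - h *\<^sub>R (p a - P) - integral {a..b} (\<lambda>s. w s - w b)
      = (h * h / 2) *\<^sub>R I - integral {a..b} D"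
    unfolding qs[OF bI] h\<Psi> ip by (simp add: algebra_simps)
  also have "norm \<dots> \<le> norm ((h * h / 2) *\<^sub>R I) + norm (integral {a..b} D)" by (rule norm_triangle_ineq4)
  finally show ?q using 3 4 unfolding Y_def by (simp add: algebra_simps)
qed

text \<open>The errors of \<open>p\<close> and \<open>q\<close> feed each other with factors
  \<open>h * B\<close> and \<open>h\<close>. The remainders of \<open>local_error\<close> are
  \<open>h\<close> times quantities whose sum over the steps is bounded, hence contribute
  \<open>O(h)\<close> in total; what is left for probability is \<open>noise_error\<close> and the
  moments of the data.\<close>

lemma global_error:
  "\<exists>C\<ge>0. \<forall>N h w p q P Q. 0 < N \<and> h = T / real N \<and> h * B \<le> 1 / 2 \<and> w 0 = 0 \<and>
     continuous_on {0..T} w \<and> continuous_on {0..T} p \<and> continuous_on {0..T} q \<and>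
     (\<forall>t\<in>{0..T}. q t = Q 0 + integral {0..t} p \<and> p t = P 0 - integral {0..t} (\<lambda>s. V' (q s)) + w t) \<and>
     (\<forall>n<N. drift_preserving_step V' h (w (real (Suc n) * h) - w (real n * h)) (P n) (Q n) (P (Suc n)) (Q (Suc n))) \<longrightarrow>
     (\<forall>n\<le>N. norm (p (real n * h) - P n) + norm (q (real n * h) - Q n)
        \<le> C * (norm (noise_error w h n) + h * (\<Sum>k<n. norm (noise_error w h k))
             + h * (1 + norm (P 0) + norm (Q 0) + integral {0..T} (\<lambda>s. norm (w s))
                    + h * (\<Sum>k\<le>N. norm (w (real k * h))))))"
proof -
  obtain C1 where C1: "0 \<le> C1" and sol: "\<forall>w p q p\<^sub>0 q\<^sub>0. continuous_on {0..T} w \<and> continuous_on {0..T} p \<and> continuous_on {0..T} q \<and>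
     (\<forall>t\<in>{0..T}. q t = q\<^sub>0 + integral {0..t} p \<and> p t = p\<^sub>0 - integral {0..t} (\<lambda>s. V' (q s)) + w t) \<longrightarrow>
     (\<forall>t\<in>{0..T}. norm (p t) + norm (q t)
        \<le> C1 * (1 + norm p\<^sub>0 + norm q\<^sub>0 + norm (w t) + integral {0..T} (\<lambda>s. norm (w s))))"
    using solution_bound by blast
  obtain C2 where C2: "0 \<le> C2" and num: "\<forall>N h w P Q. 0 < N \<and> h = T / real N \<and> h * B \<le> 1 / 2 \<and> w 0 = 0 \<and>
     (\<forall>n<N. drift_preserving_step V' h (w (Suc n) - w n) (P n) (Q n) (P (Suc n)) (Q (Suc n))) \<longrightarrow>
     (\<forall>n\<le>N. norm (P n) + norm (Q n)
        \<le> C2 * (1 + norm (P 0) + norm (Q 0) + norm (w n) + h * (\<Sum>k\<le>N. norm (w k))))"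
    using scheme_bound by blast
  \<comment> \<open>The first two summands bound the integrals of \<open>p\<close> and
    \<open>q\<close>, the third the stages, where 5 is \<open>2 + 1 + 2\<close>: from
    \<open>B * norm \<Psi>\<close>, from \<open>v0 + B * norm Q\<close>, and from
    \<open>norm \<Psi>\<close>. \<open>C\<close> comes out of Gronwall with rate
    \<open>B\<close>.\<close>
  define G where "G = B * (C1 * (T + 1)) + v0 * T + 5 * B * (C2 * (T + 1) + 2 + v0 * T)"
  define C where "C = 1 + G + B * exp (B * T) * (1 + T * G)"
  have G: "0 \<le> G" using B C1 C2 T v0_nonneg by (auto simp: G_def)
  have C: "0 \<le> C" using B G T by (auto simp: C_def)
  show ?thesis
  proof (rule exI[of _ C], rule conjI[OF C], intro allI impI, elim conjE)
    fix N n :: nat and h and w p q :: "real \<Rightarrow> real ^ 'm" and P Q :: "nat \<Rightarrow> real ^ 'm"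
    assume N: "0 < N" and h_def: "h = T / real N" and hB: "h * B \<le> 1 / 2" and w0: "w 0 = 0"
      and w: "continuous_on {0..T} w" and p: "continuous_on {0..T} p" and q: "continuous_on {0..T} q"
      and eq: "\<forall>t\<in>{0..T}. q t = Q 0 + integral {0..t} p \<and> p t = P 0 - integral {0..t} (\<lambda>s. V' (q s)) + w t"
      and step: "\<forall>n<N. drift_preserving_step V' h (w (real (Suc n) * h) - w (real n * h)) (P n) (Q n) (P (Suc n)) (Q (Suc n))"
      and n: "n \<le> N"
    have h: "0 < h" and Nh: "real N * h = T" using N T by (auto simp: h_def)
    have grid: "real k * h \<in> {0..T}" if "k \<le> N" for k
      unfolding Nh[symmetric] using that h by (auto intro!: mult_right_mono)
    define \<tau> where "\<tau> k = real k * h" for k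
    define v where "v k = w (\<tau> k)" for k
    obtain \<Psi> I where
      Q: "\<And>n. n < N \<Longrightarrow> Q (Suc n) = Q n + h *\<^sub>R \<Psi> n" and
      P: "\<And>n. n < N \<Longrightarrow> P (Suc n) = P n + (v (Suc n) - v n) - h *\<^sub>R I n" and
      \<Psi>I: "\<And>n. n < N \<Longrightarrow> \<Psi> n = P n + (v (Suc n) - v n) - (h / 2) *\<^sub>R I n" and
      IV: "\<And>n. n < N \<Longrightarrow> norm (I n - V' (Q n)) \<le> B * h * norm (\<Psi> n)" and
      I: "\<And>n. n < N \<Longrightarrow> norm (I n) \<le> v0 + B * norm (Q n) + norm (\<Psi> n)" and
      \<Psi>: "\<And>n. n < N \<Longrightarrow> norm (\<Psi> n) \<le> 2 * (norm (P n) + norm (Q n) + norm (v n) + norm (v (Suc n)) + v0)"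
    proof (rule scheme_unfold[of N h v P Q])
      show "drift_preserving_step V' h (v (Suc n) - v n) (P n) (Q n) (P (Suc n)) (Q (Suc n))" if "n < N" for n
        using step that by (simp add: v_def \<tau>_def)
    qed (use h hB in simp_all)
    define z where "z t = norm (p t) + norm (q t)" for t
    define y where "y n = norm (P n) + norm (Q n)" for n
    define J where "J = integral {0..T} (\<lambda>s. norm (w s))"
    define Z where "Z = h * (\<Sum>k\<le>N. norm (v k))"
    define U where "U = 1 + norm (P 0) + norm (Q 0) + J + Z"
    define e where "e n = norm (p (\<tau> n) - P n) + norm (q (\<tau> n) - Q n)" for n
    define \<rho> where "\<rho> n = norm (noise_error w h n)" for n
    have J0: "0 \<le> J" unfolding J_def
      by (intro integral_nonneg integrable_continuous_interval continuous_intros w) auto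
    have Z0: "0 \<le> Z" using h by (auto simp: Z_def intro!: mult_nonneg_nonneg sum_nonneg)
    have U: "1 \<le> U" using J0 Z0 by (simp add: U_def)
    have zb: "z t \<le> C1 * (1 + norm (P 0) + norm (Q 0) + norm (w t) + J)" if "t \<in> {0..T}" for t
      using sol[rule_format, of w p q "Q 0" "P 0"] w p q eq that unfolding z_def J_def by blast
    have yb: "y k \<le> C2 * (1 + norm (P 0) + norm (Q 0) + norm (v k) + Z)" if "k \<le> N" for k
      using num[rule_format, of N h v P Q k] N h_def hB w0 step that unfolding y_def Z_def v_def \<tau>_def by simp
    have sum_v: "h * (\<Sum>k<N. norm (v k)) \<le> Z"
      unfolding Z_def using h by (intro mult_left_mono sum_mono2) auto
    have sum_v': "h * (\<Sum>k<N. norm (v (Suc k))) \<le> Z"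
    proof -
      have "(\<Sum>k<N. norm (v (Suc k))) = (\<Sum>k\<in>Suc ` {..<N}. norm (v k))" by (simp add: sum.reindex)
      also have "\<dots> \<le> (\<Sum>k\<le>N. norm (v k))" by (intro sum_mono2) auto
      finally show ?thesis unfolding Z_def using h by (intro mult_left_mono) auto
    qed
    define X where "X k = integral {\<tau> k..\<tau> (Suc k)} (\<lambda>s. norm (p s))" for k
    define Y where "Y k = integral {\<tau> k..\<tau> (Suc k)} (\<lambda>s. v0 + B * norm (q s))" for k
    define gp where "gp k = B * X k + h * B * norm (\<Psi> k)" for k
    define gq where "gq k = Y k + h * (v0 + B * norm (Q k) + norm (\<Psi> k))" for k
    define r where "r k = integral {\<tau> k..\<tau> (Suc k)} (\<lambda>s. w s - w (\<tau> (Suc k)))" for k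
    have le: "0 \<le> \<tau> k" "\<tau> (Suc k) = \<tau> k + h" for k using h by (auto simp: \<tau>_def algebra_simps)
    have \<tau>T: "\<tau> (Suc k) \<le> T" if "k < N" for k using grid[of "Suc k"] that by (simp add: \<tau>_def)
    have step_p: "norm (p (\<tau> (Suc k)) - P (Suc k) - (p (\<tau> k) - P k)) \<le> h * B * norm (q (\<tau> k) - Q k) + h * gp k"
      and step_q: "norm (q (\<tau> (Suc k)) - Q (Suc k) - (q (\<tau> k) - Q k) - h *\<^sub>R (p (\<tau> k) - P k) - r k) \<le> h * gq k"
      if k: "k < N" for k
      using local_error[of w p q "Q 0" "P 0" "\<tau> k" h "\<tau> (Suc k)" "\<Psi> k" "P k" "I k" "Q k"]
        w p q eq le(1)[of k] h le(2)[of k] \<tau>T[OF k] \<Psi>I[OF k] IV[OF k] I[OF k] P[OF k] Q[OF k]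
      by (auto simp: gp_def gq_def X_def Y_def r_def v_def)
    define g where "g k = gp k + gq k" for k
    have start: "p (\<tau> 0) = P 0" "q (\<tau> 0) = Q 0" using eq T w0 by (auto simp: \<tau>_def)
    have \<rho>: "\<rho> n = norm (\<Sum>k<n. r k)" for n
      by (simp add: \<rho>_def noise_error_def r_def \<tau>_def)
    \<comment> \<open>The integrals over single steps add up to integrals over the whole interval,
      and the terms with \<open>h * norm (\<Psi> k)\<close> to a time average. The sum is therefore
      bounded uniformly in \<open>N\<close> by the data in \<open>U\<close>.\<close>
    have gsum: "(\<Sum>k<N. g k) \<le> G * U"
    proof -
      have grd: "(\<Sum>k<N. integral {\<tau> k..\<tau> (Suc k)} g) = integral {0..T} g"
        if "continuous_on {0..T} g" for g :: "real \<Rightarrow> real"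
        using integral_grid[OF that less_imp_le[OF h], of N] Nh by (simp add: \<tau>_def)
      have "(\<Sum>k<N. B * X k + Y k) = B * integral {0..T} (\<lambda>s. norm (p s)) + integral {0..T} (\<lambda>s. v0 + B * norm (q s))"
        unfolding X_def Y_def sum.distrib sum_distrib_left[symmetric]
        by (subst (1 2) grd) (auto intro!: continuous_intros p q)
      also have "\<dots> = integral {0..T} (\<lambda>s. B * norm (p s) + (v0 + B * norm (q s)))"
        unfolding integral_mult_right[symmetric]
        by (intro integral_add[symmetric] integrable_continuous_interval continuous_intros p q)
      also have "\<dots> \<le> integral {0..T} (\<lambda>s. (v0 + B * (C1 * (1 + norm (P 0) + norm (Q 0) + J))) + B * (C1 * norm (w s)))"
      proof (intro integral_le integrable_continuous_interval continuous_intros p q w)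
        fix s assume "s \<in> {0..T}"
        from mult_left_mono[OF zb[OF this], of B] B
        show "B * norm (p s) + (v0 + B * norm (q s)) \<le> (v0 + B * (C1 * (1 + norm (P 0) + norm (Q 0) + J))) + B * (C1 * norm (w s))"
          by (simp add: z_def algebra_simps)
      qed
      also have "\<dots> = T * (v0 + B * (C1 * (1 + norm (P 0) + norm (Q 0) + J))) + B * (C1 * J)"
        unfolding J_def using T w
        by (subst integral_add) (auto intro!: integrable_continuous_interval continuous_intros)
      also have "\<dots> \<le> T * (v0 * U + B * (C1 * U)) + B * (C1 * U)"
        using T B C1 v0_nonneg U Z0 J0
        by (intro add_mono mult_left_mono) (auto simp: U_def mult_le_cancel_left1)
      finally have 1: "(\<Sum>k<N. B * X k + Y k) \<le> (B * (C1 * (T + 1)) + v0 * T) * U" by (simp add: algebra_simps)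
      have "(\<Sum>k<N. h * B * norm (\<Psi> k) + h * (v0 + B * norm (Q k) + norm (\<Psi> k)))
          \<le> (\<Sum>k<N. 5 * B * h * (C2 * (U + norm (v k)) + norm (v k) + norm (v (Suc k)) + v0))"
      proof (rule sum_mono)
        fix k assume "k \<in> {..<N}"
        then have k: "k < N" by simp
        have y: "y k \<le> C2 * (U + norm (v k))"
          by (rule order_trans[OF yb]) (use k C2 J0 in \<open>auto intro!: mult_left_mono simp: U_def\<close>)
        define S where "S = y k + norm (v k) + norm (v (Suc k)) + v0"
        have "norm (\<Psi> k) \<le> 2 * S" using \<Psi>[OF k] by (simp add: S_def y_def)
        moreover have "norm (Q k) + v0 \<le> S" by (simp add: S_def y_def)
        moreover have "1 * v0 \<le> B * v0" "1 * norm (\<Psi> k) \<le> B * norm (\<Psi> k)"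
          using v0_nonneg B by (intro mult_right_mono; simp)+
        moreover have "B * norm (\<Psi> k) \<le> B * (2 * S)" "B * (norm (Q k) + v0) \<le> B * S"
          using calculation B by (auto intro: mult_left_mono)
        ultimately have "B * norm (\<Psi> k) + (v0 + B * norm (Q k) + norm (\<Psi> k)) \<le> B * (2 * S) + B * S + B * (2 * S)"
          by (simp only: distrib_left)
        also have "\<dots> = 5 * B * S" by simp
        also have "\<dots> \<le> 5 * B * (C2 * (U + norm (v k)) + norm (v k) + norm (v (Suc k)) + v0)"
          using y B by (intro mult_left_mono) (auto simp: S_def)
        finally have "h * (B * norm (\<Psi> k) + (v0 + B * norm (Q k) + norm (\<Psi> k)))
            \<le> h * (5 * B * (C2 * (U + norm (v k)) + norm (v k) + norm (v (Suc k)) + v0))"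
          using h by (intro mult_left_mono) auto
        then show "h * B * norm (\<Psi> k) + h * (v0 + B * norm (Q k) + norm (\<Psi> k))
            \<le> 5 * B * h * (C2 * (U + norm (v k)) + norm (v k) + norm (v (Suc k)) + v0)"
          by (simp add: algebra_simps)
      qed
      also have "\<dots> = 5 * B * (C2 * (T * U + h * (\<Sum>k<N. norm (v k))) + h * (\<Sum>k<N. norm (v k))
          + h * (\<Sum>k<N. norm (v (Suc k))) + T * v0)"
        unfolding Nh[symmetric]
        by (simp add: sum.distrib sum_distrib_left distrib_left mult_ac)
      also have "\<dots> \<le> 5 * B * (C2 * (T * U + U) + U + U + T * (v0 * U))"
      proof -
        have "Z \<le> U" using J0 by (simp add: U_def)
        then have "h * (\<Sum>k<N. norm (v k)) \<le> U" "h * (\<Sum>k<N. norm (v (Suc k))) \<le> U"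
          using sum_v sum_v' by linarith+
        moreover have "v0 \<le> v0 * U" using v0_nonneg U by (simp add: mult_le_cancel_left1)
        ultimately show ?thesis using B C2 T by (intro mult_left_mono add_mono) auto
      qed
      finally have 2: "(\<Sum>k<N. h * B * norm (\<Psi> k) + h * (v0 + B * norm (Q k) + norm (\<Psi> k)))
          \<le> 5 * B * (C2 * (T + 1) + 2 + v0 * T) * U" by (simp add: algebra_simps)
      have "(\<Sum>k<N. g k) = (\<Sum>k<N. B * X k + Y k) + (\<Sum>k<N. h * B * norm (\<Psi> k) + h * (v0 + B * norm (Q k) + norm (\<Psi> k)))"
        unfolding sum.distrib[symmetric] g_def gp_def gq_def by (simp add: algebra_simps)
      also have "\<dots> \<le> (B * (C1 * (T + 1)) + v0 * T) * U + 5 * B * (C2 * (T + 1) + 2 + v0 * T) * U"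
        using 1 2 by (rule add_mono)
      also have "\<dots> = G * U" by (simp add: G_def algebra_simps)
      finally show ?thesis .
    qed
    have X0: "0 \<le> X k" "0 \<le> Y k" if "k < N" for k
    proof -
      have "{\<tau> k..\<tau> (Suc k)} \<subseteq> {0..T}" using le[of k] \<tau>T[OF that] h by auto
      then show "0 \<le> X k" "0 \<le> Y k" unfolding X_def Y_def using v0_nonneg B
        by (auto intro!: integral_nonneg integrable_continuous_interval continuous_intros continuous_on_subset[OF p] continuous_on_subset[OF q])
    qed
    have g0: "0 \<le> g k" if "k < N" for k
      using X0[OF that] B h v0_nonneg by (auto simp: g_def gp_def gq_def)
    have gsum_n: "(\<Sum>k<n. g k) \<le> G * U" if "n \<le> N" for n
      by (rule order_trans[OF sum_mono2 gsum]) (use that g0 in auto)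
    define a where "a n = \<rho> n + h * (G * U)" for n
    have e: "e n \<le> a n + h * B * (\<Sum>k<n. e k)" if n: "n \<le> N" for n
    proof -
      have "norm (p (\<tau> n) - P n) \<le> h * B * (\<Sum>k<n. norm (q (\<tau> k) - Q k)) + h * (\<Sum>k<n. gp k)"
        using n
      proof (induction n)
        case (Suc n)
        have "norm (p (\<tau> (Suc n)) - P (Suc n)) \<le> norm (p (\<tau> n) - P n)
            + norm (p (\<tau> (Suc n)) - P (Suc n) - (p (\<tau> n) - P n))"
          using norm_triangle_ineq[of "p (\<tau> n) - P n" "p (\<tau> (Suc n)) - P (Suc n) - (p (\<tau> n) - P n)"] by simp
        then show ?case using Suc step_p[of n] by (simp add: algebra_simps)
      qed (simp add: start)
      \<comment> \<open>The \<open>r k\<close> are subtracted before norms are taken and return as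
        \<open>\<rho> n\<close>, the norm of their full sum. Bounding each \<open>norm (r k)\<close>
        would lose the cancellation between steps.\<close>
      moreover have "norm (q (\<tau> n) - Q n - (\<Sum>k<n. r k)) \<le> h * (\<Sum>k<n. norm (p (\<tau> k) - P k)) + h * (\<Sum>k<n. gq k)"
        using n
      proof (induction n)
        case (Suc n)
        define A where "A = q (\<tau> n) - Q n - (\<Sum>k<n. r k)"
        define E where "E = q (\<tau> (Suc n)) - Q (Suc n) - (q (\<tau> n) - Q n) - h *\<^sub>R (p (\<tau> n) - P n) - r n"
        have "q (\<tau> (Suc n)) - Q (Suc n) - (\<Sum>k<Suc n. r k) = A + h *\<^sub>R (p (\<tau> n) - P n) + E"
          by (simp add: A_def E_def)
        then have "norm (q (\<tau> (Suc n)) - Q (Suc n) - (\<Sum>k<Suc n. r k))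
            \<le> norm A + norm (h *\<^sub>R (p (\<tau> n) - P n)) + norm E"
          using norm_triangle_le[OF add_right_mono[OF norm_triangle_ineq]] by (metis order_refl)
        moreover have "norm A \<le> h * (\<Sum>k<n. norm (p (\<tau> k) - P k)) + h * (\<Sum>k<n. gq k)"
          using Suc by (simp add: A_def)
        moreover have "norm E \<le> h * gq n" using step_q[of n] Suc.prems by (simp add: E_def)
        moreover have "norm (h *\<^sub>R (p (\<tau> n) - P n)) = h * norm (p (\<tau> n) - P n)" using h by simp
        ultimately show ?case by (simp only: sum.lessThan_Suc distrib_left)
      qed (simp add: start)
      moreover have "norm (q (\<tau> n) - Q n) \<le> norm (q (\<tau> n) - Q n - (\<Sum>k<n. r k)) + \<rho> n"
        using norm_triangle_ineq[of "q (\<tau> n) - Q n - (\<Sum>k<n. r k)" "\<Sum>k<n. r k"] by (simp add: \<rho>)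
      ultimately have "e n \<le> \<rho> n + h * (\<Sum>k<n. g k) + (h * B * (\<Sum>k<n. norm (q (\<tau> k) - Q k)) + h * 1 * (\<Sum>k<n. norm (p (\<tau> k) - P k)))"
        by (simp add: e_def g_def sum.distrib distrib_left)
      also have "\<dots> \<le> \<rho> n + h * (G * U) + (h * B * (\<Sum>k<n. norm (q (\<tau> k) - Q k)) + h * B * (\<Sum>k<n. norm (p (\<tau> k) - P k)))"
        using gsum_n[OF n] h B by (intro add_mono mult_left_mono mult_right_mono sum_nonneg) auto
      finally show ?thesis by (simp add: a_def e_def sum.distrib distrib_left)
    qed
    have "e n \<le> a n + h * B * exp (B * (real N * h)) * (\<Sum>k<n. a k)"
      by (rule discrete_gronwall[OF e]) (use U G h B n in \<open>auto simp: a_def \<rho>_def\<close>)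
    also have "h * B * exp (B * (real N * h)) * (\<Sum>k<n. a k) = B * exp (B * T) * (h * (\<Sum>k<n. a k))"
      by (simp add: Nh)
    also have "\<dots> \<le> B * exp (B * T) * (h * (\<Sum>k<n. \<rho> k) + T * (h * (G * U)))"
    proof (intro mult_left_mono)
      have "h * (\<Sum>k<n. a k) = h * (\<Sum>k<n. \<rho> k) + (real n * h) * (h * (G * U))"
        by (simp add: a_def sum.distrib algebra_simps)
      also have "(real n * h) * (h * (G * U)) \<le> T * (h * (G * U))"
        using grid[OF n] G U h by (intro mult_right_mono) auto
      finally show "h * (\<Sum>k<n. a k) \<le> h * (\<Sum>k<n. \<rho> k) + T * (h * (G * U))" by simp
    qed (use B in auto)
    finally have "e n \<le> \<rho> n * 1 + (B * exp (B * T)) * (h * (\<Sum>k<n. \<rho> k)) + (G + B * exp (B * T) * T * G) * (h * U)"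
      by (simp add: a_def algebra_simps)
    also have "\<dots> \<le> \<rho> n * C + C * (h * (\<Sum>k<n. \<rho> k)) + C * (h * U)"
      using G B T h U
      by (intro add_mono mult_left_mono mult_right_mono mult_nonneg_nonneg sum_nonneg)
         (auto simp: C_def \<rho>_def algebra_simps intro!: add_nonneg_nonneg)
    finally show "norm (p (real n * h) - P n) + norm (q (real n * h) - Q n)
        \<le> C * (norm (noise_error w h n) + h * (\<Sum>k<n. norm (noise_error w h k))
             + h * (1 + norm (P 0) + norm (Q 0) + integral {0..T} (\<lambda>s. norm (w s))
                    + h * (\<Sum>k\<le>N. norm (w (real k * h)))))"
      by (simp add: e_def \<rho>_def U_def J_def Z_def v_def \<tau>_def algebra_simps)
  qed
qed

end

section \<open>Moments of the noise\<close>

lemma Basis_vec_real: "Basis = range (\<lambda>j. axis j (1::real))"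
  by (auto simp: Basis_vec_def)

lemma borel_measurable_vec_nth: "(\<lambda>x :: real ^ 'd. x $ i) \<in> borel_measurable borel"
  by (intro borel_measurable_continuous_onI continuous_intros)

lemma Int_stable_vimages: "Int_stable {Y -` A \<inter> S | A. A \<in> sets N}"
proof (rule Int_stableI)
  fix a b assume "a \<in> {Y -` A \<inter> S | A. A \<in> sets N}" "b \<in> {Y -` A \<inter> S | A. A \<in> sets N}"
  then obtain A B where "a = Y -` A \<inter> S" "b = Y -` B \<inter> S" "A \<in> sets N" "B \<in> sets N" by blast
  then show "a \<inter> b \<in> {Y -` A \<inter> S | A. A \<in> sets N}"
    by (auto intro!: exI[of _ "A \<inter> B"])
qed

text \<open>Tonelli: the density is a product, coordinate \<open>i\<close> also carries
  \<open>g\<close>, and every other coordinate integrates to 1. The product is moved to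
  \<open>Basis\<close>, over which the integral factorises.\<close>

lemma nn_integral_prod_component:
  fixes g :: "real \<Rightarrow> ennreal" and \<phi> :: "real \<Rightarrow> ennreal"
  assumes [measurable]: "g \<in> borel_measurable borel" "\<phi> \<in> borel_measurable borel"
    and \<phi>: "(\<integral>\<^sup>+ x. \<phi> x \<partial>lborel) = 1"
  shows "(\<integral>\<^sup>+ x. (\<Prod>j\<in>UNIV. \<phi> (x $ j)) * g (x $ i) \<partial>(lborel :: (real ^ 'd) measure)) = (\<integral>\<^sup>+ x. \<phi> x * g x \<partial>lborel)"
proof -
  define f where "f b x = \<phi> x * (if b = axis i (1::real) then g x else 1)" for b :: "real ^ 'd" and x
  have [measurable]: "f b \<in> borel_measurable borel" for b unfolding f_def[abs_def] by (cases "b = axis i 1") simp_all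
  have inj: "inj (\<lambda>j::'d. axis j (1::real))" by (auto simp: inj_def axis_eq_axis)
  have "(\<Prod>j\<in>UNIV. \<phi> (x $ j)) * g (x $ i) = (\<Prod>b\<in>Basis. f b (x \<bullet> b))" for x :: "real ^ 'd"
    unfolding Basis_vec_real using inj
    by (subst prod.reindex) (auto simp: f_def inner_axis axis_eq_axis prod.distrib prod.If_cases)
  then have "(\<integral>\<^sup>+ x. (\<Prod>j\<in>UNIV. \<phi> (x $ j)) * g (x $ i) \<partial>(lborel :: (real ^ 'd) measure))
      = (\<Prod>b\<in>Basis. (\<integral>\<^sup>+ x. f b x \<partial>lborel))"
    by (simp add: nn_integral_lborel_prod)
  also have "\<dots> = (\<Prod>j\<in>UNIV. (\<integral>\<^sup>+ x. f (axis j 1) x \<partial>lborel))"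
    unfolding Basis_vec_real using inj by (subst prod.reindex) auto
  also have "\<dots> = (\<Prod>j\<in>UNIV. if j = i then (\<integral>\<^sup>+ x. \<phi> x * g x \<partial>lborel) else 1)"
    by (intro prod.cong) (auto simp: f_def axis_eq_axis \<phi>)
  also have "\<dots> = (\<integral>\<^sup>+ x. \<phi> x * g x \<partial>lborel)" by (simp add: prod.delta)
  finally show ?thesis .
qed

text \<open>Abel summation: the increment from \<open>j\<close> to \<open>Suc j\<close> occurs in
  the terms with \<open>i \<le> j\<close>, of which there are \<open>Suc j\<close>.\<close>

lemma sum_block_by_parts:
  fixes x :: "nat \<Rightarrow> 'b::real_vector"
  shows "(\<Sum>i<m. x i - x m) = - (\<Sum>j<m. real (Suc j) *\<^sub>R (x (Suc j) - x j))"
proof (induction m)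
  case (Suc m)
  have "(\<Sum>i<Suc m. x i - x (Suc m)) = (\<Sum>i<m. (x i - x m) + (x m - x (Suc m))) + (x m - x (Suc m))" by simp
  also have "\<dots> = (\<Sum>i<m. x i - x m) - real (Suc m) *\<^sub>R (x (Suc m) - x m)"
    by (simp only: sum.distrib sum_constant) (simp add: algebra_simps scaleR_left_distrib sum_constant_scaleR)
  finally show ?case by (simp add: Suc.IH)
qed simp

section \<open>Brownian increments\<close>

locale brownian_setting = prob_space M for M :: "'a measure" +
  fixes T :: real and F :: "real \<Rightarrow> 'a measure" and W :: "real \<Rightarrow> 'a \<Rightarrow> real ^ 'd"
  assumes T: "0 < T" and filt: "normal_filtration M T F" and bm: "brownian_motion M T F W"
begin

lemma subalg: "t \<in> {0..T} \<Longrightarrow> subalgebra M (F t)"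
  using filt by (simp add: normal_filtration_def)

lemma F_mono: "f \<in> borel_measurable (F s) \<Longrightarrow> s \<le> t \<Longrightarrow> f \<in> borel_measurable (F t)"
proof -
  assume f: "f \<in> borel_measurable (F s)" and st: "s \<le> t"
  have "filtration (space M) F" using filt by (simp add: normal_filtration_def)
  from filtration.sets_F_mono[OF this st] filtration.space_F[OF this]
  have "sets (F s) \<subseteq> sets (F t)" "space (F s) = space (F t)" by auto
  with f show ?thesis by (auto simp: measurable_def)
qed

lemma F_meas: "f \<in> borel_measurable (F t) \<Longrightarrow> t \<in> {0..T} \<Longrightarrow> f \<in> borel_measurable M"
  using measurable_from_subalg[OF subalg] by blast

lemma W_meas_F: "t \<in> {0..T} \<Longrightarrow> W t \<in> borel_measurable (F t)"
  using bm by (simp add: brownian_motion_def)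

lemma W_meas [measurable]: "t \<in> {0..T} \<Longrightarrow> W t \<in> borel_measurable M"
  using F_meas W_meas_F by blast

lemma W_cont: "\<omega> \<in> space M \<Longrightarrow> continuous_on {0..T} (\<lambda>t. W t \<omega>)"
  using bm by (simp add: brownian_motion_def)

text \<open>A marginal of the product density. Scalar components are enough later on, because the
  norm of a vector is bounded by the sum of its absolute components.\<close>

lemma increment_normal:
  assumes "0 \<le> s" "s < t" "t \<le> T"
  shows "distributed M lborel (\<lambda>\<omega>. (W t \<omega> - W s \<omega>) $ i) (\<lambda>x. ennreal (normal_density 0 (sqrt (t - s)) x))"
proof -
  have d: "distributed M lborel (\<lambda>\<omega>. W t \<omega> - W s \<omega>)
      (\<lambda>x. ennreal (\<Prod>i\<in>UNIV. normal_density 0 (sqrt (t - s)) (x $ i)))"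
    using bm assms by (simp add: brownian_motion_def)
  have [measurable]: "(\<lambda>\<omega>. W t \<omega> - W s \<omega>) \<in> borel_measurable M"
    using distributed_measurable[OF d] by simp
  have m: "(\<lambda>\<omega>. (W t \<omega> - W s \<omega>) $ i) \<in> borel_measurable M"
    by (rule measurable_compose[OF _ borel_measurable_vec_nth]) measurable
  have one: "(\<integral>\<^sup>+ x. ennreal (normal_density 0 (sqrt (t - s)) x) \<partial>lborel) = 1"
    using prob_space.emeasure_space_1[OF prob_space_normal_density[of "sqrt (t - s)" 0]] assms
    by (simp add: emeasure_density)
  show ?thesis unfolding distributed_def
  proof (intro conjI measure_eqI)
    fix A assume "A \<in> sets (distr M lborel (\<lambda>\<omega>. (W t \<omega> - W s \<omega>) $ i))"
    then have A [measurable]: "A \<in> sets borel" by simp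
    have "emeasure (distr M lborel (\<lambda>\<omega>. (W t \<omega> - W s \<omega>) $ i)) A
        = (\<integral>\<^sup>+ y. indicator A y \<partial>distr M lborel (\<lambda>\<omega>. (W t \<omega> - W s \<omega>) $ i))" by simp
    also have "\<dots> = (\<integral>\<^sup>+ \<omega>. indicator A ((W t \<omega> - W s \<omega>) $ i) \<partial>M)"
      by (rule nn_integral_distr) (use m in simp_all)
    also have "\<dots> = (\<integral>\<^sup>+ x. ennreal (\<Prod>i\<in>UNIV. normal_density 0 (sqrt (t - s)) (x $ i)) * indicator A (x $ i) \<partial>lborel)"
      by (rule distributed_nn_integral[OF d, symmetric]) simp
    also have "\<dots> = (\<integral>\<^sup>+ x. (\<Prod>i\<in>UNIV. ennreal (normal_density 0 (sqrt (t - s)) (x $ i))) * indicator A (x $ i) \<partial>lborel)"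
      by (simp add: prod_ennreal)
    also have "\<dots> = (\<integral>\<^sup>+ x. ennreal (normal_density 0 (sqrt (t - s)) x) * indicator A x \<partial>lborel)"
      by (rule nn_integral_prod_component) (use one in simp_all)
    also have "\<dots> = emeasure (density lborel (\<lambda>x. ennreal (normal_density 0 (sqrt (t - s)) x))) A"
      by (simp add: emeasure_density)
    finally show "emeasure (distr M lborel (\<lambda>\<omega>. (W t \<omega> - W s \<omega>) $ i)) A
        = emeasure (density lborel (\<lambda>x. ennreal (normal_density 0 (sqrt (t - s)) x))) A" .
  qed (use m in simp_all)
qed

lemma increment_moment:
  assumes st: "0 \<le> s" "s \<le> t" "t \<le> T" and k: "0 < k"
  shows "moment_le M (2 * k) (\<lambda>\<omega>. (W t \<omega> - W s \<omega>) $ i) (fact (2 * k) / (2 ^ k * fact k) * (t - s) ^ k)"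
proof (cases "s = t")
  case False
  then have s: "s < t" using st by simp
  note d = increment_normal[OF st(1) s st(3), of i]
  let ?\<sigma> = "sqrt (t - s)"
  have m: "has_bochner_integral lborel (\<lambda>x. normal_density 0 ?\<sigma> x * x ^ (2 * k)) (fact (2 * k) / ((2 / ?\<sigma>\<^sup>2) ^ k * fact k))"
    using normal_moment_even[of ?\<sigma> 0 k] s by simp
  have "integrable M (\<lambda>\<omega>. ((W t \<omega> - W s \<omega>) $ i) ^ (2 * k))"
    using distributed_integrable[OF d, of "\<lambda>x. x ^ (2 * k)"] m by (simp add: has_bochner_integral_iff)
  moreover have "(\<integral>\<omega>. ((W t \<omega> - W s \<omega>) $ i) ^ (2 * k) \<partial>M) = fact (2 * k) / ((2 / ?\<sigma>\<^sup>2) ^ k * fact k)"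
    using distributed_integral[OF d, of "\<lambda>x. x ^ (2 * k)"] m by (simp add: has_bochner_integral_iff)
  ultimately show ?thesis
    using s distributed_measurable[OF d] by (intro moment_leI) (auto simp: power_even_abs power_divide)
\<comment> \<open>For \<open>s = t\<close> the increment has no density; it is 0, and so is the
  bound, because \<open>0 < k\<close>.\<close>
qed (use k in \<open>simp add: moment_le_def zero_power\<close>)

lemma increment_mean_zero:
  assumes "0 \<le> s" "s < t" "t \<le> T"
  shows "integrable M (\<lambda>\<omega>. (W t \<omega> - W s \<omega>) $ i)" "(\<integral>\<omega>. (W t \<omega> - W s \<omega>) $ i \<partial>M) = 0"
proof -
  note d = increment_normal[OF assms, of i]
  have m: "has_bochner_integral lborel (\<lambda>x. normal_density 0 (sqrt (t - s)) x * x) 0"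
    using normal_moment_odd[of "sqrt (t - s)" 0 0] assms by simp
  show "integrable M (\<lambda>\<omega>. (W t \<omega> - W s \<omega>) $ i)"
    using distributed_integrable[OF d, of "\<lambda>x. x"] m by (simp add: has_bochner_integral_iff)
  show "(\<integral>\<omega>. (W t \<omega> - W s \<omega>) $ i \<partial>M) = 0"
    using distributed_integral[OF d, of "\<lambda>x. x"] m by (simp add: has_bochner_integral_iff)
qed

text \<open>Independence is given for \<open>F s\<close> and the vector increment. Preimages under
  \<open>X\<close> lie in \<open>F s\<close>, and preimages under a component are preimages under
  the vector, so both families only shrink; being closed under intersection, they pass independence
  on to the generated sigma-algebras.\<close>

lemma increment_indep:
  assumes "0 \<le> s" "s < t" "t \<le> T" and X: "X \<in> borel_measurable (F s)"
  shows "indep_var borel X borel (\<lambda>\<omega>. (W t \<omega> - W s \<omega>) $ i)"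
proof -
  have s: "s \<in> {0..T}" "t \<in> {0..T}" using assms by auto
  have sp: "space (F s) = space M" using subalg[OF s(1)] by (simp add: subalgebra_def)
  have ind: "indep_set (sets (F s)) {(\<lambda>\<omega>. W t \<omega> - W s \<omega>) -` A \<inter> space M | A. A \<in> sets borel}"
    using bm assms by (simp add: brownian_motion_def)
  have sub: "{X -` A \<inter> space M | A. A \<in> sets borel} \<subseteq> sets (F s)"
    using measurable_sets[OF X] by (auto simp: sp)
  let ?D = "\<lambda>\<omega>. (W t \<omega> - W s \<omega>) $ i"
  have sub': "{?D -` A \<inter> space M | A. A \<in> sets borel} \<subseteq> {(\<lambda>\<omega>. W t \<omega> - W s \<omega>) -` A \<inter> space M | A. A \<in> sets borel}"
  proof clarify
    fix A :: "real set" assume "A \<in> sets borel"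
    then have "(\<lambda>x :: real ^ 'd. x $ i) -` A \<in> sets borel"
      using measurable_sets[OF borel_measurable_vec_nth, of A] by simp
    then show "\<exists>B. ?D -` A \<inter> space M = (\<lambda>\<omega>. W t \<omega> - W s \<omega>) -` B \<inter> space M \<and> B \<in> sets borel"
      by (intro exI[of _ "(\<lambda>x :: real ^ 'd. x $ i) -` A"]) auto
  qed
  have "indep_set {X -` A \<inter> space M | A. A \<in> sets borel} {?D -` A \<inter> space M | A. A \<in> sets borel}"
    unfolding indep_set_def
    by (rule indep_sets_mono_sets[OF ind[unfolded indep_set_def]]) (use sub sub' in \<open>simp split: bool.split\<close>)
  then have "indep_set (sigma_sets (space M) {X -` A \<inter> space M | A. A \<in> sets borel})
      (sigma_sets (space M) {?D -` A \<inter> space M | A. A \<in> sets borel})"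
    by (intro indep_set_sigma_sets Int_stable_vimages)
  moreover have "?D \<in> borel_measurable M"
    using distributed_measurable[OF increment_normal[OF assms(1-3)], of i] by simp
  ultimately show ?thesis
    using F_meas[OF X s(1)] unfolding indep_var_eq by simp
qed

text \<open>A discrete form of the Ito isometry: the partial sum is measurable with respect to the
  past of the next increment, which is independent of it and has mean 0, so mixed terms vanish and
  second moments add. Each increment over a cell contributes at most
  \<open>h\<^sup>2 * \<delta>\<close>.\<close>

lemma weighted_increments_moment:
  assumes \<delta>: "0 < \<delta>" and c: "\<And>j. \<bar>c j\<bar> \<le> h"
  shows "real n * \<delta> \<le> T \<Longrightarrow>
    moment_le M 2 (\<lambda>\<omega>. \<Sum>j<n. c j * ((W (real (Suc j) * \<delta>) \<omega> - W (real j * \<delta>) \<omega>) $ i)) (h\<^sup>2 * (real n * \<delta>))"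
proof (induction n)
  case (Suc n)
  define S where "S \<omega> = (\<Sum>j<n. c j * ((W (real (Suc j) * \<delta>) \<omega> - W (real j * \<delta>) \<omega>) $ i))" for \<omega>
  define D where "D \<omega> = (W (real (Suc n) * \<delta>) \<omega> - W (real n * \<delta>) \<omega>) $ i" for \<omega>
  have n: "0 \<le> real n * \<delta>" "real n * \<delta> < real (Suc n) * \<delta>" using \<delta> by (auto simp: algebra_simps)
  have IH: "moment_le M 2 S (h\<^sup>2 * (real n * \<delta>))" using Suc n by (simp add: S_def[abs_def])
  \<comment> \<open>The Gaussian constant at \<open>k = 1\<close> is 1, leaving the variance
    \<open>\<delta>\<close>.\<close>
  have \<delta>1: "fact (2 * 1) / (2 ^ 1 * fact 1) * (real (Suc n) * \<delta> - real n * \<delta>) ^ 1 = \<delta>"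
    by (simp add: algebra_simps)
  have "moment_le M (2 * 1) D \<delta>"
    using increment_moment[of "real n * \<delta>" "real (Suc n) * \<delta>" 1 i, unfolded \<delta>1] n Suc.prems by (simp add: D_def[abs_def])
  then have D: "moment_le M 2 D \<delta>" by (simp only: mult_1_right)
  have j: "real j * \<delta> \<in> {0..T}" if "j \<le> n" for j
  proof -
    have "real j * \<delta> \<le> real n * \<delta>" using that \<delta> by (intro mult_right_mono) auto
    then have "real j * \<delta> \<le> T" using n(2) Suc.prems by linarith
    then show ?thesis using \<delta> by simp
  qed
  have W_F: "(\<lambda>\<omega>. W (real j * \<delta>) \<omega> $ i) \<in> borel_measurable (F (real n * \<delta>))" if "j \<le> n" for j
    by (rule measurable_compose[OF F_mono[OF W_meas_F[OF j[OF that]]] borel_measurable_vec_nth])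
       (use that \<delta> in simp)
  have "(\<lambda>\<omega>. c j * (W (real (Suc j) * \<delta>) \<omega> $ i - W (real j * \<delta>) \<omega> $ i)) \<in> borel_measurable (F (real n * \<delta>))"
    if "j < n" for j
    using W_F[of j] W_F[of "Suc j"] that
    by (intro borel_measurable_times borel_measurable_diff borel_measurable_const) auto
  then have SF: "S \<in> borel_measurable (F (real n * \<delta>))"
    unfolding S_def[abs_def] by (intro borel_measurable_sum) simp
  have int: "integrable M S" "integrable M D"
    using moment_leD(4)[OF moment_le_lower[OF IH, of 1]] moment_leD(2)[OF IH]
      moment_leD(4)[OF moment_le_lower[OF D, of 1]] moment_leD(2)[OF D]
    by (simp_all add: integrable_abs_iff)
  note ind = increment_indep[OF n Suc.prems SF, of i, folded D_def]
  have SD: "integrable M (\<lambda>\<omega>. S \<omega> * D \<omega>)" "(\<integral>\<omega>. S \<omega> * D \<omega> \<partial>M) = 0"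
    using indep_var_integrable[OF ind int] indep_var_lebesgue_integral[OF ind int]
      increment_mean_zero[OF n Suc.prems, of i, folded D_def] by simp_all
  have S2: "integrable M (\<lambda>\<omega>. (S \<omega>)\<^sup>2)" "(\<integral>\<omega>. (S \<omega>)\<^sup>2 \<partial>M) \<le> h\<^sup>2 * (real n * \<delta>)"
    and D2: "integrable M (\<lambda>\<omega>. (D \<omega>)\<^sup>2)" "(\<integral>\<omega>. (D \<omega>)\<^sup>2 \<partial>M) \<le> \<delta>"
    using moment_leD(4,5)[OF IH] moment_leD(4,5)[OF D] by (simp_all add: power2_abs)
  have "moment_le M 2 (\<lambda>\<omega>. S \<omega> + c n * D \<omega>) (h\<^sup>2 * (real (Suc n) * \<delta>))"
  proof (rule moment_leI)
    have eq: "\<bar>S \<omega> + c n * D \<omega>\<bar>\<^sup>2 = (S \<omega>)\<^sup>2 + 2 * c n * (S \<omega> * D \<omega>) + (c n)\<^sup>2 * (D \<omega>)\<^sup>2" for \<omega>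
      by (simp add: power2_sum power_mult_distrib)
    show "(\<lambda>\<omega>. S \<omega> + c n * D \<omega>) \<in> borel_measurable M"
      using moment_leD(2)[OF IH] moment_leD(2)[OF D] by simp
    show "integrable M (\<lambda>\<omega>. \<bar>S \<omega> + c n * D \<omega>\<bar>\<^sup>2)" unfolding eq using S2 D2 SD by simp
    have "(\<integral>\<omega>. \<bar>S \<omega> + c n * D \<omega>\<bar>\<^sup>2 \<partial>M)
        = (\<integral>\<omega>. (S \<omega>)\<^sup>2 \<partial>M) + 2 * c n * (\<integral>\<omega>. S \<omega> * D \<omega> \<partial>M) + (c n)\<^sup>2 * (\<integral>\<omega>. (D \<omega>)\<^sup>2 \<partial>M)"
      unfolding eq using S2(1) D2(1) SD(1) by simp
    also have "\<dots> \<le> h\<^sup>2 * (real n * \<delta>) + 0 + h\<^sup>2 * \<delta>"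
      using S2(2) D2(2) SD(2) power_mono[OF c[of n], of 2] \<delta>
      by (intro add_mono mult_mono) auto
    finally show "(\<integral>\<omega>. \<bar>S \<omega> + c n * D \<omega>\<bar>\<^sup>2 \<partial>M) \<le> h\<^sup>2 * (real (Suc n) * \<delta>)" by (simp add: algebra_simps)
  qed
  then show ?case by (simp add: S_def D_def)
qed (simp add: moment_le_def)

end

section \<open>The noise and Riemann sums of its integrals\<close>

text \<open>\<open>W 0\<close> is subtracted because Brownian motion starts at 0 only almost surely,
  while the pathwise estimates ask for a noise path that vanishes at time 0.\<close>

definition noise :: "real ^ 'd ^ 'm \<Rightarrow> (real \<Rightarrow> 'a \<Rightarrow> real ^ 'd) \<Rightarrow> real \<Rightarrow> 'a \<Rightarrow> real ^ 'm" where
  "noise \<Sigma> W t \<omega> = \<Sigma> *v (W t \<omega> - W 0 \<omega>)"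

lemma noise_diff: "noise \<Sigma> W t \<omega> - noise \<Sigma> W s \<omega> = \<Sigma> *v (W t \<omega> - W s \<omega>)"
  by (simp add: noise_def matrix_vector_mult_diff_distrib[symmetric])

lemma norm_matrix_vector_mult_le:
  fixes \<Sigma> :: "real ^ 'd ^ 'm"
  shows "norm (\<Sigma> *v x) \<le> onorm ((*v) \<Sigma>) * (\<Sum>i\<in>UNIV. \<bar>x $ i\<bar>)"
proof -
  have "norm (\<Sigma> *v x) \<le> onorm ((*v) \<Sigma>) * norm x"
    by (rule onorm[OF matrix_vector_mul_bounded_linear])
  also have "\<dots> \<le> onorm ((*v) \<Sigma>) * (\<Sum>i\<in>UNIV. \<bar>x $ i\<bar>)"
    by (intro mult_left_mono norm_le_l1_cart onorm_pos_le matrix_vector_mul_bounded_linear)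
  finally show ?thesis .
qed

context brownian_setting
begin

lemma noise_continuous:
  "\<omega> \<in> space M \<Longrightarrow> continuous_on {0..T} (\<lambda>t. noise \<Sigma> W t \<omega>)"
  unfolding noise_def
  by (intro bounded_linear.continuous_on[OF matrix_vector_mul_bounded_linear] continuous_intros W_cont)

lemma noise_meas [measurable]: "t \<in> {0..T} \<Longrightarrow> noise \<Sigma> W t \<in> borel_measurable M"
proof -
  assume t: "t \<in> {0..T}"
  have "(\<lambda>x. \<Sigma> *v x) \<in> borel_measurable borel"
    by (intro borel_measurable_continuous_onI matrix_vector_mult_linear_continuous_on)
  moreover have "(\<lambda>\<omega>. W t \<omega> - W 0 \<omega>) \<in> borel_measurable M"
    using W_meas[OF t] W_meas[of 0] T by (intro borel_measurable_diff) auto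
  ultimately show ?thesis unfolding noise_def[abs_def] by (rule measurable_compose[rotated])
qed

text \<open>Every absolute component gets the operator norm of \<open>\<Sigma>\<close> as its
  weight, so the total weight is this norm times the dimension.\<close>

lemma moment_le_matrix_mult:
  fixes \<Sigma> :: "real ^ 'd ^ 'm" and X :: "'a \<Rightarrow> real ^ 'd"
  assumes X: "\<And>i. moment_le M k (\<lambda>\<omega>. X \<omega> $ i) c" and k: "0 < k"
    and m: "(\<lambda>\<omega>. \<Sigma> *v X \<omega>) \<in> borel_measurable M"
  shows "moment_le M k (\<lambda>\<omega>. norm (\<Sigma> *v X \<omega>)) ((onorm ((*v) \<Sigma>) * real CARD('d)) ^ k * c)"
proof -
  have s: "0 \<le> onorm ((*v) \<Sigma>)" by (intro onorm_pos_le matrix_vector_mul_bounded_linear)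
  have "moment_le M k (\<lambda>\<omega>. \<Sum>i\<in>UNIV. onorm ((*v) \<Sigma>) * \<bar>X \<omega> $ i\<bar>) ((onorm ((*v) \<Sigma>) * real CARD('d)) ^ k * c)"
  proof (rule moment_le_weighted_sum)
    fix i
    have [measurable]: "(\<lambda>\<omega>. X \<omega> $ i) \<in> borel_measurable M" using moment_leD(2)[OF X] .
    show "moment_le M k (\<lambda>\<omega>. \<bar>X \<omega> $ i\<bar>) c" by (rule moment_le_mono[OF X]) auto
  qed (use s k moment_leD(1)[OF X] in \<open>auto simp: mult.commute\<close>)
  then show ?thesis
    by (rule moment_le_mono)
       (use m norm_matrix_vector_mult_le[of \<Sigma>] in \<open>auto simp: sum_distrib_left intro!: AE_I2 order_trans[OF _ abs_ge_self]\<close>)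
qed

text \<open>Even Gaussian moments: an increment has size \<open>sqrt (t - s)\<close>, so the moment
  of order \<open>2 * k\<close> scales like \<open>(t - s) ^ k\<close>. The constant is fixed before
  \<open>s\<close> and \<open>t\<close>.\<close>

lemma noise_moments:
  assumes k: "0 < k"
  obtains c where "0 \<le> c"
    "\<And>s t. 0 \<le> s \<Longrightarrow> s \<le> t \<Longrightarrow> t \<le> T \<Longrightarrow>
       moment_le M (2 * k) (\<lambda>\<omega>. norm (noise \<Sigma> W t \<omega> - noise \<Sigma> W s \<omega>)) (c * (t - s) ^ k)"
proof (rule that[of "(onorm ((*v) \<Sigma>) * real CARD('d)) ^ (2 * k) * (fact (2 * k) / (2 ^ k * fact k))"])
  show "0 \<le> (onorm ((*v) \<Sigma>) * real CARD('d)) ^ (2 * k) * (fact (2 * k) / (2 ^ k * fact k))"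
    by (simp add: onorm_pos_le)
  fix s t assume st: "0 \<le> s" "s \<le> t" "t \<le> T"
  have m: "(\<lambda>\<omega>. \<Sigma> *v (W t \<omega> - W s \<omega>)) \<in> borel_measurable M"
    unfolding noise_diff[symmetric] using st by (intro borel_measurable_diff noise_meas) auto
  show "moment_le M (2 * k) (\<lambda>\<omega>. norm (noise \<Sigma> W t \<omega> - noise \<Sigma> W s \<omega>))
      ((onorm ((*v) \<Sigma>) * real CARD('d)) ^ (2 * k) * (fact (2 * k) / (2 ^ k * fact k)) * (t - s) ^ k)"
    unfolding noise_diff mult.assoc[of _ "fact (2 * k) / (2 ^ k * fact k)"]
    by (rule moment_le_matrix_mult[OF increment_moment[OF st k] _ m]) (use k in simp)
qed

text \<open>Riemann sums have weights of total \<open>T\<close>, whence the same bound for each of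
  them, and Fatou carries it over to the integral.\<close>

lemma noise_integral_moment:
  assumes k: "0 < k" and c: "\<And>t. t \<in> {0..T} \<Longrightarrow> moment_le M k (\<lambda>\<omega>. norm (noise \<Sigma> W t \<omega>)) c"
  shows "moment_le M k (\<lambda>\<omega>. integral {0..T} (\<lambda>s. norm (noise \<Sigma> W s \<omega>))) (T ^ k * c)"
proof (rule moment_le_LIMSEQ)
  fix m
  let ?h = "T / real (Suc m)"
  have grid: "real i * ?h \<in> {0..T}" if "i < Suc m" for i
  proof -
    have "real i * ?h \<le> real (Suc m) * ?h" using T that by (intro mult_right_mono) auto
    also have "\<dots> = T" by simp
    finally show ?thesis using T by simp
  qed
  show "moment_le M k (\<lambda>\<omega>. \<Sum>i<Suc m. ?h * norm (noise \<Sigma> W (real i * ?h) \<omega>)) (T ^ k * c)"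
    by (rule moment_le_weighted_sum)
       (use T k moment_leD(1)[OF c[of 0]] grid c in \<open>auto simp del: of_nat_Suc\<close>)
next
  fix \<omega> assume "\<omega> \<in> space M"
  then have "continuous_on {0..T} (\<lambda>t. norm (noise \<Sigma> W t \<omega>))"
    by (intro continuous_intros noise_continuous)
  from riemann_sum_LIMSEQ[OF _ this] T
  show "(\<lambda>m. \<Sum>i<Suc m. T / real (Suc m) * norm (noise \<Sigma> W (real i * (T / real (Suc m))) \<omega>))
      \<longlonglongrightarrow> integral {0..T} (\<lambda>s. norm (noise \<Sigma> W s \<omega>))" by simp
qed

text \<open>The nodes are written as multiples of \<open>h / real m\<close>, so that the steps and
  their subdivisions form one grid, over whose cells the increments of \<open>W\<close> can be
  treated in a single sum.\<close>

definition riemann_noise_error :: "real ^ 'd ^ 'm \<Rightarrow> real \<Rightarrow> nat \<Rightarrow> nat \<Rightarrow> 'a \<Rightarrow> real ^ 'm" where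
  "riemann_noise_error \<Sigma> h n m \<omega> =
     (\<Sum>k<n. \<Sum>i<m. (h / real m) *\<^sub>R
        (noise \<Sigma> W (real (k * m + i) * (h / real m)) \<omega> - noise \<Sigma> W (real (k * m + m) * (h / real m)) \<omega>))"

lemma riemann_grid:
  assumes "0 < h" "real n * h \<le> T" "k < n" "i \<le> m" "0 < m"
  shows "real (k * m + i) * (h / real m) \<in> {0..T}"
    "real (k * m + i) * (h / real m) = real k * h + real i * (h / real m)"
    "real (k * m + m) * (h / real m) = real (Suc k) * h"
proof -
  show eq: "real (k * m + i) * (h / real m) = real k * h + real i * (h / real m)"
    "real (k * m + m) * (h / real m) = real (Suc k) * h"
    using assms by (auto simp: field_simps)
  have "real (k * m + i) * (h / real m) \<le> real (k * m + m) * (h / real m)"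
    using assms by (intro mult_right_mono) auto
  also have "\<dots> \<le> real n * h" unfolding eq(2) using assms by (intro mult_right_mono) auto
  finally show "real (k * m + i) * (h / real m) \<in> {0..T}" using assms by auto
qed

lemma riemann_noise_error_meas:
  assumes "0 < h" "real n * h \<le> T" "0 < m"
  shows "riemann_noise_error \<Sigma> h n m \<in> borel_measurable M"
  unfolding riemann_noise_error_def[abs_def]
  using riemann_grid(1)[OF assms(1,2) _ _ assms(3)]
  by (intro borel_measurable_sum borel_measurable_scaleR borel_measurable_diff borel_measurable_const noise_meas) auto

lemma riemann_noise_error_LIMSEQ:
  assumes h: "0 < h" and n: "real n * h \<le> T" and \<omega>: "\<omega> \<in> space M"
  shows "(\<lambda>m. riemann_noise_error \<Sigma> h n (Suc m) \<omega>) \<longlonglongrightarrow> noise_error (\<lambda>t. noise \<Sigma> W t \<omega>) h n"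
  unfolding riemann_noise_error_def noise_error_def
proof (rule tendsto_sum)
  fix k assume "k \<in> {..<n}"
  then have k: "k < n" by simp
  have le: "real (Suc k) * h \<le> T" using riemann_grid(1,3)[OF h n k, of 1 1] by auto
  have kh: "real k * h \<le> real (Suc k) * h" "real (Suc k) * h - real k * h = h" using h by (auto simp: algebra_simps)
  have "{real k * h..real (Suc k) * h} \<subseteq> {0..T}" using le h by auto
  then have "continuous_on {real k * h..real (Suc k) * h} (\<lambda>s. noise \<Sigma> W s \<omega> - noise \<Sigma> W (real (Suc k) * h) \<omega>)"
    by (intro continuous_intros continuous_on_subset[OF noise_continuous[OF \<omega>]])
  from riemann_sum_LIMSEQ[OF kh(1) this]
  show "(\<lambda>m. \<Sum>i<Suc m. (h / real (Suc m)) *\<^sub>R (noise \<Sigma> W (real (k * Suc m + i) * (h / real (Suc m))) \<omega>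
          - noise \<Sigma> W (real (k * Suc m + Suc m) * (h / real (Suc m))) \<omega>))
      \<longlonglongrightarrow> integral {real k * h..real (Suc k) * h} (\<lambda>s. noise \<Sigma> W s \<omega> - noise \<Sigma> W (real (Suc k) * h) \<omega>)"
  proof (rule Lim_transform_eventually, intro always_eventually allI sum.cong refl)
    fix m i assume "i \<in> {..<Suc m}"
    then have i: "i \<le> Suc m" by simp
    show "((real (Suc k) * h - real k * h) / real (Suc m)) *\<^sub>R
         (noise \<Sigma> W (real k * h + real i * ((real (Suc k) * h - real k * h) / real (Suc m))) \<omega> - noise \<Sigma> W (real (Suc k) * h) \<omega>)
      = (h / real (Suc m)) *\<^sub>R (noise \<Sigma> W (real (k * Suc m + i) * (h / real (Suc m))) \<omega>
          - noise \<Sigma> W (real (k * Suc m + Suc m) * (h / real (Suc m))) \<omega>)"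
      unfolding kh(2) using riemann_grid(2,3)[OF h n k i] by simp
  qed
qed

lemma noise_error_norm_LIMSEQ:
  assumes h: "0 < h" and n: "real n * h \<le> T"
    and c: "\<And>m. moment_le M k (\<lambda>\<omega>. norm (riemann_noise_error \<Sigma> h n (Suc m) \<omega>)) c"
  shows "moment_le M k (\<lambda>\<omega>. norm (noise_error (\<lambda>t. noise \<Sigma> W t \<omega>) h n)) c"
  by (rule moment_le_LIMSEQ[where X = "\<lambda>m \<omega>. norm (riemann_noise_error \<Sigma> h n (Suc m) \<omega>)", OF c]) (intro tendsto_norm riemann_noise_error_LIMSEQ h n)

text \<open>Order 1/2, for all moments: every increment over a single step has size \<open>sqrt h\<close>.\<close>

lemma noise_error_moment:
  assumes h: "0 < h" and n: "real n * h \<le> T" and k: "0 < k" and c0: "0 \<le> c"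
    and c: "\<And>s t. 0 \<le> s \<Longrightarrow> s \<le> t \<Longrightarrow> t \<le> T \<Longrightarrow>
       moment_le M (2 * k) (\<lambda>\<omega>. norm (noise \<Sigma> W t \<omega> - noise \<Sigma> W s \<omega>)) (c * (t - s) ^ k)"
  shows "moment_le M (2 * k) (\<lambda>\<omega>. norm (noise_error (\<lambda>t. noise \<Sigma> W t \<omega>) h n)) (T ^ (2 * k) * (c * h ^ k))"
proof (rule noise_error_norm_LIMSEQ[OF h n])
  fix m'
  define m where "m = Suc m'"
  have m: "0 < m" by (simp add: m_def)
  \<comment> \<open>The later time comes first, so that the moment hypothesis on forward increments
    applies; the norm hides the sign.\<close>
  let ?X = "\<lambda>(j, i) \<omega>. norm (noise \<Sigma> W (real (j * m + m) * (h / real m)) \<omega> - noise \<Sigma> W (real (j * m + i) * (h / real m)) \<omega>)"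
  have "moment_le M (2 * k) (\<lambda>\<omega>. \<Sum>x\<in>{..<n} \<times> {..<m}. (h / real m) * ?X x \<omega>) (T ^ (2 * k) * (c * h ^ k))"
  proof (rule moment_le_weighted_sum)
    show "(\<Sum>x\<in>{..<n} \<times> {..<m}. h / real m) \<le> T" using n m by simp
    fix x assume "x \<in> {..<n} \<times> {..<m}"
    then obtain j i where x: "x = (j, i)" and ji: "j < n" "i < m" by auto
    note g = riemann_grid[OF h n ji(1) _ m]
    have "real i * (h / real m) \<le> real m * (h / real m)" using ji h by (intro mult_right_mono) auto
    then have d: "real (j * m + m) * (h / real m) - real (j * m + i) * (h / real m) \<in> {0..h}"
      using g(2)[of i] g(3)[of m] ji h m by (auto simp: algebra_simps)
    have "moment_le M (2 * k) (?X x) (c * (real (j * m + m) * (h / real m) - real (j * m + i) * (h / real m)) ^ k)"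
      unfolding x prod.case by (rule c) (use g(1)[of i] g(1)[of m] ji d in auto)
    then show "moment_le M (2 * k) (?X x) (c * h ^ k)"
      by (rule moment_le_weaken) (use c0 d in \<open>auto intro!: mult_left_mono power_mono\<close>)
  qed (use h k c0 in auto)
  then show "moment_le M (2 * k) (\<lambda>\<omega>. norm (riemann_noise_error \<Sigma> h n (Suc m') \<omega>)) (T ^ (2 * k) * (c * h ^ k))"
  proof (rule moment_le_mono)
    show "(\<lambda>\<omega>. norm (riemann_noise_error \<Sigma> h n (Suc m') \<omega>)) \<in> borel_measurable M"
      using riemann_noise_error_meas[OF h n, of "Suc m'" \<Sigma>] by simp
    have "norm (riemann_noise_error \<Sigma> h n m \<omega>) \<le> (\<Sum>x\<in>{..<n} \<times> {..<m}. (h / real m) * ?X x \<omega>)" for \<omega>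
    proof -
      have "norm (riemann_noise_error \<Sigma> h n m \<omega>) \<le> (\<Sum>j<n. \<Sum>i<m. (h / real m) * ?X (j, i) \<omega>)"
        unfolding riemann_noise_error_def using h
        by (intro sum_norm_le) (simp add: norm_minus_commute)
      then show ?thesis by (simp add: sum.cartesian_product case_prod_unfold)
    qed
    then show "AE \<omega> in M. \<bar>norm (riemann_noise_error \<Sigma> h n (Suc m') \<omega>)\<bar>
        \<le> \<bar>\<Sum>x\<in>{..<n} \<times> {..<m}. (h / real m) * ?X x \<omega>\<bar>"
      unfolding m_def[symmetric] by (intro AE_I2) (auto intro: order_trans[OF _ abs_ge_self])
  qed
qed

text \<open>Order 1 in mean square: summation by parts turns the Riemann sum into a combination of
  independent centred increments with coefficients at most \<open>h\<close>.\<close>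

lemma noise_error_mean_square:
  fixes \<Sigma> :: "real ^ 'd ^ 'm"
  assumes h: "0 < h" and n: "real n * h \<le> T"
  shows "moment_le M 2 (\<lambda>\<omega>. norm (noise_error (\<lambda>t. noise \<Sigma> W t \<omega>) h n))
    ((onorm ((*v) \<Sigma>) * real CARD('d))\<^sup>2 * (T * h\<^sup>2))"
proof (rule noise_error_norm_LIMSEQ[OF h n])
  fix m'
  define m where "m = Suc m'"
  define \<delta> where "\<delta> = h / real m"
  have m: "0 < m" by (simp add: m_def)
  have \<delta>: "0 < \<delta>" "real m * \<delta> = h" using h m by (auto simp: \<delta>_def)
  \<comment> \<open>Summation by parts gives the increment at position \<open>i\<close> of a block,
    counted from 0, the coefficient \<open>- (\<delta> * real (Suc i))\<close>;
    \<open>j mod m\<close> recovers this position from the global index. The largest absolute value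
    is \<open>real m * \<delta> = h\<close>.\<close>
  define c where "c j = - (\<delta> * real (Suc (j mod m)))" for j
  define X where "X \<omega> = (\<Sum>j<n * m. c j *\<^sub>R (W (real (Suc j) * \<delta>) \<omega> - W (real j * \<delta>) \<omega>))" for \<omega>
  have eq: "riemann_noise_error \<Sigma> h n m \<omega> = \<Sigma> *v X \<omega>" for \<omega>
  proof -
    have "riemann_noise_error \<Sigma> h n m \<omega> = (\<Sum>k<n. \<delta> *\<^sub>R (\<Sum>i<m. noise \<Sigma> W (real (k * m + i) * \<delta>) \<omega> - noise \<Sigma> W (real (k * m + m) * \<delta>) \<omega>))"
      by (simp add: riemann_noise_error_def \<delta>_def scaleR_sum_right)
    also have "\<dots> = (\<Sum>k<n. \<delta> *\<^sub>R (- (\<Sum>j<m. real (Suc j) *\<^sub>R (noise \<Sigma> W (real (k * m + Suc j) * \<delta>) \<omega> - noise \<Sigma> W (real (k * m + j) * \<delta>) \<omega>))))"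
      by (subst sum_block_by_parts[of "\<lambda>i. noise \<Sigma> W (real (k * m + i) * \<delta>) \<omega>" for k]) simp
    also have "\<dots> = (\<Sum>k<n. \<Sum>j<m. c (k * m + j) *\<^sub>R (noise \<Sigma> W (real (Suc (k * m + j)) * \<delta>) \<omega> - noise \<Sigma> W (real (k * m + j) * \<delta>) \<omega>))"
      by (simp add: c_def scaleR_sum_right sum_negf)
    also have "\<dots> = (\<Sum>k<n. \<Sum>j=k * m..<k * m + m. c j *\<^sub>R (noise \<Sigma> W (real (Suc j) * \<delta>) \<omega> - noise \<Sigma> W (real j * \<delta>) \<omega>))"
    proof (rule sum.cong[OF refl])
      fix k
      show "(\<Sum>j<m. c (k * m + j) *\<^sub>R (noise \<Sigma> W (real (Suc (k * m + j)) * \<delta>) \<omega> - noise \<Sigma> W (real (k * m + j) * \<delta>) \<omega>))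
        = (\<Sum>j=k * m..<k * m + m. c j *\<^sub>R (noise \<Sigma> W (real (Suc j) * \<delta>) \<omega> - noise \<Sigma> W (real j * \<delta>) \<omega>))"
        using sum.shift_bounds_nat_ivl[of "\<lambda>j. c j *\<^sub>R (noise \<Sigma> W (real (Suc j) * \<delta>) \<omega> - noise \<Sigma> W (real j * \<delta>) \<omega>)" 0 "k * m" m]
        by (simp add: lessThan_atLeast0 add.commute)
    qed
    \<comment> \<open>The blocks are joined into one sum over all \<open>n * m\<close> increments,
      so that orthogonality acts across steps as well as within them.\<close>
    also have "\<dots> = (\<Sum>j<n * m. c j *\<^sub>R (noise \<Sigma> W (real (Suc j) * \<delta>) \<omega> - noise \<Sigma> W (real j * \<delta>) \<omega>))"
      by (rule sum.nat_group)
    also have "\<dots> = \<Sigma> *v X \<omega>"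
      unfolding X_def noise_diff
      by (simp add: linear_sum[OF matrix_vector_mul_linear] matrix_vector_mult_scaleR)
    finally show ?thesis .
  qed
  have "moment_le M 2 (\<lambda>\<omega>. X \<omega> $ i) (T * h\<^sup>2)" for i
  proof -
    have "\<bar>c j\<bar> \<le> h" for j
    proof -
      have "Suc (j mod m) \<le> m" using m by (simp add: Suc_le_eq)
      then have le: "real (Suc (j mod m)) \<le> real m" by (simp only: of_nat_le_iff)
      have "\<bar>c j\<bar> = real (Suc (j mod m)) * \<delta>" using \<delta> by (simp add: c_def abs_mult)
      also have "\<dots> \<le> real m * \<delta>" using \<delta> le by (intro mult_right_mono) auto
      finally show ?thesis using \<delta> by simp
    qed
    moreover have nm: "real (n * m) * \<delta> = real n * h" using \<delta> by (simp add: mult.assoc)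
    ultimately have "moment_le M 2 (\<lambda>\<omega>. \<Sum>j<n * m. c j * ((W (real (Suc j) * \<delta>) \<omega> - W (real j * \<delta>) \<omega>) $ i)) (h\<^sup>2 * (real (n * m) * \<delta>))"
      by (intro weighted_increments_moment \<delta>) (use n in auto)
    then have "moment_le M 2 (\<lambda>\<omega>. X \<omega> $ i) (h\<^sup>2 * (real (n * m) * \<delta>))" by (simp add: X_def)
    then show ?thesis
      by (rule moment_le_weaken) (unfold nm, use mult_right_mono[OF n, of "h\<^sup>2"] in \<open>simp add: mult.commute\<close>)
  qed
  then have "moment_le M 2 (\<lambda>\<omega>. norm (\<Sigma> *v X \<omega>)) ((onorm ((*v) \<Sigma>) * real CARD('d))\<^sup>2 * (T * h\<^sup>2))"
    by (rule moment_le_matrix_mult) (use riemann_noise_error_meas[OF h n m, of \<Sigma>] in \<open>simp_all add: eq[abs_def]\<close>)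
  then show "moment_le M 2 (\<lambda>\<omega>. norm (riemann_noise_error \<Sigma> h n (Suc m') \<omega>)) ((onorm ((*v) \<Sigma>) * real CARD('d))\<^sup>2 * (T * h\<^sup>2))"
    by (simp add: eq m_def[symmetric])
qed

end

section \<open>Strong convergence\<close>

lemma moment_le_power_iff:
  assumes "X \<in> borel_measurable M"
  shows "moment_le M k (\<lambda>\<omega>. X \<omega> ^ j) c \<longleftrightarrow> moment_le M (j * k) X c"
  using assms by (auto simp: moment_le_def power_abs power_mult)

section \<open>Moments of the solution and of the scheme\<close>

text \<open>\<open>r\<close> is the growth exponent of the derivative of the test function. The test
  function itself may grow like the power \<open>r + 1\<close>, and its square has to be integrable;
  hence the moment order \<open>2 * (r + 1)\<close>.\<close>

locale hamiltonian_sde = brownian_setting M T F W + lipschitz_force V' B T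
  for M :: "'a measure" and T F and W :: "real \<Rightarrow> 'a \<Rightarrow> real ^ 'd" and V' :: "real ^ 'm \<Rightarrow> real ^ 'm" and B +
  fixes \<Sigma> :: "real ^ 'd ^ 'm" and p\<^sub>0 q\<^sub>0 :: "'a \<Rightarrow> real ^ 'm" and p q :: "real \<Rightarrow> 'a \<Rightarrow> real ^ 'm" and r :: nat
  assumes init_meas: "p\<^sub>0 \<in> borel_measurable (F 0)" "q\<^sub>0 \<in> borel_measurable (F 0)"
    and init_moment: "integrable M (\<lambda>\<omega>. norm (p\<^sub>0 \<omega>, q\<^sub>0 \<omega>) ^ (2 * (r + 1)))"
    and solution: "hamiltonian_sde_solution M T F W V' \<Sigma> p\<^sub>0 q\<^sub>0 p q"
begin

text \<open>A run of \<open>N\<close> steps reaching \<open>T\<close>. The restriction on the step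
  size is included because the pathwise bounds on the scheme rest on it.\<close>

abbreviation scheme where
  "scheme N P Q \<equiv> 0 < N \<and> T / real N * B \<le> 1 / 2 \<and>
     drift_preserving_scheme M F W V' \<Sigma> p\<^sub>0 q\<^sub>0 (T / real N) N P Q"

text \<open>Collects the data that appear in the pathwise bounds, apart from the noise at the
  current time and \<open>noise_error\<close>. \<open>N\<close> enters only through an average over
  the grid, so the moments can be bounded uniformly in \<open>N\<close>.\<close>

definition U :: "nat \<Rightarrow> 'a \<Rightarrow> real" where
  "U N \<omega> = 1 + norm (p\<^sub>0 \<omega>) + norm (q\<^sub>0 \<omega>) + integral {0..T} (\<lambda>s. norm (noise \<Sigma> W s \<omega>))
     + T / real N * (\<Sum>k\<le>N. norm (noise \<Sigma> W (real k * (T / real N)) \<omega>))"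

lemma T0: "0 < T" using T .

lemma grid_mem: "0 < N \<Longrightarrow> n \<le> N \<Longrightarrow> real n * (T / real N) \<in> {0..T}"
  using T0 mult_right_mono[of "real n" "real N" "T / real N"] by simp

lemma noise_0: "noise \<Sigma> W 0 \<omega> = 0"
  by (simp add: noise_def)

lemma init_meas_M [measurable]: "p\<^sub>0 \<in> borel_measurable M" "q\<^sub>0 \<in> borel_measurable M"
  using F_meas[OF init_meas(1)] F_meas[OF init_meas(2)] T0 by auto

lemma solution_meas: "t \<in> {0..T} \<Longrightarrow> p t \<in> borel_measurable M" "t \<in> {0..T} \<Longrightarrow> q t \<in> borel_measurable M"
  using solution F_meas unfolding hamiltonian_sde_solution_def by blast+

lemma scheme_meas:
  assumes "scheme N P Q" "n \<le> N"
  shows "P n \<in> borel_measurable M" "Q n \<in> borel_measurable M"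
  using assms F_meas[OF _ grid_mem[of N n]] unfolding drift_preserving_scheme_def by auto

lemma solution_path:
  "AE \<omega> in M. continuous_on {0..T} (\<lambda>t. p t \<omega>) \<and> continuous_on {0..T} (\<lambda>t. q t \<omega>) \<and>
     continuous_on {0..T} (\<lambda>t. noise \<Sigma> W t \<omega>) \<and>
     (\<forall>t\<in>{0..T}. q t \<omega> = q\<^sub>0 \<omega> + integral {0..t} (\<lambda>s. p s \<omega>) \<and>
        p t \<omega> = p\<^sub>0 \<omega> - integral {0..t} (\<lambda>s. V' (q s \<omega>)) + noise \<Sigma> W t \<omega>)"
proof -
  have "AE \<omega> in M. continuous_on {0..T} (\<lambda>t. p t \<omega>) \<and> continuous_on {0..T} (\<lambda>t. q t \<omega>) \<and>
        (\<forall>t\<in>{0..T}.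
           q t \<omega> = q\<^sub>0 \<omega> + integral {0..t} (\<lambda>s. p s \<omega>) \<and>
           p t \<omega> = p\<^sub>0 \<omega> - integral {0..t} (\<lambda>s. V' (q s \<omega>)) + \<Sigma> *v (W t \<omega> - W 0 \<omega>))"
    using solution unfolding hamiltonian_sde_solution_def by blast
  then show ?thesis using AE_space by eventually_elim (simp add: noise_continuous, simp add: noise_def)
qed

lemma scheme_path:
  assumes "scheme N P Q"
  shows "AE \<omega> in M. P 0 \<omega> = p\<^sub>0 \<omega> \<and> Q 0 \<omega> = q\<^sub>0 \<omega> \<and>
        (\<forall>n<N. drift_preserving_step V' (T / real N)
           (noise \<Sigma> W (real (Suc n) * (T / real N)) \<omega> - noise \<Sigma> W (real n * (T / real N)) \<omega>)
           (P n \<omega>) (Q n \<omega>) (P (Suc n) \<omega>) (Q (Suc n) \<omega>))"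
  using assms unfolding drift_preserving_scheme_def noise_diff by blast

lemma noise_moment_bound:
  obtains c where "0 \<le> c" "\<And>t. t \<in> {0..T} \<Longrightarrow> moment_le M (2 * (r + 1)) (\<lambda>\<omega>. norm (noise \<Sigma> W t \<omega>)) c"
proof -
  have k: "0 < r + 1" by simp
  obtain c where c: "0 \<le> c" "\<And>s t. 0 \<le> s \<Longrightarrow> s \<le> t \<Longrightarrow> t \<le> T \<Longrightarrow>
      moment_le M (2 * (r + 1)) (\<lambda>\<omega>. norm (noise \<Sigma> W t \<omega> - noise \<Sigma> W s \<omega>)) (c * (t - s) ^ (r + 1))"
    by (rule noise_moments[OF k, of \<Sigma>]) (rule that; simp)
  show ?thesis
  proof (rule that[of "c * T ^ (r + 1)"])
    fix t assume t: "t \<in> {0..T}"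
    have "moment_le M (2 * (r + 1)) (\<lambda>\<omega>. norm (noise \<Sigma> W t \<omega>)) (c * t ^ (r + 1))"
      using c(2)[of 0 t] t unfolding noise_0 by simp
    then show "moment_le M (2 * (r + 1)) (\<lambda>\<omega>. norm (noise \<Sigma> W t \<omega>)) (c * T ^ (r + 1))"
      by (rule moment_le_weaken) (use c t in \<open>intro mult_left_mono power_mono; auto\<close>)
  qed (use c T0 in simp)
qed

lemma init_moment_bound: "\<exists>c. moment_le M (2 * (r + 1)) (\<lambda>\<omega>. norm (p\<^sub>0 \<omega>) + norm (q\<^sub>0 \<omega>)) c"
proof -
  have "moment_le M (2 * (r + 1)) (\<lambda>\<omega>. norm (p\<^sub>0 \<omega>, q\<^sub>0 \<omega>)) (\<integral>\<omega>. \<bar>norm (p\<^sub>0 \<omega>, q\<^sub>0 \<omega>)\<bar> ^ (2 * (r + 1)) \<partial>M)"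
    by (rule moment_leI) (use init_moment in auto)
  from moment_le_cmult[OF this, of 2] have "moment_le M (2 * (r + 1)) (\<lambda>\<omega>. norm (p\<^sub>0 \<omega>) + norm (q\<^sub>0 \<omega>))
      (\<bar>2\<bar> ^ (2 * (r + 1)) * (\<integral>\<omega>. \<bar>norm (p\<^sub>0 \<omega>, q\<^sub>0 \<omega>)\<bar> ^ (2 * (r + 1)) \<partial>M))"
  proof (rule moment_le_mono)
    have "norm (p\<^sub>0 \<omega>) + norm (q\<^sub>0 \<omega>) \<le> 2 * norm (p\<^sub>0 \<omega>, q\<^sub>0 \<omega>)" for \<omega>
      using norm_fst_le[of "p\<^sub>0 \<omega>" "q\<^sub>0 \<omega>"] norm_snd_le[of "q\<^sub>0 \<omega>" "p\<^sub>0 \<omega>"] by linarith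
    then show "AE \<omega> in M. \<bar>norm (p\<^sub>0 \<omega>) + norm (q\<^sub>0 \<omega>)\<bar> \<le> \<bar>2 * norm (p\<^sub>0 \<omega>, q\<^sub>0 \<omega>)\<bar>" by simp
  qed simp
  then show ?thesis by blast
qed

lemma U_moment:
  obtains c where "0 \<le> c" "\<And>N. 0 < N \<Longrightarrow> moment_le M (2 * (r + 1)) (U N) c"
proof -
  let ?K = "2 * (r + 1)"
  obtain c where c: "0 \<le> c" "\<And>t. t \<in> {0..T} \<Longrightarrow> moment_le M ?K (\<lambda>\<omega>. norm (noise \<Sigma> W t \<omega>)) c"
    using noise_moment_bound by blast
  obtain c0 where c0: "moment_le M ?K (\<lambda>\<omega>. norm (p\<^sub>0 \<omega>) + norm (q\<^sub>0 \<omega>)) c0" using init_moment_bound by blast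
  have J: "moment_le M ?K (\<lambda>\<omega>. integral {0..T} (\<lambda>s. norm (noise \<Sigma> W s \<omega>))) (T ^ ?K * c)"
    by (rule noise_integral_moment) (use c in auto)
  \<comment> \<open>Three additions, each with a factor \<open>2 ^ ?K\<close>. \<open>2 * T\<close>
    bounds the total weight of the grid average, which counts both end points and so has
    \<open>N + 1\<close> terms.\<close>
  define d where "d = 2 ^ ?K * (2 ^ ?K * (2 ^ ?K * (\<bar>1\<bar> ^ ?K + c0) + T ^ ?K * c) + (2 * T) ^ ?K * c)"
  have m: "moment_le M ?K (U N) d" if N: "0 < N" for N
  proof -
    have "moment_le M ?K (\<lambda>\<omega>. \<Sum>k\<le>N. T / real N * norm (noise \<Sigma> W (real k * (T / real N)) \<omega>)) ((2 * T) ^ ?K * c)"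
    proof (rule moment_le_weighted_sum)
      have "(\<Sum>k\<le>N. T / real N) = (real N + 1) * (T / real N)" by simp
      also have "\<dots> \<le> (2 * real N) * (T / real N)" using N T0 by (intro mult_right_mono) auto
      finally show "(\<Sum>k\<le>N. T / real N) \<le> 2 * T" using N by simp
    qed (use c T0 grid_mem[OF N] in auto)
    from moment_le_add[OF moment_le_add[OF moment_le_add[OF moment_le_const[of ?K 1] c0] J] this]
    show ?thesis unfolding d_def
      by (rule subst[where P = "\<lambda>X. moment_le M ?K X d" for d, rotated])
         (simp add: U_def fun_eq_iff sum_distrib_left add.assoc)
  qed
  show ?thesis by (rule that[of d]) (use moment_leD(1)[OF m[of 1]] m in auto)
qed

lemma solution_moment:
  obtains c where "0 \<le> c" "\<And>t. t \<in> {0..T} \<Longrightarrow> moment_le M (2 * (r + 1)) (\<lambda>\<omega>. norm (p t \<omega>) + norm (q t \<omega>)) c"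
proof -
  let ?K = "2 * (r + 1)"
  obtain C where C: "0 \<le> C" and sol: "\<forall>w p q p\<^sub>0 q\<^sub>0. continuous_on {0..T} w \<and> continuous_on {0..T} p \<and> continuous_on {0..T} q \<and>
     (\<forall>t\<in>{0..T}. q t = q\<^sub>0 + integral {0..t} p \<and> p t = p\<^sub>0 - integral {0..t} (\<lambda>s. V' (q s)) + w t) \<longrightarrow>
     (\<forall>t\<in>{0..T}. norm (p t) + norm (q t)
        \<le> C * (1 + norm p\<^sub>0 + norm q\<^sub>0 + norm (w t) + integral {0..T} (\<lambda>s. norm (w s))))"
    using solution_bound by blast
  obtain c where c: "0 \<le> c" "\<And>t. t \<in> {0..T} \<Longrightarrow> moment_le M ?K (\<lambda>\<omega>. norm (noise \<Sigma> W t \<omega>)) c"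
    using noise_moment_bound by blast
  obtain u where u: "0 \<le> u" "\<And>N. 0 < N \<Longrightarrow> moment_le M ?K (U N) u" using U_moment by blast
  show ?thesis
  proof (rule that)
    fix t assume t: "t \<in> {0..T}"
    note [measurable] = solution_meas[OF t]
    \<comment> \<open>\<open>U 1\<close> contains the initial values and the integral of the noise;
      its remaining summand is nonnegative and only weakens the bound.\<close>
    from moment_le_cmult[OF moment_le_add[OF c(2)[OF t] u(2)[of 1]], of C]
    show "moment_le M ?K (\<lambda>\<omega>. norm (p t \<omega>) + norm (q t \<omega>)) (\<bar>C\<bar> ^ ?K * (2 ^ ?K * (c + u)))"
    proof (rule moment_le_mono)
      show "AE \<omega> in M. \<bar>norm (p t \<omega>) + norm (q t \<omega>)\<bar> \<le> \<bar>C * (norm (noise \<Sigma> W t \<omega>) + U 1 \<omega>)\<bar>"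
        using solution_path
      proof eventually_elim
        case (elim \<omega>)
        have "norm (p t \<omega>) + norm (q t \<omega>) \<le> C * (1 + norm (p\<^sub>0 \<omega>) + norm (q\<^sub>0 \<omega>) + norm (noise \<Sigma> W t \<omega>)
            + integral {0..T} (\<lambda>s. norm (noise \<Sigma> W s \<omega>)))"
          using sol[rule_format, of "\<lambda>t. noise \<Sigma> W t \<omega>" "\<lambda>t. p t \<omega>" "\<lambda>t. q t \<omega>" "q\<^sub>0 \<omega>" "p\<^sub>0 \<omega>" t] elim t by blast
        also have "\<dots> \<le> C * (norm (noise \<Sigma> W t \<omega>) + U 1 \<omega>)"
          using C T0 by (intro mult_left_mono) (auto simp: U_def intro!: mult_nonneg_nonneg sum_nonneg)
        finally show ?case by simp
      qed
    qed simp_all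
  qed (use c u in simp)
qed

lemma scheme_moment:
  obtains c where "0 \<le> c"
    "\<And>N P Q n. scheme N P Q \<Longrightarrow> n \<le> N \<Longrightarrow> moment_le M (2 * (r + 1)) (\<lambda>\<omega>. norm (P n \<omega>) + norm (Q n \<omega>)) c"
proof -
  let ?K = "2 * (r + 1)"
  obtain C where C: "0 \<le> C" and num: "\<forall>N h w P Q. 0 < N \<and> h = T / real N \<and> h * B \<le> 1 / 2 \<and> w 0 = 0 \<and>
     (\<forall>n<N. drift_preserving_step V' h (w (Suc n) - w n) (P n) (Q n) (P (Suc n)) (Q (Suc n))) \<longrightarrow>
     (\<forall>n\<le>N. norm (P n) + norm (Q n)
        \<le> C * (1 + norm (P 0) + norm (Q 0) + norm (w n) + h * (\<Sum>k\<le>N. norm (w k))))"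
    using scheme_bound by blast
  obtain c where c: "0 \<le> c" "\<And>t. t \<in> {0..T} \<Longrightarrow> moment_le M ?K (\<lambda>\<omega>. norm (noise \<Sigma> W t \<omega>)) c"
    using noise_moment_bound by blast
  obtain u where u: "0 \<le> u" "\<And>N. 0 < N \<Longrightarrow> moment_le M ?K (U N) u" using U_moment by blast
  show ?thesis
  proof (rule that)
    fix N n P Q assume sch: "scheme N P Q" and n: "n \<le> N"
    then have N: "0 < N" by simp
    note t = grid_mem[OF N n]
    note [measurable] = scheme_meas[OF sch n]
    from moment_le_cmult[OF moment_le_add[OF c(2)[OF t] u(2)[OF N]], of C]
    show "moment_le M ?K (\<lambda>\<omega>. norm (P n \<omega>) + norm (Q n \<omega>)) (\<bar>C\<bar> ^ ?K * (2 ^ ?K * (c + u)))"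
    proof (rule moment_le_mono)
      show "AE \<omega> in M. \<bar>norm (P n \<omega>) + norm (Q n \<omega>)\<bar> \<le> \<bar>C * (norm (noise \<Sigma> W (real n * (T / real N)) \<omega>) + U N \<omega>)\<bar>"
        using scheme_path[OF sch] AE_space
      proof eventually_elim
        case (elim \<omega>)
        have "norm (P n \<omega>) + norm (Q n \<omega>) \<le> C * (1 + norm (P 0 \<omega>) + norm (Q 0 \<omega>) + norm (noise \<Sigma> W (real n * (T / real N)) \<omega>)
            + T / real N * (\<Sum>k\<le>N. norm (noise \<Sigma> W (real k * (T / real N)) \<omega>)))"
          using num[rule_format, of N "T / real N" "\<lambda>k. noise \<Sigma> W (real k * (T / real N)) \<omega>" "\<lambda>k. P k \<omega>" "\<lambda>k. Q k \<omega>" n]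
            conjunct1[OF elim(1)] conjunct1[OF conjunct2[OF elim(1)]] conjunct2[OF conjunct2[OF elim(1)]] sch n
          by (simp only: of_nat_0 mult_zero_left noise_0 simp_thms)
        also have "\<dots> \<le> C * (norm (noise \<Sigma> W (real n * (T / real N)) \<omega>) + U N \<omega>)"
        proof -
          have "0 \<le> integral {0..T} (\<lambda>s. norm (noise \<Sigma> W s \<omega>))"
            using elim by (intro integral_nonneg integrable_continuous_interval continuous_intros noise_continuous) auto
          then show ?thesis using C elim by (intro mult_left_mono) (auto simp: U_def)
        qed
        finally show ?case by simp
      qed
    qed simp_all
  qed (use c u in simp)
qed

section \<open>Moments of the error\<close>

text \<open>Common to both rates: \<open>\<eta>\<close> is the rate of the moment of order
  \<open>K\<close> of \<open>noise_error\<close>. The condition \<open>h ^ K \<le> \<eta> h\<close>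
  lets it dominate the remaining \<open>O(h)\<close> part of the error, and the sum over earlier
  times is a weighted sum of total weight at most \<open>T\<close>.\<close>

lemma error_moment:
  assumes K: "0 < K" "K \<le> 2 * (r + 1)" and d: "0 \<le> d"
    and \<eta>: "\<And>N. 0 < N \<Longrightarrow> T / real N * B \<le> 1 / 2 \<Longrightarrow> (T / real N) ^ K \<le> \<eta> (T / real N)"
    and \<rho>: "\<And>N n. 0 < N \<Longrightarrow> n \<le> N \<Longrightarrow>
      moment_le M K (\<lambda>\<omega>. norm (noise_error (\<lambda>t. noise \<Sigma> W t \<omega>) (T / real N) n)) (d * \<eta> (T / real N))"
  obtains c where "0 \<le> c"
    "\<And>N P Q n. scheme N P Q \<Longrightarrow> n \<le> N \<Longrightarrow> moment_le M K
      (\<lambda>\<omega>. norm (p (real n * (T / real N)) \<omega> - P n \<omega>) + norm (q (real n * (T / real N)) \<omega> - Q n \<omega>)) (c * \<eta> (T / real N))"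
proof -
  obtain C where C: "0 \<le> C" and glob: "\<forall>N h w p q P Q. 0 < N \<and> h = T / real N \<and> h * B \<le> 1 / 2 \<and> w 0 = 0 \<and>
     continuous_on {0..T} w \<and> continuous_on {0..T} p \<and> continuous_on {0..T} q \<and>
     (\<forall>t\<in>{0..T}. q t = Q 0 + integral {0..t} p \<and> p t = P 0 - integral {0..t} (\<lambda>s. V' (q s)) + w t) \<and>
     (\<forall>n<N. drift_preserving_step V' h (w (real (Suc n) * h) - w (real n * h)) (P n) (Q n) (P (Suc n)) (Q (Suc n))) \<longrightarrow>
     (\<forall>n\<le>N. norm (p (real n * h) - P n) + norm (q (real n * h) - Q n)
        \<le> C * (norm (noise_error w h n) + h * (\<Sum>k<n. norm (noise_error w h k))
             + h * (1 + norm (P 0) + norm (Q 0) + integral {0..T} (\<lambda>s. norm (w s))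
                    + h * (\<Sum>k\<le>N. norm (w (real k * h))))))"
    using global_error by blast
  obtain u where u: "0 \<le> u" "\<And>N. 0 < N \<Longrightarrow> moment_le M (2 * (r + 1)) (U N) u" using U_moment by blast
  define c where "c = C ^ K * (2 ^ K * (2 ^ K * (d + T ^ K * d) + (1 + u)))"
  show ?thesis
  proof (rule that)
    show "0 \<le> c" using C d u T0 by (simp add: c_def)
    fix N n P Q assume sch: "scheme N P Q" and n: "n \<le> N"
    define h where "h = T / real N"
    have N: "0 < N" and hB: "h * B \<le> 1 / 2" using sch by (auto simp: h_def)
    have h: "0 < h" using T0 N by (simp add: h_def)
    have \<eta>h: "h ^ K \<le> \<eta> h" using \<eta> N hB by (simp add: h_def)
    have \<eta>0: "0 \<le> \<eta> h" using \<eta>h h by (meson order_trans less_imp_le zero_le_power)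
    let ?\<rho> = "\<lambda>n \<omega>. norm (noise_error (\<lambda>t. noise \<Sigma> W t \<omega>) h n)"
    have t: "real n * h \<in> {0..T}" using grid_mem[OF N n] by (simp add: h_def)
    note [measurable] = scheme_meas[OF sch n] solution_meas[OF t]
    have \<rho>h: "moment_le M K (?\<rho> k) (d * \<eta> h)" if "k \<le> N" for k using \<rho>[OF N that] by (simp add: h_def)
    have sum: "moment_le M K (\<lambda>\<omega>. \<Sum>k<n. h * ?\<rho> k \<omega>) (T ^ K * (d * \<eta> h))"
      by (rule moment_le_weighted_sum) (use h t n \<rho>h d \<eta>0 K in auto)
    have hU: "moment_le M K (\<lambda>\<omega>. h * U N \<omega>) ((1 + u) * \<eta> h)"
      by (rule moment_le_weaken[OF moment_le_cmult[OF moment_le_lower[OF u(2)[OF N] K(2)], of h]])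
         (use h \<eta>h u in \<open>simp add: mult.commute mult_left_mono\<close>)
    have ev: "\<bar>C\<bar> ^ K * (2 ^ K * (2 ^ K * (d * \<eta> h + T ^ K * (d * \<eta> h)) + (1 + u) * \<eta> h)) = c * \<eta> h"
      using C by (simp add: c_def algebra_simps)
    have "moment_le M K (\<lambda>\<omega>. C * ((?\<rho> n \<omega> + (\<Sum>k<n. h * ?\<rho> k \<omega>)) + h * U N \<omega>)) (c * \<eta> h)"
      using moment_le_cmult[OF moment_le_add[OF moment_le_add[OF \<rho>h[OF n] sum] hU], of C] unfolding ev .
    then have "moment_le M K (\<lambda>\<omega>. norm (p (real n * h) \<omega> - P n \<omega>) + norm (q (real n * h) \<omega> - Q n \<omega>)) (c * \<eta> h)"
    proof (rule moment_le_mono)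
      show "AE \<omega> in M. \<bar>norm (p (real n * h) \<omega> - P n \<omega>) + norm (q (real n * h) \<omega> - Q n \<omega>)\<bar>
          \<le> \<bar>C * ((?\<rho> n \<omega> + (\<Sum>k<n. h * ?\<rho> k \<omega>)) + h * U N \<omega>)\<bar>"
        using scheme_path[OF sch] solution_path
      proof eventually_elim
        case (elim \<omega>)
        have "norm (p (real n * h) \<omega> - P n \<omega>) + norm (q (real n * h) \<omega> - Q n \<omega>)
          \<le> C * (?\<rho> n \<omega> + h * (\<Sum>k<n. ?\<rho> k \<omega>)
             + h * (1 + norm (P 0 \<omega>) + norm (Q 0 \<omega>) + integral {0..T} (\<lambda>s. norm (noise \<Sigma> W s \<omega>))
                    + h * (\<Sum>k\<le>N. norm (noise \<Sigma> W (real k * h) \<omega>))))"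
          using glob[rule_format, of N h "\<lambda>t. noise \<Sigma> W t \<omega>" "\<lambda>t. p t \<omega>" "\<lambda>t. q t \<omega>" "\<lambda>n. Q n \<omega>" "\<lambda>n. P n \<omega>" n]
            elim n N hB noise_0[of \<omega>] unfolding h_def by auto
        also have "\<dots> = C * ((?\<rho> n \<omega> + (\<Sum>k<n. h * ?\<rho> k \<omega>)) + h * U N \<omega>)"
          using elim by (simp add: U_def h_def sum_distrib_left)
        finally show ?case by simp
      qed
    qed simp
    then show "moment_le M K
      (\<lambda>\<omega>. norm (p (real n * (T / real N)) \<omega> - P n \<omega>) + norm (q (real n * (T / real N)) \<omega> - Q n \<omega>)) (c * \<eta> (T / real N))"
      by (simp add: h_def)
  qed
qed

lemma error_mean_square:
  obtains c where "0 \<le> c"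
    "\<And>N P Q n. scheme N P Q \<Longrightarrow> n \<le> N \<Longrightarrow> moment_le M 2
      (\<lambda>\<omega>. norm (p (real n * (T / real N)) \<omega> - P n \<omega>) + norm (q (real n * (T / real N)) \<omega> - Q n \<omega>)) (c * (T / real N)\<^sup>2)"
proof (rule error_moment[of 2 "(onorm ((*v) \<Sigma>) * real CARD('d))\<^sup>2 * T" "\<lambda>h. h\<^sup>2"])
  show "0 \<le> (onorm ((*v) \<Sigma>) * real CARD('d))\<^sup>2 * T" using T0 by simp
  fix N n :: nat assume N: "0 < N" "n \<le> N"
  show "moment_le M 2 (\<lambda>\<omega>. norm (noise_error (\<lambda>t. noise \<Sigma> W t \<omega>) (T / real N) n))
      ((onorm ((*v) \<Sigma>) * real CARD('d))\<^sup>2 * T * (T / real N)\<^sup>2)"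
    using noise_error_mean_square[of "T / real N" n \<Sigma>] N grid_mem[OF N] T0 by (simp add: mult.assoc)
qed (use that in auto)

lemma error_half_order:
  obtains c where "0 \<le> c"
    "\<And>N P Q n. scheme N P Q \<Longrightarrow> n \<le> N \<Longrightarrow> moment_le M (2 * (r + 1))
      (\<lambda>\<omega>. norm (p (real n * (T / real N)) \<omega> - P n \<omega>) + norm (q (real n * (T / real N)) \<omega> - Q n \<omega>)) (c * (T / real N) ^ (r + 1))"
proof -
  have k: "0 < r + 1" by simp
  obtain c where c: "0 \<le> c" "\<And>s t. 0 \<le> s \<Longrightarrow> s \<le> t \<Longrightarrow> t \<le> T \<Longrightarrow>
      moment_le M (2 * (r + 1)) (\<lambda>\<omega>. norm (noise \<Sigma> W t \<omega> - noise \<Sigma> W s \<omega>)) (c * (t - s) ^ (r + 1))"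
    by (rule noise_moments[OF k, of \<Sigma>]) (rule that; simp)
  show ?thesis
  proof (rule error_moment[of "2 * (r + 1)" "T ^ (2 * (r + 1)) * c" "\<lambda>h. h ^ (r + 1)"])
    fix N n :: nat assume N: "0 < N" "n \<le> N"
    show "moment_le M (2 * (r + 1)) (\<lambda>\<omega>. norm (noise_error (\<lambda>t. noise \<Sigma> W t \<omega>) (T / real N) n))
        (T ^ (2 * (r + 1)) * c * (T / real N) ^ (r + 1))"
      using noise_error_moment[of "T / real N" n "r + 1" c \<Sigma>] c N grid_mem[OF N] T0 by (simp add: mult.assoc)
  next
    fix N :: nat assume N: "0 < N" and hB: "T / real N * B \<le> 1 / 2"
    \<comment> \<open>\<open>1 \<le> B\<close> turns the threshold into
      \<open>T / real N \<le> 1\<close>, so that the \<open>O(h)\<close> part of the error is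
      dominated by the half order.\<close>
    have "T / real N * 1 \<le> T / real N * B" using B T0 by (intro mult_left_mono) auto
    then have "T / real N \<le> 1" using hB by linarith
    then show "(T / real N) ^ (2 * (r + 1)) \<le> (T / real N) ^ (r + 1)"
      using T0 by (intro power_decreasing) auto
  qed (use that c T0 in auto)
qed

end

section \<open>Multilevel Monte Carlo\<close>

text \<open>Variances of independent centred variables add: a further summand is independent of the
  sum of the others, so the expectation of the product factorises and is 0.\<close>

lemma (in prob_space) moment_le_indep_sum:
  assumes "finite I" and "indep_vars (\<lambda>_. borel) Z I"
    and "\<And>i. i \<in> I \<Longrightarrow> moment_le M 2 (Z i) c" and "\<And>i. i \<in> I \<Longrightarrow> expectation (Z i) = 0"
  shows "moment_le M 2 (\<lambda>\<omega>. \<Sum>i\<in>I. Z i \<omega>) (real (card I) * c)"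
  using assms
proof (induction I rule: finite_induct)
  case (insert i I)
  define S where "S \<omega> = (\<Sum>i\<in>I. Z i \<omega>)" for \<omega>
  have "indep_vars (\<lambda>_. borel) Z I" by (rule indep_vars_subset[OF insert.prems(1)]) auto
  then have S: "moment_le M 2 S (real (card I) * c)" unfolding S_def[abs_def] using insert by simp
  have Z: "moment_le M 2 (Z i) c" "expectation (Z i) = 0" using insert by auto
  have [measurable]: "S \<in> borel_measurable M" "Z i \<in> borel_measurable M" using moment_leD(2) S Z by blast+
  have int: "integrable M S" "integrable M (Z i)"
    using moment_leD(4)[OF moment_le_lower[OF S, of 1]] moment_leD(4)[OF moment_le_lower[OF Z(1), of 1]]
    by (simp_all add: integrable_abs_iff)
  have ind: "indep_var borel (Z i) borel S"
    unfolding S_def[abs_def] by (rule indep_vars_sum[OF insert.hyps insert.prems(1)])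
  have prod: "integrable M (\<lambda>\<omega>. Z i \<omega> * S \<omega>)" "expectation (\<lambda>\<omega>. Z i \<omega> * S \<omega>) = 0"
    using indep_var_integrable[OF ind int(2,1)] indep_var_lebesgue_integral[OF ind int(2,1)] Z(2) by simp_all
  have S2: "integrable M (\<lambda>\<omega>. (S \<omega>)\<^sup>2)" "(\<integral>\<omega>. (S \<omega>)\<^sup>2 \<partial>M) \<le> real (card I) * c"
    and Z2: "integrable M (\<lambda>\<omega>. (Z i \<omega>)\<^sup>2)" "(\<integral>\<omega>. (Z i \<omega>)\<^sup>2 \<partial>M) \<le> c"
    using moment_leD(4,5)[OF S] moment_leD(4,5)[OF Z(1)] by (simp_all add: power2_abs)
  have "moment_le M 2 (\<lambda>\<omega>. Z i \<omega> + S \<omega>) (real (card (insert i I)) * c)"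
  proof (rule moment_leI)
    have eq: "\<bar>Z i \<omega> + S \<omega>\<bar>\<^sup>2 = (Z i \<omega>)\<^sup>2 + 2 * (Z i \<omega> * S \<omega>) + (S \<omega>)\<^sup>2" for \<omega>
      by (simp add: power2_sum)
    show "integrable M (\<lambda>\<omega>. \<bar>Z i \<omega> + S \<omega>\<bar>\<^sup>2)" unfolding eq using S2 Z2 prod by simp
    have "(\<integral>\<omega>. \<bar>Z i \<omega> + S \<omega>\<bar>\<^sup>2 \<partial>M) = (\<integral>\<omega>. (Z i \<omega>)\<^sup>2 \<partial>M) + 2 * (\<integral>\<omega>. Z i \<omega> * S \<omega> \<partial>M) + (\<integral>\<omega>. (S \<omega>)\<^sup>2 \<partial>M)"
      unfolding eq using S2 Z2 prod(1) by simp
    then show "(\<integral>\<omega>. \<bar>Z i \<omega> + S \<omega>\<bar>\<^sup>2 \<partial>M) \<le> real (card (insert i I)) * c"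
      using S2 Z2 prod(2) insert.hyps by (simp add: algebra_simps)
  qed simp
  then show ?case using insert.hyps by (simp add: S_def)
qed (simp add: moment_le_def)

text \<open>Averaging independent samples divides the variance by \<open>real n\<close>. The
  deviation of a sample from its mean has a second moment no larger than that of \<open>Y\<close>,
  so \<open>c\<close> may be kept.\<close>

lemma (in prob_space) mc_estimator_moment:
  assumes Y: "moment_le M 2 Y c" and S: "iid_samples M Y n S" and n: "0 < n"
  shows "moment_le M 2 (\<lambda>\<omega>. expectation Y - mc_estimator n S \<omega>) (c / real n)"
proof -
  define \<mu> where "\<mu> = expectation Y"
  have [measurable]: "Y \<in> borel_measurable M" using moment_leD(2)[OF Y] .
  have ind: "indep_vars (\<lambda>_. borel) S {1..n}"
    and dist: "\<And>i. i \<in> {1..n} \<Longrightarrow> distr M borel (S i) = distr M borel Y"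
    using S by (auto simp: iid_samples_def)
  have Sm: "i \<in> {1..n} \<Longrightarrow> S i \<in> borel_measurable M" for i using ind by (simp add: indep_vars_def)
  \<comment> \<open>The samples agree with \<open>Y\<close> in law only; integrals are carried over
    through the image measure.\<close>
  have transfer: "integrable M (\<lambda>\<omega>. g (S i \<omega>))" "expectation (\<lambda>\<omega>. g (S i \<omega>)) = expectation (\<lambda>\<omega>. g (Y \<omega>))"
    if i: "i \<in> {1..n}" and g: "g \<in> borel_measurable borel" and int: "integrable M (\<lambda>\<omega>. g (Y \<omega>))" for i and g :: "real \<Rightarrow> real"
    using int integrable_distr_eq[OF Sm[OF i] g] integrable_distr_eq[of Y M borel g] dist[OF i] g
      integral_distr[OF Sm[OF i] g] integral_distr[of Y M borel g] by auto
  have Yi: "integrable M Y" using moment_leD(4)[OF moment_le_lower[OF Y, of 1]] by (simp add: integrable_abs_iff)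
  have Y2: "integrable M (\<lambda>\<omega>. (Y \<omega>)\<^sup>2)" "expectation (\<lambda>\<omega>. (Y \<omega>)\<^sup>2) \<le> c"
    using moment_leD(4,5)[OF Y] by (simp_all add: power2_abs)
  have "moment_le M 2 (\<lambda>\<omega>. \<Sum>i\<in>{1..n}. \<mu> - S i \<omega>) (real (card {1..n}) * c)"
  proof (rule moment_le_indep_sum)
    show "indep_vars (\<lambda>_. borel) (\<lambda>i \<omega>. \<mu> - S i \<omega>) {1..n}"
      by (rule indep_vars_compose2[OF ind]) simp
    fix i assume i: "i \<in> {1..n}"
    note [measurable] = Sm[OF i]
    have int: "integrable M (S i)" "expectation (S i) = \<mu>"
      using transfer[OF i, of "\<lambda>x. x"] Yi by (auto simp: \<mu>_def)
    have int2: "integrable M (\<lambda>\<omega>. (S i \<omega>)\<^sup>2)" "expectation (\<lambda>\<omega>. (S i \<omega>)\<^sup>2) \<le> c"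
      using transfer[OF i, of "\<lambda>x. x\<^sup>2"] Y2 by auto
    show "expectation (\<lambda>\<omega>. \<mu> - S i \<omega>) = 0" using int by (simp add: prob_space)
    show "moment_le M 2 (\<lambda>\<omega>. \<mu> - S i \<omega>) c"
    proof (rule moment_leI)
      have eq: "\<bar>\<mu> - S i \<omega>\<bar>\<^sup>2 = \<mu>\<^sup>2 - 2 * \<mu> * S i \<omega> + (S i \<omega>)\<^sup>2" for \<omega> by (simp add: power2_diff)
      show "integrable M (\<lambda>\<omega>. \<bar>\<mu> - S i \<omega>\<bar>\<^sup>2)" unfolding eq using int int2 by simp
      have "expectation (\<lambda>\<omega>. \<bar>\<mu> - S i \<omega>\<bar>\<^sup>2) = \<mu>\<^sup>2 - 2 * \<mu> * \<mu> + expectation (\<lambda>\<omega>. (S i \<omega>)\<^sup>2)"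
        unfolding eq using int int2 by (simp add: prob_space)
      also have "\<dots> \<le> c" using int2(2) zero_le_square[of \<mu>] unfolding power2_eq_square by linarith
      finally show "expectation (\<lambda>\<omega>. \<bar>\<mu> - S i \<omega>\<bar>\<^sup>2) \<le> c" .
    qed simp
  qed simp
  from moment_le_cmult[OF this, of "1 / real n"]
  have "moment_le M 2 (\<lambda>\<omega>. 1 / real n * (\<Sum>i\<in>{1..n}. \<mu> - S i \<omega>)) (c / real n)"
    using n by (simp add: power2_eq_square)
  moreover have "1 / real n * (\<Sum>i\<in>{1..n}. \<mu> - S i \<omega>) = \<mu> - mc_estimator n S \<omega>" for \<omega>
    using n by (simp add: mc_estimator_def sum_subtractf right_diff_distrib)
  ultimately show ?thesis by (simp add: \<mu>_def)
qed

text \<open>The triangle inequality in L2, as Jensen's inequality with the bounds \<open>b\<close> as weights.\<close>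

lemma moment_le_sum_L2:
  assumes I: "finite I" and b: "\<And>i. i \<in> I \<Longrightarrow> 0 < b i"
    and X: "\<And>i. i \<in> I \<Longrightarrow> moment_le M 2 (X i) ((b i)\<^sup>2)"
  shows "moment_le M 2 (\<lambda>\<omega>. \<Sum>i\<in>I. X i \<omega>) ((\<Sum>i\<in>I. b i)\<^sup>2)"
proof -
  have "moment_le M 2 (\<lambda>\<omega>. \<Sum>i\<in>I. b i * (1 / b i * X i \<omega>)) ((\<Sum>i\<in>I. b i)\<^sup>2 * 1)"
  proof (rule moment_le_weighted_sum)
    fix i assume i: "i \<in> I"
    have "\<bar>1 / b i\<bar>\<^sup>2 * (b i)\<^sup>2 = 1" using b[OF i] by (simp add: power_divide)
    then show "moment_le M 2 (\<lambda>\<omega>. 1 / b i * X i \<omega>) 1" using moment_le_cmult[OF X[OF i], of "1 / b i"] by simp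
  qed (use I b in \<open>auto intro: less_imp_le\<close>)
  moreover have "(\<Sum>i\<in>I. b i * (1 / b i * X i \<omega>)) = (\<Sum>i\<in>I. X i \<omega>)" for \<omega>
    using b by (intro sum.cong) (auto simp: less_imp_neq[symmetric])
  ultimately show ?thesis by simp
qed

section \<open>Sample sizes and the zeta function\<close>

lemma level_weight: "2 powr (2 * (real L - real l / 2)) = 4 ^ L / 2 ^ l"
proof -
  have "2 powr (2 * (real L - real l / 2)) = 2 powr (real (2 * L) - real l)" by (simp add: algebra_simps)
  also have "\<dots> = 2 ^ (2 * L) / 2 ^ l" by (simp only: powr_diff powr_realpow zero_less_numeral)
  finally show ?thesis by (simp add: power_mult)
qed

lemma sample_size_0: "sample_size \<epsilon> L 0 = 4 ^ L"
proof -
  have "2 powr (2 * real L) = real (4 ^ L)" using level_weight[of L 0] by simp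
  then show ?thesis by (simp add: sample_size_def del: of_nat_power)
qed

lemma sample_size_level:
  "0 < l \<Longrightarrow> sample_size \<epsilon> L l = nat \<lceil>4 ^ L / 2 ^ l * real l powr (2 * (1 + \<epsilon>))\<rceil>"
  unfolding sample_size_def level_weight by simp

text \<open>Written with a square because the sample size divides a variance bound, of which the
  root is taken afterwards.\<close>

lemma sample_size_ge: "0 < l \<Longrightarrow> 4 ^ L / 2 ^ l * (real l powr (1 + \<epsilon>))\<^sup>2 \<le> real (sample_size \<epsilon> L l)"
proof -
  assume l: "0 < l"
  have "(real l powr (1 + \<epsilon>))\<^sup>2 = real l powr (2 * (1 + \<epsilon>))"
    by (simp add: power2_eq_square powr_add[symmetric])
  then show ?thesis unfolding sample_size_level[OF l] by (simp only: real_nat_ceiling_ge)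
qed

text \<open>Rounding up at most doubles a number that is at least 1, and
  \<open>4 ^ L / 2 ^ l\<close> is at least 1 for \<open>l \<le> L\<close>. The power of
  \<open>l\<close> is enlarged to that of \<open>L\<close> so that all levels get the same factor in
  the work estimate.\<close>

lemma sample_size_le:
  assumes \<epsilon>: "0 < \<epsilon>" and l: "l \<le> L" and L: "0 < L"
  shows "real (sample_size \<epsilon> L l) \<le> 2 * (4 ^ L / 2 ^ l * real L powr (2 * (1 + \<epsilon>)))"
proof (cases "l = 0")
  case True
  have "1 \<le> real L powr (2 * (1 + \<epsilon>))" using L \<epsilon> by (intro ge_one_powr_ge_zero) auto
  then have "4 ^ L * 1 \<le> (4::real) ^ L * (2 * real L powr (2 * (1 + \<epsilon>)))" by (intro mult_left_mono) auto
  then show ?thesis using True by (simp add: sample_size_0)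
next
  case False
  define x where "x = 4 ^ L / 2 ^ l * real l powr (2 * (1 + \<epsilon>))"
  have 1: "1 \<le> real l powr (2 * (1 + \<epsilon>))" using False \<epsilon> by (intro ge_one_powr_ge_zero) auto
  have "(2::real) ^ l \<le> 2 ^ L" using l by (intro power_increasing) auto
  also have "(2::real) ^ L \<le> 4 ^ L" by (intro power_mono) auto
  finally have "1 \<le> (4::real) ^ L / 2 ^ l" by simp
  from mult_mono[OF this 1] have x: "1 \<le> x" by (simp add: x_def)
  have l0: "0 < l" using False by simp
  have "real (sample_size \<epsilon> L l) = of_int \<lceil>x\<rceil>"
    unfolding sample_size_level[OF l0] x_def[symmetric] using x by simp
  also have "\<dots> \<le> 2 * x" using x of_int_ceiling_le_add_one[of x] by linarith
  also have "x \<le> 4 ^ L / 2 ^ l * real L powr (2 * (1 + \<epsilon>))"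
    unfolding x_def using l \<epsilon> by (intro mult_left_mono powr_mono2) auto
  finally show ?thesis by simp
qed

lemma zeta_partial_sum:
  assumes "0 < \<epsilon>"
  shows "(\<Sum>l=1..L. 1 / real l powr (1 + \<epsilon>)) \<le> riemann_zeta (1 + \<epsilon>)"
proof -
  have "summable (\<lambda>n. real n powr (- (1 + \<epsilon>)))" using summable_real_powr_iff[of "- (1 + \<epsilon>)"] assms by simp
  then have "summable (\<lambda>n. real (Suc n) powr (- (1 + \<epsilon>)))" by (subst summable_Suc_iff)
  then have "summable (\<lambda>n. 1 / real (Suc n) powr (1 + \<epsilon>))" by (simp only: powr_minus_divide)
  then have "(\<Sum>n<L. 1 / real (Suc n) powr (1 + \<epsilon>)) \<le> riemann_zeta (1 + \<epsilon>)"
    unfolding riemann_zeta_def by (intro sum_le_suminf) auto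
  moreover have "(\<Sum>n<L. 1 / real (Suc n) powr (1 + \<epsilon>)) = (\<Sum>l=1..L. 1 / real l powr (1 + \<epsilon>))"
    by (rule sum.reindex_bij_witness[of _ "\<lambda>l. l - 1" Suc]) auto
  ultimately show ?thesis by simp
qed

section \<open>Error and work of the multilevel estimator\<close>

text \<open>The error splits into the bias on level \<open>L\<close> and the sampling errors of the
  levels, whose means telescope to the mean of \<open>Y L\<close>. The joint law of different levels
  is left open, so L2 norms are added instead of variances, and the sum of
  \<open>1 / real l powr (1 + \<epsilon>)\<close> appears.\<close>

lemma (in prob_space) mlmc_error:
  assumes T: "0 < T" and D: "0 < D0" "0 < D1" "0 < D2"
    and Y0: "moment_le M 2 (Y 0) D0"
    and Y: "\<And>l. 0 < l \<Longrightarrow> moment_le M 2 (\<lambda>\<omega>. Y l \<omega> - Y (l - 1) \<omega>) (D1 * step_size T l)"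
    and bias: "\<And>l. \<bar>\<mu> - expectation (Y l)\<bar> \<le> D2 * step_size T l"
    and \<epsilon>: "0 < \<epsilon>" and S: "mlmc_samples M Y (sample_size \<epsilon> L) L S"
  shows "moment_le M 2 (\<lambda>\<omega>. \<mu> - mlmc_estimator (sample_size \<epsilon> L) L S \<omega>)
    (((D2 + sqrt D0 / T + sqrt (D1 / T) * riemann_zeta (1 + \<epsilon>)) * step_size T L)\<^sup>2)"
proof -
  let ?h = "step_size T L"
  have h: "0 < step_size T l" for l using T by (simp add: step_size_def)
  define \<Delta> where "\<Delta> l \<omega> = (if l = 0 then Y 0 \<omega> else Y l \<omega> - Y (l - 1) \<omega>)" for l \<omega>
  have \<Delta>: "moment_le M 2 (\<Delta> l) (if l = 0 then D0 else D1 * step_size T l)" for l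
    using Y0 Y[of l] by (cases "l = 0") (simp_all add: \<Delta>_def[abs_def])
  have \<Delta>int: "integrable M (\<Delta> l)" for l
    using moment_leD(4)[OF moment_le_lower[OF \<Delta>, of 1]] moment_leD(2)[OF \<Delta>] by (simp add: integrable_abs_iff)
  have Yint: "integrable M (Y l)" for l
  proof (induction l)
    case 0
    then show ?case using \<Delta>int[of 0] by (simp add: \<Delta>_def[abs_def])
  next
    case (Suc l)
    then have "integrable M (\<lambda>\<omega>. \<Delta> (Suc l) \<omega> + Y l \<omega>)" using \<Delta>int by simp
    then show ?case by (simp add: \<Delta>_def[abs_def])
  qed
  have telescope: "(\<Sum>l\<le>L. expectation (\<Delta> l)) = expectation (Y L)" for L
  proof (induction L)
    case 0
    then show ?case by (simp add: \<Delta>_def[abs_def])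
  next
    case (Suc L)
    then show ?case using Yint by (simp add: \<Delta>_def[abs_def])
  qed
  \<comment> \<open>Square roots of the variance bounds. On level 0 the bound is
    \<open>D0 / 4 ^ L\<close>. On level \<open>l\<close> the factor \<open>1 / 2 ^ l\<close> of the
    step size cancels against that of the sample size, leaving \<open>D1 * T / 4 ^ L\<close> divided
    by \<open>real l powr (2 * (1 + \<epsilon>))\<close>. Both are expressed through
    \<open>step_size T L = T / 2 ^ L\<close>.\<close>
  define b where "b l = (if l = 0 then sqrt D0 / T * ?h else sqrt (D1 / T) * ?h * (1 / real l powr (1 + \<epsilon>)))" for l
  have b: "0 < b l" for l using D T h by (simp add: b_def)
  have "moment_le M 2 (\<lambda>\<omega>. expectation (\<Delta> l) - mc_estimator (sample_size \<epsilon> L l) (S l) \<omega>) ((b l)\<^sup>2)"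
    if l: "l \<le> L" for l
  proof (cases "l = 0")
    case True
    have "iid_samples M (\<Delta> 0) (sample_size \<epsilon> L 0) (S 0)"
      using S by (simp add: mlmc_samples_def \<Delta>_def[abs_def])
    from mc_estimator_moment[OF \<Delta> this]
    have "moment_le M 2 (\<lambda>\<omega>. expectation (\<Delta> 0) - mc_estimator (sample_size \<epsilon> L 0) (S 0) \<omega>) (D0 / 4 ^ L)"
      by (simp add: sample_size_0)
    moreover have "(b 0)\<^sup>2 = D0 / 4 ^ L"
      using D T by (simp add: b_def step_size_def power_mult_distrib power_divide power2_eq_square power_mult_distrib[symmetric])
    ultimately show ?thesis using True by simp
  next
    case False
    then have l0: "0 < l" by simp
    have iid: "iid_samples M (\<Delta> l) (sample_size \<epsilon> L l) (S l)"
      using S l l0 by (simp add: mlmc_samples_def \<Delta>_def[abs_def])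
    define y where "y = real l powr (1 + \<epsilon>)"
    have y: "0 < y" using l0 by (simp add: y_def)
    have x: "0 < 4 ^ L / 2 ^ l * y\<^sup>2" using y by simp
    then have n: "0 < real (sample_size \<epsilon> L l)" using sample_size_ge[OF l0, of L \<epsilon>] unfolding y_def by linarith
    have "D1 * step_size T l / real (sample_size \<epsilon> L l) \<le> D1 * step_size T l / (4 ^ L / 2 ^ l * y\<^sup>2)"
    proof (rule divide_left_mono)
      show "4 ^ L / 2 ^ l * y\<^sup>2 \<le> real (sample_size \<epsilon> L l)" unfolding y_def by (rule sample_size_ge[OF l0])
      show "0 < real (sample_size \<epsilon> L l) * (4 ^ L / 2 ^ l * y\<^sup>2)" by (rule mult_pos_pos[OF n x])
    qed (use D h[of l] in simp)
    also have "\<dots> = (sqrt (D1 / T) * ?h * (1 / y))\<^sup>2"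
    proof -
      have "(sqrt (D1 / T) * ?h * (1 / y))\<^sup>2 = D1 / T * ?h\<^sup>2 * (1 / y)\<^sup>2"
        unfolding power_mult_distrib using D T by simp
      also have "?h\<^sup>2 = T * T / 4 ^ L"
        by (simp add: step_size_def power_divide power2_eq_square power_mult_distrib[symmetric])
      also have "D1 / T * (T * T / 4 ^ L) * (1 / y)\<^sup>2 = D1 * T / (4 ^ L * y\<^sup>2)"
        using T by (simp add: power_divide field_simps)
      finally show ?thesis using y by (simp add: step_size_def)
    qed
    finally have le: "D1 * step_size T l / real (sample_size \<epsilon> L l) \<le> (b l)\<^sup>2" using l0 by (simp add: b_def y_def)
    have "moment_le M 2 (\<lambda>\<omega>. expectation (\<Delta> l) - mc_estimator (sample_size \<epsilon> L l) (S l) \<omega>)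
        (D1 * step_size T l / real (sample_size \<epsilon> L l))"
      using mc_estimator_moment[OF \<Delta> iid] n l0 by simp
    then show ?thesis using le by (rule moment_le_weaken)
  qed
  then have "moment_le M 2 (\<lambda>\<omega>. \<Sum>l\<le>L. expectation (\<Delta> l) - mc_estimator (sample_size \<epsilon> L l) (S l) \<omega>) ((\<Sum>l\<le>L. b l)\<^sup>2)"
    using b by (intro moment_le_sum_L2) auto
  moreover have "moment_le M 2 (\<lambda>_. \<mu> - expectation (Y L)) ((D2 * ?h)\<^sup>2)"
    by (rule moment_le_weaken[OF moment_le_const]) (rule power_mono[OF bias abs_ge_zero])
  moreover have B: "0 < (\<Sum>l\<le>L. b l)" using b by (intro sum_pos) auto
  \<comment> \<open>Bias and total sampling error are joined by the same L2 triangle inequality,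
    with the two truth values as index set.\<close>
  ultimately have "moment_le M 2 (\<lambda>\<omega>. \<Sum>i\<in>{True, False}. (if i then \<mu> - expectation (Y L)
      else (\<Sum>l\<le>L. expectation (\<Delta> l) - mc_estimator (sample_size \<epsilon> L l) (S l) \<omega>)))
      ((\<Sum>i\<in>{True, False}. if i then D2 * ?h else (\<Sum>l\<le>L. b l))\<^sup>2)"
    using D h[of L] by (intro moment_le_sum_L2) auto
  moreover have "(\<Sum>i\<in>{True, False}. (if i then \<mu> - expectation (Y L)
      else (\<Sum>l\<le>L. expectation (\<Delta> l) - mc_estimator (sample_size \<epsilon> L l) (S l) \<omega>)))
    = \<mu> - mlmc_estimator (sample_size \<epsilon> L) L S \<omega>" for \<omega>
    using telescope[of L] by (simp add: sum_subtractf mlmc_estimator_def sum.atMost_shift atLeast1_atMost_eq_remove0 atMost_atLeast0 sum.atLeast_Suc_atMost)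
  ultimately have res: "moment_le M 2 (\<lambda>\<omega>. \<mu> - mlmc_estimator (sample_size \<epsilon> L) L S \<omega>) ((D2 * ?h + (\<Sum>l\<le>L. b l))\<^sup>2)"
    by simp
  have "(\<Sum>l\<le>L. b l) = b 0 + (\<Sum>l=1..L. b l)" by (simp add: atMost_atLeast0 sum.atLeast_Suc_atMost)
  also have "(\<Sum>l=1..L. b l) = sqrt (D1 / T) * ?h * (\<Sum>l=1..L. 1 / real l powr (1 + \<epsilon>))"
    unfolding sum_distrib_left by (intro sum.cong) (auto simp: b_def)
  also have "\<dots> \<le> sqrt (D1 / T) * ?h * riemann_zeta (1 + \<epsilon>)"
    using D T h[of L] by (intro mult_left_mono zeta_partial_sum \<epsilon>) auto
  finally have "(\<Sum>l\<le>L. b l) \<le> sqrt D0 / T * ?h + sqrt (D1 / T) * ?h * riemann_zeta (1 + \<epsilon>)"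
    by (simp add: b_def)
  then have "(D2 * ?h + (\<Sum>l\<le>L. b l))\<^sup>2 \<le> ((D2 + sqrt D0 / T + sqrt (D1 / T) * riemann_zeta (1 + \<epsilon>)) * ?h)\<^sup>2"
    using B D h[of L] by (intro power_mono) (auto simp: algebra_simps)
  with res show ?thesis by (rule moment_le_weaken)
qed

text \<open>On each level the factor \<open>1 / 2 ^ l\<close> of the sample size compensates the
  growth \<open>2 ^ l\<close> of the cost, so every level costs at most a multiple of
  \<open>4 ^ L * real L powr (2 * (1 + \<epsilon>))\<close>. The number of levels supplies one more
  power of \<open>L\<close>.\<close>

lemma mlmc_work_bigo:
  assumes T: "0 < T" and \<epsilon>: "0 < \<epsilon>" and cost: "cost \<in> O(\<lambda>l. 1 / step_size T l)"
  shows "(\<lambda>L. mlmc_work cost (sample_size \<epsilon> L) L) \<in> O(\<lambda>L. 1 / (step_size T L)\<^sup>2 * real L powr (3 + 2 * \<epsilon>))"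
proof -
  obtain c where "eventually (\<lambda>l. norm (cost l) \<le> c * norm (1 / step_size T l)) at_top"
    using cost by (elim landau_o.bigE)
  then obtain l0 where l0: "\<And>l. l0 \<le> l \<Longrightarrow> \<bar>cost l\<bar> \<le> c * (2 ^ l / T)"
    using T by (auto simp: eventually_at_top_linorder step_size_def)
  \<comment> \<open>The cost is controlled only from some level on; the finitely many earlier costs
    are added to the constant.\<close>
  define C where "C = (\<Sum>l<l0. \<bar>cost l\<bar>) + \<bar>c\<bar> / T"
  have C: "0 \<le> C" using T by (auto simp: C_def intro!: add_nonneg_nonneg sum_nonneg)
  have bound: "\<bar>cost l\<bar> \<le> C * 2 ^ l" for l
  proof (cases "l0 \<le> l")
    case True
    have "c * (2 ^ l / T) \<le> \<bar>c\<bar> / T * 2 ^ l" using T by (simp add: divide_right_mono mult_right_mono)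
    also have "\<dots> \<le> C * 2 ^ l" unfolding C_def by (intro mult_right_mono) (auto intro!: sum_nonneg)
    finally show ?thesis using l0[OF True] by linarith
  next
    case False
    then have "\<bar>cost l\<bar> \<le> (\<Sum>l<l0. \<bar>cost l\<bar>)" by (intro member_le_sum) auto
    also have "\<dots> \<le> C" using T by (simp add: C_def)
    also have "\<dots> \<le> C * 2 ^ l" using C mult_left_mono[of 1 "2 ^ l" C] by simp
    finally show ?thesis .
  qed
  show ?thesis
  \<comment> \<open>The summand 1 makes the constant positive even if \<open>C = 0\<close>.\<close>
  proof (rule landau_o.bigI[of "4 * C * T\<^sup>2 + 1"])
    show "eventually (\<lambda>L. norm (mlmc_work cost (sample_size \<epsilon> L) L)
        \<le> (4 * C * T\<^sup>2 + 1) * norm (1 / (step_size T L)\<^sup>2 * real L powr (3 + 2 * \<epsilon>))) at_top"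
      using eventually_gt_at_top[of 0]
    proof eventually_elim
      case (elim L)
      let ?P = "real L powr (2 * (1 + \<epsilon>))"
      have "\<bar>mlmc_work cost (sample_size \<epsilon> L) L\<bar> \<le> (\<Sum>l=0..L. \<bar>real (sample_size \<epsilon> L l) * cost l\<bar>)"
        unfolding mlmc_work_def by (rule sum_abs)
      also have "\<dots> \<le> (\<Sum>l=0..L. 2 * C * 4 ^ L * ?P)"
      proof (rule sum_mono)
        fix l assume "l \<in> {0..L}"
        then have "real (sample_size \<epsilon> L l) * \<bar>cost l\<bar> \<le> 2 * (4 ^ L / 2 ^ l * ?P) * (C * 2 ^ l)"
          using elim by (intro mult_mono sample_size_le \<epsilon> bound) auto
        then show "\<bar>real (sample_size \<epsilon> L l) * cost l\<bar> \<le> 2 * C * 4 ^ L * ?P"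
          by (simp add: abs_mult mult_ac)
      qed
      also have "\<dots> = (real L + 1) * (2 * C * 4 ^ L * ?P)" by simp
      also have "\<dots> \<le> (2 * real L) * (2 * C * 4 ^ L * ?P)" using elim C by (intro mult_right_mono) auto
      also have "\<dots> = 4 * C * 4 ^ L * (real L * ?P)" by simp
      also have "real L * ?P = real L powr (3 + 2 * \<epsilon>)"
      proof -
        have "real L powr (1 + 2 * (1 + \<epsilon>)) = real L powr 1 * ?P" by (rule powr_add)
        then show ?thesis using elim by (simp add: algebra_simps)
      qed
      also have "4 * C * 4 ^ L * real L powr (3 + 2 * \<epsilon>) = 4 * C * T\<^sup>2 * (1 / (step_size T L)\<^sup>2 * real L powr (3 + 2 * \<epsilon>))"
        using T by (simp add: step_size_def power_divide power2_eq_square power_mult_distrib[symmetric])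
      also have "\<dots> \<le> (4 * C * T\<^sup>2 + 1) * norm (1 / (step_size T L)\<^sup>2 * real L powr (3 + 2 * \<epsilon>))"
        using C by (intro mult_mono) auto
      finally show ?case by simp
    qed
  qed (use C in \<open>auto intro: add_nonneg_pos\<close>)
qed

section \<open>Weak convergence and the main theorem\<close>

lemma norm_Pair_le: "norm (x, y) \<le> norm x + norm y"
  using norm_Pair[of x y] sqrt_sum_squares_le_sum_abs[of "norm x" "norm y"] by simp

text \<open>Mean value inequality on the segment from \<open>x\<close> to \<open>y\<close>, where
  norms stay below \<open>1 + norm x + norm y\<close>. This base is at least 1, so
  \<open>1 + norm z ^ r\<close> is at most twice its power of order \<open>r\<close>.\<close>

lemma polynomial_growth_diff:
  fixes f :: "'v::euclidean_space \<Rightarrow> real"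
  assumes f: "\<And>x. f differentiable (at x)"
    and growth: "\<And>x. onorm (frechet_derivative f (at x)) \<le> K * (1 + norm x ^ r)"
  shows "\<bar>f x - f y\<bar> \<le> 2 * \<bar>K\<bar> * (1 + norm x + norm y) ^ r * norm (x - y)"
proof -
  let ?A = "1 + norm x + norm y"
  have "norm (f x - f y) \<le> (2 * \<bar>K\<bar> * ?A ^ r) * norm (x - y)"
  proof (rule differentiable_bound[of "closed_segment x y" f "\<lambda>z. frechet_derivative f (at z)"])
    fix z assume z: "z \<in> closed_segment x y"
    show "(f has_derivative frechet_derivative f (at z)) (at z within closed_segment x y)"
      using f[of z] frechet_derivative_works has_derivative_at_withinI by blast
    have "norm z \<le> ?A"
    proof -
      have "z \<in> cball 0 (max (norm x) (norm y))"
        using z closed_segment_subset[of x "cball 0 (max (norm x) (norm y))" y] by (auto simp: subset_iff)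
      then have "norm z \<le> max (norm x) (norm y)" by simp
      also have "\<dots> \<le> ?A" by simp
      finally show ?thesis .
    qed
    then have "norm z ^ r \<le> ?A ^ r" by (intro power_mono) auto
    moreover have "1 \<le> ?A ^ r" by (intro one_le_power) simp
    ultimately have "1 + norm z ^ r \<le> 2 * ?A ^ r" by linarith
    then have "\<bar>K\<bar> * (1 + norm z ^ r) \<le> \<bar>K\<bar> * (2 * ?A ^ r)" by (intro mult_left_mono) auto
    moreover have "K * (1 + norm z ^ r) \<le> \<bar>K\<bar> * (1 + norm z ^ r)" by (intro mult_right_mono) auto
    ultimately show "onorm (frechet_derivative f (at z)) \<le> 2 * \<bar>K\<bar> * ?A ^ r" using growth[of z] by simp
  qed auto
  then show ?thesis by simp
qed

text \<open>Young-type inequalities replacing Hoelder's: they need only the order \<open>1 / 2\<close> in the moment of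
  order \<open>2 * (r + 1)\<close>, and the order 1 in mean square.\<close>

lemma young_square:
  fixes a e h :: real
  assumes "1 \<le> a" "0 \<le> e" "0 < h"
  shows "(a ^ r * e)\<^sup>2 \<le> h * a ^ (2 * (r + 1)) + h * (1 / h ^ (r + 1) * e ^ (2 * (r + 1)))"
proof -
  define x where "x = a\<^sup>2"
  \<comment> \<open>Division by \<open>h\<close> normalises an error of order 1/2. The product
    \<open>x ^ r * y\<close> has \<open>r + 1\<close> factors, hence is at most the larger of
    \<open>x\<close> and \<open>y\<close> to the power \<open>r + 1\<close>.\<close>
  define y where "y = e\<^sup>2 / h"
  define m where "m = max x y"
  have xy: "0 \<le> x" "0 \<le> y" "x \<le> m" "y \<le> m" using assms by (auto simp: x_def y_def m_def)
  have "(a ^ r * e)\<^sup>2 = h * (x ^ r * y)"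
    using assms by (simp add: x_def y_def power_mult_distrib power_mult[symmetric] mult.commute)
  also have "x ^ r * y \<le> m ^ r * m" using xy by (intro mult_mono power_mono) auto
  also have "\<dots> = m ^ (r + 1)" by simp
  also have "\<dots> \<le> x ^ (r + 1) + y ^ (r + 1)"
    using zero_le_power[OF xy(1), of "r + 1"] zero_le_power[OF xy(2), of "r + 1"] unfolding m_def max_def by (auto simp del: power_Suc)
  also have "y ^ (r + 1) = 1 / h ^ (r + 1) * e ^ (2 * (r + 1))"
    by (simp only: y_def power_divide power_mult) simp
  also have "x ^ (r + 1) = a ^ (2 * (r + 1))" by (simp only: x_def power_mult)
  finally show ?thesis using assms by (simp add: distrib_left)
qed

lemma young_product:
  fixes a e h :: real
  assumes "0 < h"
  shows "a ^ r * e \<le> h * a ^ (2 * r) + 1 / h * e\<^sup>2"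
proof -
  have sq: "a ^ (2 * r) = (a ^ r)\<^sup>2" by (simp only: mult.commute[of 2 r] power_mult)
  have "0 \<le> (h * a ^ r - e)\<^sup>2 + (h * a ^ r)\<^sup>2 + e\<^sup>2" by simp
  then have "2 * (h * (a ^ r * e)) \<le> 2 * ((h * a ^ r)\<^sup>2 + e\<^sup>2)" by (simp add: power2_diff)
  also have "\<dots> = 2 * (h * (h * a ^ (2 * r) + 1 / h * e\<^sup>2))"
    using assms by (simp add: sq power2_eq_square distrib_left)
  finally show ?thesis using assms by simp
qed

lemma differentiable_imp_borel_measurable:
  fixes f :: "'v::euclidean_space \<Rightarrow> real"
  assumes "\<And>x. f differentiable (at x)"
  shows "f \<in> borel_measurable borel"
  using assms
  by (intro borel_measurable_continuous_onI) (auto simp: continuous_on_eq_continuous_within intro: differentiable_imp_continuous_within differentiable_at_withinI)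

context hamiltonian_sde
begin

context
  fixes f :: "(real ^ 'm) \<times> (real ^ 'm) \<Rightarrow> real" and K :: real
  assumes f_diff: "\<And>x. f differentiable (at x)"
    and f_growth: "\<And>x. onorm (frechet_derivative f (at x)) \<le> K * (1 + norm x ^ r)"
begin

lemma f_meas [measurable]: "f \<in> borel_measurable borel"
  by (rule differentiable_imp_borel_measurable[OF f_diff])

text \<open>Comparison with \<open>f 0\<close> gives growth of order \<open>r + 1\<close> for
  \<open>f\<close>, so its second moment is governed by the moment of order
  \<open>2 * (r + 1)\<close> of \<open>X\<close>.\<close>

lemma moment_le_f:
  assumes X: "moment_le M (2 * (r + 1)) (\<lambda>\<omega>. norm (X \<omega>)) c" and m [measurable]: "X \<in> borel_measurable M"
  shows "moment_le M 2 (\<lambda>\<omega>. f (X \<omega>))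
    ((\<bar>f 0\<bar> + 2 * \<bar>K\<bar>)\<^sup>2 * (2 ^ (2 * (r + 1)) * (1 + c)))"
proof -
  have "moment_le M (2 * (r + 1)) (\<lambda>\<omega>. 1 + norm (X \<omega>)) (2 ^ (2 * (r + 1)) * (1 + c))"
    using moment_le_add[OF moment_le_const X, of 1] by simp
  then have "moment_le M 2 (\<lambda>\<omega>. (1 + norm (X \<omega>)) ^ (r + 1)) (2 ^ (2 * (r + 1)) * (1 + c))"
    by (subst moment_le_power_iff) (auto simp: mult.commute)
  from moment_le_cmult[OF this, of "\<bar>f 0\<bar> + 2 * \<bar>K\<bar>"]
  have "moment_le M 2 (\<lambda>\<omega>. (\<bar>f 0\<bar> + 2 * \<bar>K\<bar>) * (1 + norm (X \<omega>)) ^ (r + 1)) ((\<bar>f 0\<bar> + 2 * \<bar>K\<bar>)\<^sup>2 * (2 ^ (2 * (r + 1)) * (1 + c)))"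
    by simp
  then show ?thesis
  proof (rule moment_le_mono)
    have "\<bar>f x\<bar> \<le> (\<bar>f 0\<bar> + 2 * \<bar>K\<bar>) * (1 + norm x) ^ (r + 1)" for x
    proof -
      have "\<bar>f x\<bar> \<le> \<bar>f 0\<bar> * 1 + 2 * \<bar>K\<bar> * ((1 + norm x) ^ r * norm x)"
        using polynomial_growth_diff[OF f_diff f_growth, of x 0] by (simp add: mult.assoc)
      also have "\<dots> \<le> \<bar>f 0\<bar> * (1 + norm x) ^ (r + 1) + 2 * \<bar>K\<bar> * ((1 + norm x) ^ r * (1 + norm x))"
        by (intro add_mono mult_left_mono one_le_power) auto
      finally show ?thesis by (simp add: algebra_simps)
    qed
    then show "AE \<omega> in M. \<bar>f (X \<omega>)\<bar> \<le> \<bar>(\<bar>f 0\<bar> + 2 * \<bar>K\<bar>) * (1 + norm (X \<omega>)) ^ (r + 1)\<bar>"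
      by (intro AE_I2) (auto intro: order_trans[OF _ abs_ge_self])
  qed measurable
qed

text \<open>The difference is at most a multiple of \<open>A ^ r * E\<close>, with \<open>A\<close>
  of bounded moments and \<open>E\<close> the error. In \<open>young_product\<close> the weight
  \<open>1 / h\<close> turns the mean square order 1 into \<open>h\<close> for the first moment;
  \<open>young_square\<close> turns the half order of the high moment into \<open>h\<close> for the
  second.\<close>

lemma moment_le_f_diff:
  assumes X: "moment_le M (2 * (r + 1)) (\<lambda>\<omega>. norm (X \<omega>)) c" and Y: "moment_le M (2 * (r + 1)) (\<lambda>\<omega>. norm (Y \<omega>)) d"
    and m [measurable]: "X \<in> borel_measurable M" "Y \<in> borel_measurable M"
    and h: "0 < h"
    and e2: "moment_le M 2 (\<lambda>\<omega>. norm (X \<omega> - Y \<omega>)) (a * h\<^sup>2)"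
    and eK: "moment_le M (2 * (r + 1)) (\<lambda>\<omega>. norm (X \<omega> - Y \<omega>)) (b * h ^ (r + 1))"
  defines "c' \<equiv> 2 ^ (2 * (r + 1)) * (2 ^ (2 * (r + 1)) * (1 + c) + d)"
  shows "moment_le M 1 (\<lambda>\<omega>. f (X \<omega>) - f (Y \<omega>)) (2 * \<bar>K\<bar> * (2 * ((1 + c') + a)) * h)"
    and "moment_le M 2 (\<lambda>\<omega>. f (X \<omega>) - f (Y \<omega>)) ((2 * \<bar>K\<bar>)\<^sup>2 * (2 * (c' + b)) * h)"
proof -
  define A where "A \<omega> = 1 + norm (X \<omega>) + norm (Y \<omega>)" for \<omega>
  define E where "E \<omega> = norm (X \<omega> - Y \<omega>)" for \<omega>
  have [measurable]: "A \<in> borel_measurable M" "E \<in> borel_measurable M" by (simp_all add: A_def[abs_def] E_def[abs_def])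
  have A1: "1 \<le> A \<omega>" and E0: "0 \<le> E \<omega>" for \<omega> by (simp_all add: A_def E_def)
  have A: "moment_le M (2 * (r + 1)) A c'"
    using moment_le_add[OF moment_le_add[OF moment_le_const X, of 1] Y] by (simp add: A_def[abs_def] c'_def)
  have diff: "\<bar>f (X \<omega>) - f (Y \<omega>)\<bar> \<le> 2 * \<bar>K\<bar> * (A \<omega> ^ r * E \<omega>)" for \<omega>
    using polynomial_growth_diff[OF f_diff f_growth, of "X \<omega>" "Y \<omega>"] by (simp add: A_def E_def mult.assoc)
  have le: "moment_le M k (\<lambda>\<omega>. f (X \<omega>) - f (Y \<omega>)) (\<bar>2 * \<bar>K\<bar>\<bar> ^ k * z)"
    if "moment_le M k (\<lambda>\<omega>. A \<omega> ^ r * E \<omega>) z" for k z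
    by (rule moment_le_mono[OF moment_le_cmult[OF that, of "2 * \<bar>K\<bar>"]])
       (use diff in \<open>auto intro: order_trans[OF _ abs_ge_self]\<close>)
  have A2r: "moment_le M 1 (\<lambda>\<omega>. A \<omega> ^ (2 * r)) (1 + c')"
    using moment_le_lower[OF A, of "2 * r"] by (subst moment_le_power_iff) auto
  have E2: "moment_le M 1 (\<lambda>\<omega>. E \<omega> ^ 2) (a * h\<^sup>2)"
    using e2 by (subst moment_le_power_iff) (auto simp: E_def[abs_def])
  have hh: "\<bar>h\<bar> = h" "\<bar>1 / h\<bar> = 1 / h" using h by auto
  have "moment_le M 1 (\<lambda>\<omega>. h * A \<omega> ^ (2 * r) + 1 / h * E \<omega> ^ 2) (2 ^ 1 * (\<bar>h\<bar> ^ 1 * (1 + c') + \<bar>1 / h\<bar> ^ 1 * (a * h\<^sup>2)))"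
    by (rule moment_le_add[OF moment_le_cmult[OF A2r] moment_le_cmult[OF E2]])
  moreover have "2 ^ 1 * (\<bar>h\<bar> ^ 1 * (1 + c') + \<bar>1 / h\<bar> ^ 1 * (a * h\<^sup>2)) = 2 * ((1 + c') + a) * h"
    using h unfolding hh by (simp add: power2_eq_square algebra_simps)
  ultimately have "moment_le M 1 (\<lambda>\<omega>. h * A \<omega> ^ (2 * r) + 1 / h * E \<omega> ^ 2) (2 * ((1 + c') + a) * h)" by simp
  then have "moment_le M 1 (\<lambda>\<omega>. A \<omega> ^ r * E \<omega>) (2 * ((1 + c') + a) * h)"
  proof (rule moment_le_mono)
    have "0 \<le> A \<omega> ^ r * E \<omega>" for \<omega> using A1[of \<omega>] E0[of \<omega>] by simp
    then show "AE \<omega> in M. \<bar>A \<omega> ^ r * E \<omega>\<bar> \<le> \<bar>h * A \<omega> ^ (2 * r) + 1 / h * E \<omega> ^ 2\<bar>"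
      by (intro AE_I2) (metis young_product[OF h] abs_of_nonneg abs_ge_self order_trans)
  qed simp
  from le[OF this] show "moment_le M 1 (\<lambda>\<omega>. f (X \<omega>) - f (Y \<omega>)) (2 * \<bar>K\<bar> * (2 * ((1 + c') + a)) * h)"
    by (simp add: mult.assoc)
  have AK: "moment_le M 1 (\<lambda>\<omega>. A \<omega> ^ (2 * (r + 1))) c'"
    using A by (subst moment_le_power_iff) auto
  have EK: "moment_le M 1 (\<lambda>\<omega>. E \<omega> ^ (2 * (r + 1))) (b * h ^ (r + 1))"
    using eK by (subst moment_le_power_iff) (auto simp: E_def[abs_def])
  have hr: "0 < h ^ (r + 1)" using h by simp
  have "moment_le M 1 (\<lambda>\<omega>. h * A \<omega> ^ (2 * (r + 1)) + h * (1 / h ^ (r + 1) * E \<omega> ^ (2 * (r + 1))))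
      (2 ^ 1 * (\<bar>h\<bar> ^ 1 * c' + \<bar>h\<bar> ^ 1 * (\<bar>1 / h ^ (r + 1)\<bar> ^ 1 * (b * h ^ (r + 1)))))"
    by (rule moment_le_add[OF moment_le_cmult[OF AK] moment_le_cmult[OF moment_le_cmult[OF EK]]])
  moreover have "2 ^ 1 * (\<bar>h\<bar> ^ 1 * c' + \<bar>h\<bar> ^ 1 * (\<bar>1 / h ^ (r + 1)\<bar> ^ 1 * (b * h ^ (r + 1)))) = 2 * (c' + b) * h"
    using h hr by (simp add: distrib_left mult_ac del: power_Suc)
  ultimately have "moment_le M 1 (\<lambda>\<omega>. h * A \<omega> ^ (2 * (r + 1)) + h * (1 / h ^ (r + 1) * E \<omega> ^ (2 * (r + 1)))) (2 * (c' + b) * h)"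
    by metis
  then have "moment_le M 1 (\<lambda>\<omega>. (A \<omega> ^ r * E \<omega>) ^ 2) (2 * (c' + b) * h)"
  proof (rule moment_le_mono)
    show "AE \<omega> in M. \<bar>(A \<omega> ^ r * E \<omega>) ^ 2\<bar> \<le> \<bar>h * A \<omega> ^ (2 * (r + 1)) + h * (1 / h ^ (r + 1) * E \<omega> ^ (2 * (r + 1)))\<bar>"
      by (intro AE_I2, unfold abs_of_nonneg[OF zero_le_power2])
         (rule order_trans[OF young_square[OF A1 E0 h] abs_ge_self])
  qed simp
  then have "moment_le M 2 (\<lambda>\<omega>. A \<omega> ^ r * E \<omega>) (2 * (c' + b) * h)"
    by (subst (asm) moment_le_power_iff) auto
  from le[OF this] show "moment_le M 2 (\<lambda>\<omega>. f (X \<omega>) - f (Y \<omega>)) ((2 * \<bar>K\<bar>)\<^sup>2 * (2 * (c' + b)) * h)"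
    by (simp add: mult.assoc)
qed

text \<open>One set of constants serves the solution and every run of the scheme, so that it applies
  to all levels at once.\<close>

lemma test_function_moments:
  obtains D0 D1 D2 where "0 < D0" "0 < D1" "0 < D2"
    "moment_le M 2 (\<lambda>\<omega>. f (p T \<omega>, q T \<omega>)) D0"
    "\<And>N P Q. scheme N P Q \<Longrightarrow> moment_le M 2 (\<lambda>\<omega>. f (P N \<omega>, Q N \<omega>)) D0"
    "\<And>N P Q. scheme N P Q \<Longrightarrow> moment_le M 2 (\<lambda>\<omega>. f (p T \<omega>, q T \<omega>) - f (P N \<omega>, Q N \<omega>)) (D1 * (T / real N))"
    "\<And>N P Q. scheme N P Q \<Longrightarrow> moment_le M 1 (\<lambda>\<omega>. f (p T \<omega>, q T \<omega>) - f (P N \<omega>, Q N \<omega>)) (D2 * (T / real N))"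
proof -
  obtain c where c: "0 \<le> c" "\<And>t. t \<in> {0..T} \<Longrightarrow> moment_le M (2 * (r + 1)) (\<lambda>\<omega>. norm (p t \<omega>) + norm (q t \<omega>)) c"
    using solution_moment by blast
  obtain d where d: "0 \<le> d" "\<And>N P Q n. scheme N P Q \<Longrightarrow> n \<le> N \<Longrightarrow> moment_le M (2 * (r + 1)) (\<lambda>\<omega>. norm (P n \<omega>) + norm (Q n \<omega>)) d"
    by (rule scheme_moment) (rule that; simp)
  obtain a where a: "0 \<le> a" "\<And>N P Q n. scheme N P Q \<Longrightarrow> n \<le> N \<Longrightarrow> moment_le M 2
      (\<lambda>\<omega>. norm (p (real n * (T / real N)) \<omega> - P n \<omega>) + norm (q (real n * (T / real N)) \<omega> - Q n \<omega>)) (a * (T / real N)\<^sup>2)"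
    by (rule error_mean_square) (rule that; simp)
  obtain b where b: "0 \<le> b" "\<And>N P Q n. scheme N P Q \<Longrightarrow> n \<le> N \<Longrightarrow> moment_le M (2 * (r + 1))
      (\<lambda>\<omega>. norm (p (real n * (T / real N)) \<omega> - P n \<omega>) + norm (q (real n * (T / real N)) \<omega> - Q n \<omega>)) (b * (T / real N) ^ (r + 1))"
    by (rule error_half_order) (rule that; simp)
  have TT: "T \<in> {0..T}" using T0 by simp
  note [measurable] = solution_meas[OF TT]
  have X: "moment_le M (2 * (r + 1)) (\<lambda>\<omega>. norm (p T \<omega>, q T \<omega>)) c"
    by (rule moment_le_mono[OF c(2)[OF TT]]) (auto intro!: AE_I2 order_trans[OF norm_Pair_le])
  have Y: "moment_le M (2 * (r + 1)) (\<lambda>\<omega>. norm (P N \<omega>, Q N \<omega>)) d" if sch: "scheme N P Q" for N P Q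
  proof -
    note [measurable] = scheme_meas[OF sch order_refl]
    show ?thesis
      by (rule moment_le_mono[OF d(2)[OF sch order_refl]]) (auto intro!: AE_I2 order_trans[OF norm_Pair_le])
  qed
  define c' where "c' = 2 ^ (2 * (r + 1)) * (2 ^ (2 * (r + 1)) * (1 + c) + d)"
  define m where "m x = (\<bar>f 0\<bar> + 2 * \<bar>K\<bar>)\<^sup>2 * (2 ^ (2 * (r + 1)) * (1 + x))" for x
  have m0: "0 \<le> m c" "0 \<le> m d" using c d by (auto simp: m_def)
  have c'0: "0 \<le> c'" using c d by (simp add: c'_def)
  define D1 where "D1 = (2 * \<bar>K\<bar>)\<^sup>2 * (2 * (c' + b))"
  define D2 where "D2 = 2 * \<bar>K\<bar> * (2 * ((1 + c') + a))"
  have D0: "0 \<le> D1" "0 \<le> D2" using c'0 a b by (auto simp: D1_def D2_def)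
  have diff: "moment_le M 1 (\<lambda>\<omega>. f (p T \<omega>, q T \<omega>) - f (P N \<omega>, Q N \<omega>)) (D2 * (T / real N))"
    "moment_le M 2 (\<lambda>\<omega>. f (p T \<omega>, q T \<omega>) - f (P N \<omega>, Q N \<omega>)) (D1 * (T / real N))"
    if sch: "scheme N P Q" for N P Q
  proof -
    note [measurable] = scheme_meas[OF sch order_refl]
    have N: "0 < N" using sch by simp
    have NT: "real N * (T / real N) = T" using N by simp
    have h: "0 < T / real N" using N T0 by simp
    have e2: "moment_le M 2 (\<lambda>\<omega>. norm ((p T \<omega>, q T \<omega>) - (P N \<omega>, Q N \<omega>))) (a * (T / real N)\<^sup>2)"
      by (rule moment_le_mono[OF a(2)[OF sch order_refl, unfolded NT]]) (auto intro!: AE_I2 order_trans[OF norm_Pair_le])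
    have eK: "moment_le M (2 * (r + 1)) (\<lambda>\<omega>. norm ((p T \<omega>, q T \<omega>) - (P N \<omega>, Q N \<omega>))) (b * (T / real N) ^ (r + 1))"
      by (rule moment_le_mono[OF b(2)[OF sch order_refl, unfolded NT]]) (auto intro!: AE_I2 order_trans[OF norm_Pair_le])
    have meas: "(\<lambda>\<omega>. (p T \<omega>, q T \<omega>)) \<in> borel_measurable M" "(\<lambda>\<omega>. (P N \<omega>, Q N \<omega>)) \<in> borel_measurable M"
      by (intro borel_measurable_Pair; measurable)+
    show "moment_le M 1 (\<lambda>\<omega>. f (p T \<omega>, q T \<omega>) - f (P N \<omega>, Q N \<omega>)) (D2 * (T / real N))"
      "moment_le M 2 (\<lambda>\<omega>. f (p T \<omega>, q T \<omega>) - f (P N \<omega>, Q N \<omega>)) (D1 * (T / real N))"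
      unfolding D1_def D2_def c'_def
      using moment_le_f_diff[OF X Y[OF sch] meas h e2 eK] by simp_all
  qed
  show ?thesis
  \<comment> \<open>The constants are enlarged by 1 to be positive: the bounds built from them in
    \<open>mlmc_error\<close> become weights by which one divides.\<close>
  proof (rule that[of "m c + m d + 1" "D1 + 1" "D2 + 1"])
    show "moment_le M 2 (\<lambda>\<omega>. f (p T \<omega>, q T \<omega>)) (m c + m d + 1)"
      by (rule moment_le_weaken[OF moment_le_f[OF X]]) (use m0 in \<open>auto simp: m_def intro!: borel_measurable_Pair\<close>)
    fix N P Q assume sch: "scheme N P Q"
    then have h: "0 \<le> T / real N" using T0 by simp
    note [measurable] = scheme_meas[OF sch order_refl]
    show "moment_le M 2 (\<lambda>\<omega>. f (P N \<omega>, Q N \<omega>)) (m c + m d + 1)"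
      by (rule moment_le_weaken[OF moment_le_f[OF Y[OF sch]]]) (use m0 in \<open>auto simp: m_def intro!: borel_measurable_Pair\<close>)
    show "moment_le M 2 (\<lambda>\<omega>. f (p T \<omega>, q T \<omega>) - f (P N \<omega>, Q N \<omega>)) ((D1 + 1) * (T / real N))"
      by (rule moment_le_weaken[OF diff(2)[OF sch]]) (use h in \<open>intro mult_right_mono; simp\<close>)
    show "moment_le M 1 (\<lambda>\<omega>. f (p T \<omega>, q T \<omega>) - f (P N \<omega>, Q N \<omega>)) ((D2 + 1) * (T / real N))"
      by (rule moment_le_weaken[OF diff(1)[OF sch]]) (use h in \<open>intro mult_right_mono; simp\<close>)
  qed (use m0 D0 in auto)
qed

end

end

section \<open>Convergence below the step size threshold and the multilevel estimate\<close>

context hamiltonian_sde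
begin

lemma le_threshold: "h \<le> 1 / (2 * B) \<Longrightarrow> h * B \<le> 1 / 2"
  using B by (simp add: field_simps)

lemma mean_square: "mean_square_order_one M T F W V' \<Sigma> p\<^sub>0 q\<^sub>0 p q (1 / (2 * B))"
proof -
  obtain a where a: "0 \<le> a" "\<And>N P Q n. scheme N P Q \<Longrightarrow> n \<le> N \<Longrightarrow> moment_le M 2
      (\<lambda>\<omega>. norm (p (real n * (T / real N)) \<omega> - P n \<omega>) + norm (q (real n * (T / real N)) \<omega> - Q n \<omega>)) (a * (T / real N)\<^sup>2)"
    by (rule error_mean_square) (rule that; simp)
  show ?thesis unfolding mean_square_order_one_def
  proof (intro exI[of _ "sqrt a"] allI impI, elim conjE)
    fix N P Q h n
    assume N: "0 < N" and h: "h = T / real N" "h \<le> 1 / (2 * B)"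
      and "drift_preserving_scheme M F W V' \<Sigma> p\<^sub>0 q\<^sub>0 h N P Q" and n: "n \<le> N"
    then have sch: "scheme N P Q" using le_threshold[OF h(2)] unfolding h(1) by blast
    have t: "real n * h \<in> {0..T}" using grid_mem[OF N n] h by simp
    note [measurable] = scheme_meas[OF sch n] solution_meas[OF t]
    let ?X = "\<lambda>\<omega>. (p (real n * h) \<omega> - P n \<omega>, q (real n * h) \<omega> - Q n \<omega>)"
    have "moment_le M 2 (\<lambda>\<omega>. norm (?X \<omega>)) (a * h\<^sup>2)"
      by (rule moment_le_mono[OF a(2)[OF sch n, folded h(1)]]) (auto intro!: AE_I2 order_trans[OF norm_Pair_le])
    from moment_leD(4,5)[OF this]
    have X: "integrable M (\<lambda>\<omega>. (norm (?X \<omega>))\<^sup>2)" "(\<integral>\<omega>. (norm (?X \<omega>))\<^sup>2 \<partial>M) \<le> a * h\<^sup>2" by simp_all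
    have "L2_norm M ?X \<le> sqrt (a * h\<^sup>2)" unfolding L2_norm_def using X(2) by (rule real_sqrt_le_mono)
    also have "\<dots> = sqrt a * h" using T0 N h by (simp add: real_sqrt_mult)
    finally show "integrable M (\<lambda>\<omega>. (norm (?X \<omega>))\<^sup>2) \<and> L2_norm M ?X \<le> sqrt a * h" using X(1) by blast
  qed
qed

text \<open>Weak order 1 is read off from the first moment of the difference. The multilevel bound
  is kept as a bound by a square; nonnegativity of the factor is recorded for the later passage to
  the root.\<close>

lemma weak_and_mlmc:
  fixes f :: "(real ^ 'm) \<times> (real ^ 'm) \<Rightarrow> real" and K :: real
  assumes f_diff: "\<And>x. f differentiable (at x)"
    and f_growth: "\<And>x. onorm (frechet_derivative f (at x)) \<le> K * (1 + norm x ^ r)"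
  shows "weak_order_one M T F W V' \<Sigma> p\<^sub>0 q\<^sub>0 p q f (1 / (2 * B))"
    and "(\<And>l. step_size T l \<le> 1 / (2 * B) \<and> drift_preserving_scheme M F W V' \<Sigma> p\<^sub>0 q\<^sub>0 (step_size T l) (2 ^ l) (P l) (Q l)) \<Longrightarrow>
      \<exists>C\<^sub>1 C\<^sub>2 C\<^sub>3. \<forall>\<epsilon>>0. \<forall>L S. mlmc_samples M (\<lambda>l \<omega>. f (P l (2 ^ l) \<omega>, Q l (2 ^ l) \<omega>)) (sample_size \<epsilon> L) L S \<longrightarrow>
        moment_le M 2 (\<lambda>\<omega>. (\<integral>\<omega>'. f (p T \<omega>', q T \<omega>') \<partial>M) - mlmc_estimator (sample_size \<epsilon> L) L S \<omega>)
          (((C\<^sub>1 + C\<^sub>3 + C\<^sub>2 * riemann_zeta (1 + \<epsilon>)) * step_size T L)\<^sup>2) \<and>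
        0 \<le> C\<^sub>1 + C\<^sub>3 + C\<^sub>2 * riemann_zeta (1 + \<epsilon>)"
proof -
  obtain D0 D1 D2 where D: "0 < D0" "0 < D1" "0 < D2"
    and X: "moment_le M 2 (\<lambda>\<omega>. f (p T \<omega>, q T \<omega>)) D0"
    and Y: "\<And>N P Q. scheme N P Q \<Longrightarrow> moment_le M 2 (\<lambda>\<omega>. f (P N \<omega>, Q N \<omega>)) D0"
    and strong: "\<And>N P Q. scheme N P Q \<Longrightarrow> moment_le M 2 (\<lambda>\<omega>. f (p T \<omega>, q T \<omega>) - f (P N \<omega>, Q N \<omega>)) (D1 * (T / real N))"
    and weak: "\<And>N P Q. scheme N P Q \<Longrightarrow> moment_le M 1 (\<lambda>\<omega>. f (p T \<omega>, q T \<omega>) - f (P N \<omega>, Q N \<omega>)) (D2 * (T / real N))"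
    by (rule test_function_moments[OF f_diff f_growth]) (rule that; simp)
  have int: "integrable M Z" if "moment_le M 2 Z c" for Z c
    using moment_leD(4)[OF moment_le_lower[OF that, of 1]] moment_leD(2)[OF that] by (simp add: integrable_abs_iff)
  have bias: "\<bar>(\<integral>\<omega>. f (p T \<omega>, q T \<omega>) \<partial>M) - (\<integral>\<omega>. f (P N \<omega>, Q N \<omega>) \<partial>M)\<bar> \<le> D2 * (T / real N)"
    if sch: "scheme N P Q" for N P Q
  proof -
    have "(\<integral>\<omega>. f (p T \<omega>, q T \<omega>) \<partial>M) - (\<integral>\<omega>. f (P N \<omega>, Q N \<omega>) \<partial>M) = (\<integral>\<omega>. f (p T \<omega>, q T \<omega>) - f (P N \<omega>, Q N \<omega>) \<partial>M)"
      using int[OF X] int[OF Y[OF sch]] by simp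
    also have "\<bar>\<dots>\<bar> \<le> (\<integral>\<omega>. \<bar>f (p T \<omega>, q T \<omega>) - f (P N \<omega>, Q N \<omega>)\<bar> ^ 1 \<partial>M)"
      unfolding power_one_right by (rule integral_abs_bound)
    also have "\<dots> \<le> D2 * (T / real N)" by (rule moment_leD(5)[OF weak[OF sch]])
    finally show ?thesis .
  qed
  show "weak_order_one M T F W V' \<Sigma> p\<^sub>0 q\<^sub>0 p q f (1 / (2 * B))"
    unfolding weak_order_one_def
  proof (intro conjI exI[of _ D2] allI impI; (elim conjE)?)
    show "integrable M (\<lambda>\<omega>. f (p T \<omega>, q T \<omega>))" by (rule int[OF X])
    fix N P Q h
    assume "0 < N" and h: "h = T / real N" "h \<le> 1 / (2 * B)"
      and "drift_preserving_scheme M F W V' \<Sigma> p\<^sub>0 q\<^sub>0 h N P Q"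
    then have sch: "scheme N P Q" using le_threshold[OF h(2)] unfolding h(1) by blast
    show "integrable M (\<lambda>\<omega>. f (P N \<omega>, Q N \<omega>))" by (rule int[OF Y[OF sch]])
    show "\<bar>(\<integral>\<omega>. f (p T \<omega>, q T \<omega>) \<partial>M) - (\<integral>\<omega>. f (P N \<omega>, Q N \<omega>) \<partial>M)\<bar> \<le> D2 * h"
      using bias[OF sch] h by simp
  qed
  assume "\<And>l. step_size T l \<le> 1 / (2 * B) \<and> drift_preserving_scheme M F W V' \<Sigma> p\<^sub>0 q\<^sub>0 (step_size T l) (2 ^ l) (P l) (Q l)"
  then have sch: "scheme (2 ^ l) (P l) (Q l)" for l
    using le_threshold[of "step_size T l"] by (simp add: step_size_def)
  define Z where "Z l \<omega> = f (P l (2 ^ l) \<omega>, Q l (2 ^ l) \<omega>)" for l \<omega>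
  have st: "T / real (2 ^ l) = step_size T l" for l by (simp add: step_size_def)
  have Zd: "moment_le M 2 (\<lambda>\<omega>. f (p T \<omega>, q T \<omega>) - Z l \<omega>) (D1 * step_size T l)" for l
    using strong[OF sch[of l]] unfolding st Z_def .
  have diff: "moment_le M 2 (\<lambda>\<omega>. Z l \<omega> - Z (l - 1) \<omega>) (12 * D1 * step_size T l)" if l: "0 < l" for l
  proof -
    obtain k where k: "l = Suc k" using l gr0_implies_Suc by blast
    \<comment> \<open>Neighbouring levels are compared through the exact solution.
      \<open>2\<^sup>2\<close> comes from \<open>moment_le_add\<close>, and
      \<open>step_size T k = 2 * step_size T l\<close> supplies the factor 3.\<close>
    have ev: "2\<^sup>2 * (D1 * step_size T k + \<bar>- 1\<bar>\<^sup>2 * (D1 * step_size T l)) = 12 * D1 * step_size T l"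
      by (simp add: k step_size_def)
    have "moment_le M 2 (\<lambda>\<omega>. (f (p T \<omega>, q T \<omega>) - Z k \<omega>) + - 1 * (f (p T \<omega>, q T \<omega>) - Z l \<omega>))
        (12 * D1 * step_size T l)"
      using moment_le_add[OF Zd moment_le_cmult[OF Zd]] unfolding ev[symmetric] .
    then show ?thesis by (simp add: k)
  qed
  have Z0: "moment_le M 2 (Z 0) D0" using Y[OF sch[of 0]] by (simp add: Z_def[abs_def])
  have Zb: "\<bar>(\<integral>\<omega>. f (p T \<omega>, q T \<omega>) \<partial>M) - expectation (Z l)\<bar> \<le> D2 * step_size T l" for l
    using bias[OF sch[of l]] unfolding st Z_def[abs_def] .
  have D1': "0 < 12 * D1" using D by simp
  have res: "moment_le M 2 (\<lambda>\<omega>. (\<integral>\<omega>'. f (p T \<omega>', q T \<omega>') \<partial>M) - mlmc_estimator (sample_size \<epsilon> L) L S \<omega>)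
      (((D2 + sqrt D0 / T + sqrt (12 * D1 / T) * riemann_zeta (1 + \<epsilon>)) * step_size T L)\<^sup>2)"
    and nonneg: "0 \<le> D2 + sqrt D0 / T + sqrt (12 * D1 / T) * riemann_zeta (1 + \<epsilon>)"
    if "0 < \<epsilon>" "mlmc_samples M Z (sample_size \<epsilon> L) L S" for \<epsilon> L S
  proof -
    show "moment_le M 2 (\<lambda>\<omega>. (\<integral>\<omega>'. f (p T \<omega>', q T \<omega>') \<partial>M) - mlmc_estimator (sample_size \<epsilon> L) L S \<omega>)
      (((D2 + sqrt D0 / T + sqrt (12 * D1 / T) * riemann_zeta (1 + \<epsilon>)) * step_size T L)\<^sup>2)"
      by (rule mlmc_error[OF T0 D(1) D1' D(3) Z0 diff Zb that])
    have "0 \<le> riemann_zeta (1 + \<epsilon>)" using zeta_partial_sum[OF that(1), of 0] by simp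
    then show "0 \<le> D2 + sqrt D0 / T + sqrt (12 * D1 / T) * riemann_zeta (1 + \<epsilon>)"
      using D T0 by (intro add_nonneg_nonneg mult_nonneg_nonneg) auto
  qed
  show "\<exists>C\<^sub>1 C\<^sub>2 C\<^sub>3. \<forall>\<epsilon>>0. \<forall>L S. mlmc_samples M (\<lambda>l \<omega>. f (P l (2 ^ l) \<omega>, Q l (2 ^ l) \<omega>)) (sample_size \<epsilon> L) L S \<longrightarrow>
        moment_le M 2 (\<lambda>\<omega>. (\<integral>\<omega>'. f (p T \<omega>', q T \<omega>') \<partial>M) - mlmc_estimator (sample_size \<epsilon> L) L S \<omega>)
          (((C\<^sub>1 + C\<^sub>3 + C\<^sub>2 * riemann_zeta (1 + \<epsilon>)) * step_size T L)\<^sup>2) \<and>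
        0 \<le> C\<^sub>1 + C\<^sub>3 + C\<^sub>2 * riemann_zeta (1 + \<epsilon>)"
    unfolding Z_def[symmetric]
    \<comment> \<open>The constants for \<open>C\<^sub>1\<close>, \<open>C\<^sub>2\<close> and
      \<open>C\<^sub>3\<close> stem from the bias, the level corrections and level 0, in this
      order.\<close>
    by (intro exI[of _ D2] exI[of _ "sqrt (12 * D1 / T)"] exI[of _ "sqrt D0 / T"] allI impI conjI)
       (simp_all only: res nonneg)
qed

end

lemma moment_le_imp_L2_norm:
  assumes "moment_le M 2 X (b\<^sup>2)" "0 \<le> b"
  shows "integrable M (\<lambda>\<omega>. (X \<omega>)\<^sup>2) \<and> L2_norm M X \<le> b"
  using moment_leD(4,5)[OF assms(1)] assms(2) by (simp add: L2_norm_def real_le_lsqrt)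

text \<open>The threshold depends on the Lipschitz constant only and so precedes all probabilistic
  data. Finite energy says nothing about \<open>q\<^sub>0\<close> when \<open>V = 0\<close>; the
  moment assumed of the initial values is what makes \<open>f\<close> of the final state square
  integrable. The constants are found before \<open>\<epsilon>\<close>, \<open>L\<close> and the
  samples.\<close>

theorem corollary9:
  fixes V :: "real ^ 'm \<Rightarrow> real"
    and V' :: "real ^ 'm \<Rightarrow> real ^ 'm"
    and f :: "(real ^ 'm) \<times> (real ^ 'm) \<Rightarrow> real"
    and K :: real and r :: nat
  assumes V_smooth: "smooth V"
    and V_grad: "\<And>x. GDERIV V x :> V' x"
    and V'_lipschitz: "\<exists>B. B-lipschitz_on UNIV V'"
    and f_diff: "\<And>x. f differentiable (at x)"
    and f_growth: "\<And>x. onorm (frechet_derivative f (at x)) \<le> K * (1 + norm x ^ r)"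
  shows "\<exists>hs>0. \<forall>(M :: 'a measure) T F (W :: real \<Rightarrow> 'a \<Rightarrow> real ^ 'd) \<Sigma> p\<^sub>0 q\<^sub>0 p q.
    hamiltonian_setting M T F W V V' \<Sigma> p\<^sub>0 q\<^sub>0 p q \<and>
    integrable M (\<lambda>\<omega>. norm (p\<^sub>0 \<omega>, q\<^sub>0 \<omega>) ^ (2 * (r + 1))) \<longrightarrow>
      mean_square_order_one M T F W V' \<Sigma> p\<^sub>0 q\<^sub>0 p q hs \<and>
      weak_order_one M T F W V' \<Sigma> p\<^sub>0 q\<^sub>0 p q f hs \<and>
      (\<forall>P Q. (\<forall>l. step_size T l \<le> hs \<and>
             drift_preserving_scheme M F W V' \<Sigma> p\<^sub>0 q\<^sub>0 (step_size T l) (2 ^ l) (P l) (Q l)) \<longrightarrow>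
        (\<exists>C\<^sub>1 C\<^sub>2 C\<^sub>3. \<forall>\<epsilon>>0. \<forall>L>0. \<forall>S.
           mlmc_samples M (\<lambda>l \<omega>. f (P l (2 ^ l) \<omega>, Q l (2 ^ l) \<omega>)) (sample_size \<epsilon> L) L S \<longrightarrow>
           (let err = (\<lambda>\<omega>. (\<integral>\<omega>'. f (p T \<omega>', q T \<omega>') \<partial>M)
                            - mlmc_estimator (sample_size \<epsilon> L) L S \<omega>)
            in integrable M (\<lambda>\<omega>. (err \<omega>)\<^sup>2) \<and>
               L2_norm M err \<le> (C\<^sub>1 + C\<^sub>3 + C\<^sub>2 * riemann_zeta (1 + \<epsilon>)) * step_size T L)) \<and>
        (\<forall>\<epsilon>>0. \<forall>cost. cost \<in> O(\<lambda>l. 1 / step_size T l) \<longrightarrow>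
           (\<lambda>L. mlmc_work cost (sample_size \<epsilon> L) L)
             \<in> O(\<lambda>L. 1 / (step_size T L)\<^sup>2 * real L powr (3 + 2 * \<epsilon>))))"
proof -
  obtain B' where B': "B'-lipschitz_on UNIV V'" using V'_lipschitz by blast
  define B where "B = max 1 B'"
  have B: "B-lipschitz_on UNIV V'" "1 \<le> B"
    using lipschitz_on_mono[OF B' subset_refl, of B] by (auto simp: B_def)
  show ?thesis
  proof (intro exI[of _ "1 / (2 * B)"] conjI[of "_ < _"] allI impI, goal_cases)
    case 1
    then show ?case using B by simp
  next
    case (2 M T F W \<Sigma> p\<^sub>0 q\<^sub>0 p q)
    then have set: "hamiltonian_setting M T F W V V' \<Sigma> p\<^sub>0 q\<^sub>0 p q"
      and mom: "integrable M (\<lambda>\<omega>. norm (p\<^sub>0 \<omega>, q\<^sub>0 \<omega>) ^ (2 * (r + 1)))" by auto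
    from set have ps: "prob_space M" and T: "0 < T" by (auto simp: hamiltonian_setting_def)
    interpret prob_space M by (rule ps)
    interpret hamiltonian_sde M T F W V' B \<Sigma> p\<^sub>0 q\<^sub>0 p q r
      using set mom B by unfold_locales (auto simp: hamiltonian_setting_def)
    show ?case
    proof (intro conjI mean_square weak_and_mlmc(1)[OF f_diff f_growth] allI impI, goal_cases)
      case (1 P Q)
      then have sch: "step_size T l \<le> 1 / (2 * B) \<and> drift_preserving_scheme M F W V' \<Sigma> p\<^sub>0 q\<^sub>0 (step_size T l) (2 ^ l) (P l) (Q l)" for l
        by blast
      from weak_and_mlmc(2)[OF f_diff f_growth sch] obtain C\<^sub>1 C\<^sub>2 C\<^sub>3 where
        C: "\<And>\<epsilon> L S. 0 < \<epsilon> \<Longrightarrow> mlmc_samples M (\<lambda>l \<omega>. f (P l (2 ^ l) \<omega>, Q l (2 ^ l) \<omega>)) (sample_size \<epsilon> L) L S \<Longrightarrow>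
          moment_le M 2 (\<lambda>\<omega>. (\<integral>\<omega>'. f (p T \<omega>', q T \<omega>') \<partial>M) - mlmc_estimator (sample_size \<epsilon> L) L S \<omega>)
            (((C\<^sub>1 + C\<^sub>3 + C\<^sub>2 * riemann_zeta (1 + \<epsilon>)) * step_size T L)\<^sup>2) \<and>
          0 \<le> C\<^sub>1 + C\<^sub>3 + C\<^sub>2 * riemann_zeta (1 + \<epsilon>)" by blast
      have h: "0 \<le> step_size T L" for L using T by (simp add: step_size_def)
      show ?case
        unfolding Let_def
        by (intro exI[of _ C\<^sub>1] exI[of _ C\<^sub>2] exI[of _ C\<^sub>3] allI impI moment_le_imp_L2_norm)
           (use C h in \<open>auto intro: mult_nonneg_nonneg\<close>)
    next
      case (2 P Q \<epsilon> cost)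
      then show ?case using mlmc_work_bigo[OF T] by blast
    qed
  qed
qed

end
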